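(* Let $A$ be a commutative ring, $M$ an $A$-module generated by $n$ elements and $k\ge0$ an integer. Then $M$ is projective of constant rank $k$ if and only if there exist an integer $m\le\binom{n}{k}$ and elements $s_1,\ldots,s_m$ of $A$ such that $s_1A+\cdots+s_mA=A$ and each module $M_{s_i}$ is free of rank $k$ over $A_{s_i}$.
   Context: For $s\in A$, $A_s=A[1/s]$ and $M_s$ is the localization of $M$ ($A_s$ may be trivial). A finitely generated projective module $M$ over a nontrivial commutative ring $A$ is said to be of constant rank $k$ if, for every matrix $G\in\mathrm{Mat}_q(A)$ (any $q$) with $G^2=G$ and image isomorphic to $M$, the characteristic polynomial $\det(X\mathrm{I}_q-G)$ is equal, up to nilpotent elements of $A$ (coefficientwise), to $(X-1)^kX^{q-k}$ (it is equivalent to require this for one such $G$). By convention, over the trivial ring the trivial module is projective of constant rank $k$, and free of rank $k$, for every integer $k\ge 0$. *)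

theory Defs
  imports "HOL-Algebra.UnivPoly" "HOL-Combinatorics.Permutations"
begin

section \<open>Modules\<close>

text \<open>The fields \<open>mult\<close> and \<open>one\<close> of a module record carry no meaning; they are left
  \<open>undefined\<close> below.\<close>

definition module_iso ::
    "('a, 'r) ring_scheme \<Rightarrow> ('a, 'b, 'm) module_scheme \<Rightarrow> ('a, 'c, 'n) module_scheme \<Rightarrow> bool"
  where "module_iso R M N \<longleftrightarrow>
    (\<exists>f. bij_betw f (carrier M) (carrier N) \<and>
      (\<forall>x\<in>carrier M. \<forall>y\<in>carrier M. f (x \<oplus>\<^bsub>M\<^esub> y) = f x \<oplus>\<^bsub>N\<^esub> f y) \<and>
      (\<forall>a\<in>carrier R. \<forall>x\<in>carrier M. f (a \<odot>\<^bsub>M\<^esub> x) = a \<odot>\<^bsub>N\<^esub> f x))"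

definition generated_by_n ::
    "('a, 'r) ring_scheme \<Rightarrow> ('a, 'b, 'm) module_scheme \<Rightarrow> nat \<Rightarrow> bool"
  where "generated_by_n R M n \<longleftrightarrow>
    (\<exists>g \<in> {..<n} \<rightarrow> carrier M. \<forall>x\<in>carrier M.
      \<exists>a \<in> {..<n} \<rightarrow> carrier R. x = (\<Oplus>\<^bsub>M\<^esub>i\<in>{..<n}. a i \<odot>\<^bsub>M\<^esub> g i))"

definition free_module :: "('a, 'r) ring_scheme \<Rightarrow> nat \<Rightarrow> ('a, nat \<Rightarrow> 'a) module"
  where "free_module R k = \<lparr>
    carrier = {..<k} \<rightarrow>\<^sub>E carrier R,
    monoid.mult = undefined,
    one = undefined,
    zero = (\<lambda>i\<in>{..<k}. \<zero>\<^bsub>R\<^esub>),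
    add = (\<lambda>u v. \<lambda>i\<in>{..<k}. u i \<oplus>\<^bsub>R\<^esub> v i),
    smult = (\<lambda>a u. \<lambda>i\<in>{..<k}. a \<otimes>\<^bsub>R\<^esub> u i)\<rparr>"

definition free_of_rank ::
    "('a, 'r) ring_scheme \<Rightarrow> ('a, 'b, 'm) module_scheme \<Rightarrow> nat \<Rightarrow> bool"
  where "free_of_rank R M k \<longleftrightarrow> module_iso R M (free_module R k)"

text \<open>Finitely generated projective means: isomorphic to a direct summand of some \<open>R\<^sup>q\<close>.\<close>

definition fg_projective :: "('a, 'r) ring_scheme \<Rightarrow> ('a, 'b, 'm) module_scheme \<Rightarrow> bool"
  where "fg_projective R M \<longleftrightarrow>
    (\<exists>q P N. submodule P R (free_module R q) \<and> submodule N R (free_module R q) \<and>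
      P \<inter> N = {\<zero>\<^bsub>free_module R q\<^esub>} \<and>
      P <+>\<^bsub>free_module R q\<^esub> N = carrier (free_module R q) \<and>
      module_iso R M ((free_module R q)\<lparr>carrier := P\<rparr>))"


section \<open>Square matrices and constant rank\<close>

text \<open>A \<open>q \<times> q\<close> matrix is a function of two indices, of which only the values at indices
  below \<open>q\<close> matter.\<close>

definition sq_matrix :: "('a, 'r) ring_scheme \<Rightarrow> nat \<Rightarrow> (nat \<Rightarrow> nat \<Rightarrow> 'a) \<Rightarrow> bool"
  where "sq_matrix R q G \<longleftrightarrow> (\<forall>i<q. \<forall>j<q. G i j \<in> carrier R)"

definition idempotent_matrix :: "('a, 'r) ring_scheme \<Rightarrow> nat \<Rightarrow> (nat \<Rightarrow> nat \<Rightarrow> 'a) \<Rightarrow> bool"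
  where "idempotent_matrix R q G \<longleftrightarrow>
    (\<forall>i<q. \<forall>j<q. (\<Oplus>\<^bsub>R\<^esub>l\<in>{..<q}. G i l \<otimes>\<^bsub>R\<^esub> G l j) = G i j)"

definition mat_apply ::
    "('a, 'r) ring_scheme \<Rightarrow> nat \<Rightarrow> (nat \<Rightarrow> nat \<Rightarrow> 'a) \<Rightarrow> (nat \<Rightarrow> 'a) \<Rightarrow> (nat \<Rightarrow> 'a)"
  where "mat_apply R q G u = (\<lambda>i\<in>{..<q}. \<Oplus>\<^bsub>R\<^esub>j\<in>{..<q}. G i j \<otimes>\<^bsub>R\<^esub> u j)"

definition mat_image ::
    "('a, 'r) ring_scheme \<Rightarrow> nat \<Rightarrow> (nat \<Rightarrow> nat \<Rightarrow> 'a) \<Rightarrow> ('a, nat \<Rightarrow> 'a) module"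
  where "mat_image R q G =
    (free_module R q)\<lparr>carrier := mat_apply R q G ` carrier (free_module R q)\<rparr>"

definition mat_det :: "('a, 'r) ring_scheme \<Rightarrow> nat \<Rightarrow> (nat \<Rightarrow> nat \<Rightarrow> 'a) \<Rightarrow> 'a"
  where "mat_det R q G =
    (\<Oplus>\<^bsub>R\<^esub>p\<in>{p. p permutes {..<q}}.
      if evenperm p then \<Otimes>\<^bsub>R\<^esub>i\<in>{..<q}. G i (p i)
      else \<ominus>\<^bsub>R\<^esub> (\<Otimes>\<^bsub>R\<^esub>i\<in>{..<q}. G i (p i)))"

definition UP_X :: "('a, 'r) ring_scheme \<Rightarrow> nat \<Rightarrow> 'a"
  where "UP_X R = monom (UP R) \<one>\<^bsub>R\<^esub> 1"

definition char_polynomial ::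
    "('a, 'r) ring_scheme \<Rightarrow> nat \<Rightarrow> (nat \<Rightarrow> nat \<Rightarrow> 'a) \<Rightarrow> (nat \<Rightarrow> 'a)"
  where "char_polynomial R q G =
    mat_det (UP R) q
      (\<lambda>i j. (if i = j then UP_X R else \<zero>\<^bsub>UP R\<^esub>) \<ominus>\<^bsub>UP R\<^esub> monom (UP R) (G i j) 0)"

definition nilpotent_elem :: "('a, 'r) ring_scheme \<Rightarrow> 'a \<Rightarrow> bool"
  where "nilpotent_elem R a \<longleftrightarrow> a \<in> carrier R \<and> (\<exists>e::nat. a [^]\<^bsub>R\<^esub> e = \<zero>\<^bsub>R\<^esub>)"

definition equal_up_to_nilpotents ::
    "('a, 'r) ring_scheme \<Rightarrow> (nat \<Rightarrow> 'a) \<Rightarrow> (nat \<Rightarrow> 'a) \<Rightarrow> bool"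
  where "equal_up_to_nilpotents R f g \<longleftrightarrow>
    (\<forall>i. nilpotent_elem R (coeff (UP R) f i \<ominus>\<^bsub>R\<^esub> coeff (UP R) g i))"

text \<open>Over the trivial ring every module is trivial and counts as projective of constant rank
  \<open>k\<close> for every \<open>k\<close>, so the condition on characteristic polynomials is imposed over nontrivial
  rings only. There, \<open>k \<le> q\<close> is required for \<open>(X - 1)\<^sup>k X\<^sup>q\<^sup>-\<^sup>k\<close> to be a polynomial.\<close>

definition projective_of_constant_rank ::
    "('a, 'r) ring_scheme \<Rightarrow> ('a, 'b, 'm) module_scheme \<Rightarrow> nat \<Rightarrow> bool"
  where "projective_of_constant_rank R M k \<longleftrightarrow>
    fg_projective R M \<and>
    (carrier R \<noteq> {\<zero>\<^bsub>R\<^esub>} \<longrightarrow>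
      (\<forall>q G. sq_matrix R q G \<and> idempotent_matrix R q G \<and> module_iso R M (mat_image R q G) \<longrightarrow>
        k \<le> q \<and>
        equal_up_to_nilpotents R (char_polynomial R q G)
          ((UP_X R \<ominus>\<^bsub>UP R\<^esub> \<one>\<^bsub>UP R\<^esub>) [^]\<^bsub>UP R\<^esub> k \<otimes>\<^bsub>UP R\<^esub> UP_X R [^]\<^bsub>UP R\<^esub> (q - k))))"


section \<open>Localization\<close>

text \<open>Elements of the localization of \<open>M\<close> at a multiplicative subset \<open>S\<close> of \<open>R\<close> are classes of
  pairs \<open>(x, t)\<close>, read as \<open>x / t\<close>, with \<open>x / t = y / u\<close> iff \<open>v u x = v t y\<close> for some
  \<open>v \<in> S\<close>. The operations are given on representatives, the union being over a family of
  equal classes.\<close>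

definition loc_rel ::
    "('a, 'r) ring_scheme \<Rightarrow> 'a set \<Rightarrow> ('a, 'b, 'm) module_scheme \<Rightarrow> (('b \<times> 'a) \<times> ('b \<times> 'a)) set"
  where "loc_rel R S M =
    {((x, t), (y, u)). x \<in> carrier M \<and> t \<in> S \<and> y \<in> carrier M \<and> u \<in> S \<and>
      (\<exists>v\<in>S. (v \<otimes>\<^bsub>R\<^esub> u) \<odot>\<^bsub>M\<^esub> x = (v \<otimes>\<^bsub>R\<^esub> t) \<odot>\<^bsub>M\<^esub> y)}"

definition loc_frac ::
    "('a, 'r) ring_scheme \<Rightarrow> 'a set \<Rightarrow> ('a, 'b, 'm) module_scheme \<Rightarrow> 'b \<Rightarrow> 'a \<Rightarrow> ('b \<times> 'a) set"
  where "loc_frac R S M x t = loc_rel R S M `` {(x, t)}"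

definition loc_module ::
    "('a, 'r) ring_scheme \<Rightarrow> 'a set \<Rightarrow> ('a, 'b, 'm) module_scheme
      \<Rightarrow> (('a \<times> 'a) set, ('b \<times> 'a) set) module"
  where "loc_module R S M = \<lparr>
    carrier = (carrier M \<times> S) // loc_rel R S M,
    monoid.mult = undefined,
    one = undefined,
    zero = loc_frac R S M \<zero>\<^bsub>M\<^esub> \<one>\<^bsub>R\<^esub>,
    add = (\<lambda>X Y. \<Union>(x, t)\<in>X. \<Union>(y, u)\<in>Y.
      loc_frac R S M (u \<odot>\<^bsub>M\<^esub> x \<oplus>\<^bsub>M\<^esub> t \<odot>\<^bsub>M\<^esub> y) (t \<otimes>\<^bsub>R\<^esub> u)),
    smult = (\<lambda>A X. \<Union>(a, t)\<in>A. \<Union>(x, u)\<in>X.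
      loc_frac R S M (a \<odot>\<^bsub>M\<^esub> x) (t \<otimes>\<^bsub>R\<^esub> u))\<rparr>"

definition self_module :: "('a, 'r) ring_scheme \<Rightarrow> ('a, 'a) module"
  where "self_module R = \<lparr>
    carrier = carrier R,
    monoid.mult = undefined,
    one = undefined,
    zero = \<zero>\<^bsub>R\<^esub>,
    add = (\<lambda>x y. x \<oplus>\<^bsub>R\<^esub> y),
    smult = (\<lambda>a x. a \<otimes>\<^bsub>R\<^esub> x)\<rparr>"

definition loc_ring :: "('a, 'r) ring_scheme \<Rightarrow> 'a set \<Rightarrow> ('a \<times> 'a) set ring"
  where "loc_ring R S = \<lparr>
    carrier = carrier (loc_module R S (self_module R)),
    monoid.mult = (\<lambda>X Y. \<Union>(x, t)\<in>X. \<Union>(y, u)\<in>Y.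
      loc_frac R S (self_module R) (x \<otimes>\<^bsub>R\<^esub> y) (t \<otimes>\<^bsub>R\<^esub> u)),
    one = loc_frac R S (self_module R) \<one>\<^bsub>R\<^esub> \<one>\<^bsub>R\<^esub>,
    zero = zero (loc_module R S (self_module R)),
    add = add (loc_module R S (self_module R))\<rparr>"

definition powers_of :: "('a, 'r) ring_scheme \<Rightarrow> 'a \<Rightarrow> 'a set"
  where "powers_of R s = range (\<lambda>i::nat. s [^]\<^bsub>R\<^esub> i)"

abbreviation ring_at :: "('a, 'r) ring_scheme \<Rightarrow> 'a \<Rightarrow> ('a \<times> 'a) set ring"
  where "ring_at R s \<equiv> loc_ring R (powers_of R s)"

abbreviation module_at ::
    "('a, 'r) ring_scheme \<Rightarrow> ('a, 'b, 'm) module_scheme \<Rightarrow> 'a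
      \<Rightarrow> (('a \<times> 'a) set, ('b \<times> 'a) set) module"
  where "module_at R M s \<equiv> loc_module R (powers_of R s) M"

end

theory Submission
  imports "Jordan_Normal_Form.Char_Poly" Defs
begin

text \<open>
  A module is finitely generated projective iff it has a dual basis: elements \<open>w\<^sub>j\<close> and linear
  forms \<open>\<phi>\<^sub>j\<close> with \<open>x = \<Sum>\<^sub>j \<phi>\<^sub>j(x) w\<^sub>j\<close>. The \<open>w\<^sub>j\<close> may be exchanged for any generators, and \<open>G = (\<phi>\<^sub>i(w\<^sub>j))\<close>
  is an idempotent matrix with image \<open>M\<close>; all idempotent matrices with that image arise so
  (\<open>fg_projective_imp_dual_basis\<close>, \<open>dual_basis_mat_image\<close>, \<open>mat_image_dual_basis\<close>). In the same spirit,
  \<open>M\<^sub>s\<close> is free of rank \<open>k\<close> when, for some power \<open>t\<close> of \<open>s\<close>, there are \<open>k\<close> elements \<open>e\<^sub>l\<close> and linear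
  forms \<open>\<psi>\<^sub>l\<close> on \<open>M\<close> itself with \<open>\<Sum>\<^sub>l \<psi>\<^sub>l(x) e\<^sub>l = t x\<close> and \<open>\<psi>\<^sub>l(e\<^sub>m) = t \<delta>\<^sub>l\<^sub>m\<close>: a local basis.

  From constant rank to local freeness. Let \<open>G\<close> be the matrix of a dual basis on the \<open>n\<close> generators.
  Up to sign, the coefficient of \<open>X\<^sup>n\<^sup>-\<^sup>k\<close> in \<open>det(X - G)\<close> is the sum of the principal minors of order
  \<open>k\<close>, and the rank condition says that it is \<open>1\<close> up to sign and a nilpotent. So that sum is a unit
  and the \<open>n choose k\<close> minors are comaximal. Let \<open>s\<close> be the minor on the index set \<open>S\<close>. Over \<open>A\<^sub>s\<close>
  the columns of \<open>G\<close> in \<open>S\<close> are a basis of the image of an idempotent \<open>T\<close> with \<open>GT = TG = T\<close>, and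
  \<open>H = G - T\<close> is an idempotent orthogonal to \<open>T\<close>. As \<open>(X - T)(X - H) = X(X - G)\<close> and
  \<open>det(X - T) = X\<^sup>n\<^sup>-\<^sup>k (X - 1)\<^sup>k\<close>, the rank condition forces \<open>det(X - H) = X\<^sup>n\<close> up to nilpotents. At
  \<open>X = 1\<close> this makes \<open>1 - H\<close> invertible, while \<open>H(1 - H) = 0\<close>; hence \<open>H = 0\<close>, the image of \<open>G\<close> is
  free over \<open>A\<^sub>s\<close>, and the generators with index in \<open>S\<close> are a basis (\<open>idempotent_eq_factored_part\<close>).

  From local freeness to constant rank. A basis of \<open>M\<^sub>s\<close> yields elements of \<open>M\<close>, but coordinates only
  up to powers of \<open>s\<close> that depend on the element. They become linear forms on \<open>M\<close> because finitely
  many relations between the generators of \<open>M\<close> control all others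
  (\<open>weak_local_bases_rectify\<close>). A combination \<open>\<Sum> a\<^sub>i t\<^sub>i = 1\<close> then glues the local bases to a dual
  basis. Given any idempotent \<open>G\<close> of size \<open>q\<close> with image \<open>M\<close>, the matrices \<open>U = (\<phi>\<^sub>p(e\<^sub>l))\<close> and
  \<open>V = (\<psi>\<^sub>l(w\<^sub>j))\<close> satisfy \<open>UV = tG\<close> and \<open>VU = t\<close>, so Sylvester's determinant identity gives
  \<open>X\<^sup>k det(X - G) = X\<^sup>q (X - 1)\<^sup>k\<close> up to a power of \<open>t\<close>, and comaximality removes that power.

  Matrices and polynomials are taken over a type with a ring structure, whereas \<open>A\<close> is a ring on a
  carrier set. The two are linked by \<open>cring_prod\<close>, a product of commutative rings that has every
  such ring as a direct factor.
\<close>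

(* From here on, coeff and monom are those of the polynomial type. *)
hide_const (open) up_ring.coeff up_ring.monom

section \<open>Nilpotent elements and polynomials with nilpotent coefficients\<close>

definition nilpotent :: "'a::comm_ring_1 \<Rightarrow> bool" where
  "nilpotent a \<longleftrightarrow> (\<exists>e. a ^ e = 0)"

lemma nilpotent_0 [simp]: "nilpotent 0"
  unfolding nilpotent_def by (rule exI[of _ 1]) simp

lemma nilpotent_mult: "nilpotent a \<Longrightarrow> nilpotent (b * a)"
  unfolding nilpotent_def by (metis mult_zero_right power_mult_distrib)

lemma nilpotent_add:
  assumes "nilpotent a" "nilpotent b"
  shows "nilpotent (a + b)"
proof -
  obtain m n where m: "a ^ m = 0" and n: "b ^ n = 0"
    using assms unfolding nilpotent_def by auto
  have "of_nat (m + n choose i) * a ^ i * b ^ (m + n - i) = 0" for i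
  proof (cases "m \<le> i")
    case True
    then have "a ^ i = a ^ m * a ^ (i - m)" by (metis le_add_diff_inverse power_add)
    then show ?thesis using m by simp
  next
    case False
    then have "m + n - i = n + (m - i)" by simp
    then have "b ^ (m + n - i) = b ^ n * b ^ (m - i)" by (simp add: power_add)
    then show ?thesis using n by simp
  qed
  then have "(a + b) ^ (m + n) = 0" by (simp add: binomial_ring)
  then show ?thesis unfolding nilpotent_def by blast
qed

lemma nilpotent_sum: "(\<And>i. i \<in> I \<Longrightarrow> nilpotent (f i)) \<Longrightarrow> nilpotent (sum f I)"
  by (induction I rule: infinite_finite_induct) (auto intro: nilpotent_add)

lemma one_plus_nilpotent_unit:
  assumes "nilpotent z"
  obtains b where "(1 + z) * b = 1"
proof -
  obtain e where "z ^ e = 0" using assms unfolding nilpotent_def by auto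
  then have "(1 - (- z)) * (\<Sum>i<e. (- z) ^ i) = 1"
    using one_diff_power_eq[of "- z" e] by (simp add: power_minus[of z])
  then show ?thesis using that by simp
qed

definition nilpotent_coeffs :: "'a::comm_ring_1 poly \<Rightarrow> bool" where
  "nilpotent_coeffs p \<longleftrightarrow> (\<forall>i. nilpotent (coeff p i))"

lemma nilpotent_coeffs_mult: "nilpotent_coeffs p \<Longrightarrow> nilpotent_coeffs (q * p)"
  unfolding nilpotent_coeffs_def coeff_mult by (auto intro!: nilpotent_sum nilpotent_mult)

lemma nilpotent_coeffs_poly: "nilpotent_coeffs p \<Longrightarrow> nilpotent (poly p x)"
  unfolding nilpotent_coeffs_def poly_altdef mult.commute[of "coeff p i" for i]
  by (blast intro: nilpotent_sum nilpotent_mult)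

lemma nilpotent_coeffs_cancel_X_power:
  assumes "nilpotent_coeffs ([:0, 1:] ^ a * p)"
  shows "nilpotent_coeffs p"
  unfolding nilpotent_coeffs_def
proof
  fix i
  have "coeff ([:0, 1:] ^ a * p) (a + i) = coeff p i"
    unfolding x_as_monom x_pow_n by (simp add: coeff_monom_mult)
  then show "nilpotent (coeff p i)"
    using assms[unfolded nilpotent_coeffs_def, rule_format, of "a + i"] by simp
qed

text \<open>The coefficients of \<open>(X - 1) p\<close> are differences of consecutive coefficients of \<open>p\<close>, so nilpotency
  descends from the coefficients above the degree, which vanish.\<close>
lemma nilpotent_coeffs_cancel_X_minus_1:
  assumes "nilpotent_coeffs ([:-1, 1:] * p)"
  shows "nilpotent_coeffs p"
proof -
  have step: "nilpotent (coeff p i)" if "nilpotent (coeff p (Suc i))" for i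
  proof -
    have "coeff ([:-1, 1:] * p) (Suc i) = coeff p i - coeff p (Suc i)"
      by simp
    then have "coeff p i = coeff ([:-1, 1:] * p) (Suc i) + coeff p (Suc i)" by simp
    moreover have "nilpotent (coeff ([:-1, 1:] * p) (Suc i))"
      using assms unfolding nilpotent_coeffs_def by blast
    ultimately show ?thesis using that by (metis nilpotent_add)
  qed
  have "nilpotent (coeff p (Suc (degree p) - d))" for d
  proof (induction d)
    case 0
    then show ?case by (simp add: coeff_eq_0)
  next
    case (Suc d)
    show ?case
    proof (cases "d \<le> degree p")
      case True
      then have "Suc (Suc (degree p) - Suc d) = Suc (degree p) - d" by simp
      then show ?thesis using step[of "Suc (degree p) - Suc d"] Suc by simp
    qed (use Suc in simp)
  qed
  note low = this
  have "nilpotent (coeff p i)" for i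
  proof (cases "i \<le> degree p")
    case True
    then have "Suc (degree p) - (Suc (degree p) - i) = i" by linarith
    then show ?thesis using low[of "Suc (degree p) - i"] by metis
  qed (simp add: coeff_eq_0)
  then show ?thesis unfolding nilpotent_coeffs_def by blast
qed

lemma nilpotent_coeffs_cancel_X_minus_1_power:
  "nilpotent_coeffs ([:-1, 1:] ^ k * p) \<Longrightarrow> nilpotent_coeffs p"
proof (induction k)
  case (Suc k)
  from Suc.prems have "nilpotent_coeffs ([:-1, 1:] * ([:-1, 1:] ^ k * p))"
    by (simp only: power_Suc mult.assoc)
  then show ?case by (rule Suc.IH[OF nilpotent_coeffs_cancel_X_minus_1])
qed simp

section \<open>Sylvester's determinant identity\<close>

text \<open>This lemma and the next evaluate determinants of block triangular matrices one of whose diagonal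
  blocks is scalar, by repeated Laplace expansion along the first, respectively last, row.\<close>
lemma det_first_rows_scalar:
  fixes W :: "'a::comm_ring_1 mat"
  assumes "W \<in> carrier_mat (q + k) (q + k)"
    and "\<And>i j. i < q \<Longrightarrow> j < q + k \<Longrightarrow> W $$ (i, j) = (if i = j then y else 0)"
  shows "det W = y ^ q * det (mat k k (\<lambda>(i, j). W $$ (q + i, q + j)))"
  using assms
proof (induction q arbitrary: W)
  case 0
  then have "mat k k (\<lambda>(i, j). W $$ (0 + i, 0 + j)) = W" by (intro eq_matI) auto
  then show ?case by simp
next
  case (Suc q)
  have W: "W \<in> carrier_mat (Suc (q + k)) (Suc (q + k))" using Suc.prems(1) by simp
  have "det W = (\<Sum>j<Suc (q + k). W $$ (0, j) * cofactor W 0 j)"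
    using laplace_expansion_row[OF W] by simp
  also have "\<dots> = (\<Sum>j<Suc (q + k). if j = 0 then y * cofactor W 0 0 else 0)"
    using Suc.prems(2)[of 0] by (intro sum.cong) auto
  also have "\<dots> = y * det (mat_delete W 0 0)"
    by (simp add: cofactor_def)
  also have "det (mat_delete W 0 0)
      = y ^ q * det (mat k k (\<lambda>(i, j). mat_delete W 0 0 $$ (q + i, q + j)))"
  proof (rule Suc.IH)
    show "mat_delete W 0 0 \<in> carrier_mat (q + k) (q + k)" using mat_delete_carrier[OF W] by simp
    fix i j assume "i < q" "j < q + k"
    then show "mat_delete W 0 0 $$ (i, j) = (if i = j then y else 0)"
      using W Suc.prems(2) by (auto simp: mat_delete_def)
  qed
  also have "mat k k (\<lambda>(i, j). mat_delete W 0 0 $$ (q + i, q + j))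
      = mat k k (\<lambda>(i, j). W $$ (Suc q + i, Suc q + j))"
    using W by (intro eq_matI) (auto simp: mat_delete_def)
  finally show ?case by (simp add: mult.assoc)
qed

lemma det_last_rows_scalar:
  fixes W :: "'a::comm_ring_1 mat"
  assumes "W \<in> carrier_mat (q + k) (q + k)"
    and "\<And>i j. q \<le> i \<Longrightarrow> i < q + k \<Longrightarrow> j < q + k \<Longrightarrow> W $$ (i, j) = (if i = j then y else 0)"
  shows "det W = y ^ k * det (mat q q (\<lambda>(i, j). W $$ (i, j)))"
  using assms
proof (induction k arbitrary: W)
  case 0
  then have "mat q q (\<lambda>(i, j). W $$ (i, j)) = W" by (intro eq_matI) auto
  then show ?case by simp
next
  case (Suc k)
  let ?l = "q + k"
  have W: "W \<in> carrier_mat (Suc ?l) (Suc ?l)" using Suc.prems(1) by simp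
  have "det W = (\<Sum>j<Suc ?l. W $$ (?l, j) * cofactor W ?l j)"
    using laplace_expansion_row[OF W] by simp
  also have "\<dots> = (\<Sum>j<Suc ?l. if j = ?l then y * cofactor W ?l ?l else 0)"
    using Suc.prems(2)[of ?l] by (intro sum.cong) auto
  also have "\<dots> = y * det (mat_delete W ?l ?l)"
    by (simp add: cofactor_def)
  also have "det (mat_delete W ?l ?l)
      = y ^ k * det (mat q q (\<lambda>(i, j). mat_delete W ?l ?l $$ (i, j)))"
  proof (rule Suc.IH)
    show "mat_delete W ?l ?l \<in> carrier_mat (q + k) (q + k)" using mat_delete_carrier[OF W] by simp
    fix i j assume "q \<le> i" "i < q + k" "j < q + k"
    then show "mat_delete W ?l ?l $$ (i, j) = (if i = j then y else 0)"
      using W Suc.prems(2) by (auto simp: mat_delete_def)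
  qed
  also have "mat q q (\<lambda>(i, j). mat_delete W ?l ?l $$ (i, j))
      = mat q q (\<lambda>(i, j). W $$ (i, j))"
    using W by (intro eq_matI) (auto simp: mat_delete_def)
  finally show ?case by (simp add: mult.assoc)
qed

text \<open>Both sides come from the block matrix \<open>W\<close> with rows \<open>(y, U)\<close> and \<open>(V, 1)\<close>: the unipotent \<open>P\<close> clears
  its lower left block and leaves \<open>y - U V\<close>, while \<open>Q\<close>, of determinant \<open>y\<^sup>k\<close>, clears the upper right
  block and leaves \<open>y - V U\<close>.\<close>
lemma sylvester_determinant:
  fixes U V :: "'a::comm_ring_1 mat"
  assumes U: "U \<in> carrier_mat q k" and V: "V \<in> carrier_mat k q"
  shows "y ^ k * det (y \<cdot>\<^sub>m 1\<^sub>m q - U * V) = y ^ q * det (y \<cdot>\<^sub>m 1\<^sub>m k - V * U)"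
proof -
  let ?W = "four_block_mat (y \<cdot>\<^sub>m 1\<^sub>m q) U V (1\<^sub>m k)"
  let ?P = "four_block_mat (1\<^sub>m q) (0\<^sub>m q k) (- V) (1\<^sub>m k)"
  let ?Q = "four_block_mat (1\<^sub>m q) (- U) (0\<^sub>m k q) (y \<cdot>\<^sub>m 1\<^sub>m k)"
  have W: "?W \<in> carrier_mat (q + k) (q + k)" using U V by auto
  have P: "?P \<in> carrier_mat (q + k) (q + k)" using U V by auto
  have Q: "?Q \<in> carrier_mat (q + k) (q + k)" using U V by auto
  have "det ?P = 1 ^ q * det (mat k k (\<lambda>(i, j). ?P $$ (q + i, q + j)))"
    by (rule det_first_rows_scalar[OF P]) auto
  also have "mat k k (\<lambda>(i, j). ?P $$ (q + i, q + j)) = 1\<^sub>m k"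
    using V by (intro eq_matI) auto
  finally have detP: "det ?P = 1" by simp
  have "det ?Q = y ^ k * det (mat q q (\<lambda>(i, j). ?Q $$ (i, j)))"
    by (rule det_last_rows_scalar[OF Q]) auto
  also have "mat q q (\<lambda>(i, j). ?Q $$ (i, j)) = 1\<^sub>m q"
    using U by (intro eq_matI) auto
  finally have detQ: "det ?Q = y ^ k" by simp
  have "?W * ?P = four_block_mat (y \<cdot>\<^sub>m 1\<^sub>m q * 1\<^sub>m q + U * - V) (y \<cdot>\<^sub>m 1\<^sub>m q * 0\<^sub>m q k + U * 1\<^sub>m k)
      (V * 1\<^sub>m q + 1\<^sub>m k * - V) (V * 0\<^sub>m q k + 1\<^sub>m k * 1\<^sub>m k)"
    by (rule mult_four_block_mat) (use U V in auto)
  also have "\<dots> = four_block_mat (y \<cdot>\<^sub>m 1\<^sub>m q - U * V) U (0\<^sub>m k q) (1\<^sub>m k)"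
    using U V by (intro cong_four_block_mat eq_matI) auto
  finally have WP: "?W * ?P = four_block_mat (y \<cdot>\<^sub>m 1\<^sub>m q - U * V) U (0\<^sub>m k q) (1\<^sub>m k)" .
  have "?W * ?Q = four_block_mat (y \<cdot>\<^sub>m 1\<^sub>m q * 1\<^sub>m q + U * 0\<^sub>m k q)
      (y \<cdot>\<^sub>m 1\<^sub>m q * - U + U * (y \<cdot>\<^sub>m 1\<^sub>m k))
      (V * 1\<^sub>m q + 1\<^sub>m k * 0\<^sub>m k q) (V * - U + 1\<^sub>m k * (y \<cdot>\<^sub>m 1\<^sub>m k))"
    by (rule mult_four_block_mat) (use U V in auto)
  also have "\<dots> = four_block_mat (y \<cdot>\<^sub>m 1\<^sub>m q) (0\<^sub>m q k) V (y \<cdot>\<^sub>m 1\<^sub>m k - V * U)"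
    using U V by (intro cong_four_block_mat eq_matI) (auto simp: mult_smult_distrib mult_smult_assoc_mat[of _ q q _ k])
  finally have WQ: "?W * ?Q = four_block_mat (y \<cdot>\<^sub>m 1\<^sub>m q) (0\<^sub>m q k) V (y \<cdot>\<^sub>m 1\<^sub>m k - V * U)" .
  have "det (?W * ?P) = 1 ^ k * det (mat q q (\<lambda>(i, j). (?W * ?P) $$ (i, j)))"
    unfolding WP by (rule det_last_rows_scalar) (use U V in auto)
  also have "mat q q (\<lambda>(i, j). (?W * ?P) $$ (i, j)) = y \<cdot>\<^sub>m 1\<^sub>m q - U * V"
    unfolding WP using U V by (intro eq_matI) auto
  finally have 1: "det ?W = det (y \<cdot>\<^sub>m 1\<^sub>m q - U * V)"
    using det_mult[OF W P] detP by simp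
  have "det (?W * ?Q) = y ^ q * det (mat k k (\<lambda>(i, j). (?W * ?Q) $$ (q + i, q + j)))"
    unfolding WQ by (rule det_first_rows_scalar) (use U V in auto)
  also have "mat k k (\<lambda>(i, j). (?W * ?Q) $$ (q + i, q + j)) = y \<cdot>\<^sub>m 1\<^sub>m k - V * U"
    unfolding WQ using U V by (intro eq_matI) auto
  finally have "det ?W * y ^ k = y ^ q * det (y \<cdot>\<^sub>m 1\<^sub>m k - V * U)"
    using det_mult[OF W Q] detQ by simp
  then show ?thesis using 1 by (simp add: mult.commute)
qed

section \<open>Principal minors and the characteristic polynomial\<close>

lemma X_power_monom: "[:0, 1:] ^ n = monom (1::'a::comm_ring_1) n"
  unfolding x_as_monom x_pow_n ..

text \<open>The determinant of this matrix is the principal minor of \<open>G\<close> on \<open>S\<close>. Filling up with rows of the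
  identity avoids a renumbering of \<open>S\<close>.\<close>
definition principal_minor_mat :: "'a::comm_ring_1 mat \<Rightarrow> nat set \<Rightarrow> 'a mat" where
  "principal_minor_mat G S = mat (dim_row G) (dim_row G)
     (\<lambda>(i, j). if i \<in> S then G $$ (i, j) else if i = j then 1 else 0)"

lemma monom_prod: "finite I \<Longrightarrow> (\<Prod>i\<in>I. monom (f i) (d i)) = monom (\<Prod>i\<in>I. f i) (\<Sum>i\<in>I. d i)"
  by (induction I rule: finite_induct) (auto simp: mult_monom)

lemma monom_sum: "monom (sum f I) d = (\<Sum>i\<in>I. monom (f i) d)"
  by (induction I rule: infinite_finite_induct) (auto simp: add_monom[symmetric])

text \<open>In the Leibniz formula every factor is \<open>X \<delta> - G\<close> at \<open>(i, p i)\<close>. Multiply out and let \<open>S\<close> be the set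
  of rows from which \<open>- G\<close> is chosen; the remaining rows contribute a power of \<open>X\<close> and the rows of
  the identity matrix.\<close>
lemma char_poly_principal_minors:
  fixes G :: "'a::comm_ring_1 mat"
  assumes G: "G \<in> carrier_mat n n"
  shows "char_poly G
    = (\<Sum>S\<in>Pow {0..<n}. monom ((-1) ^ card S * det (principal_minor_mat G S)) (n - card S))"
proof -
  let ?N = "{0..<n}"
  have row: "(\<Prod>i\<in>?N. char_poly_matrix G $$ (i, p i))
      = (\<Sum>S\<in>Pow ?N. monom ((-1) ^ card S * (\<Prod>i\<in>?N. principal_minor_mat G S $$ (i, p i))) (n - card S))"
    if p: "p permutes ?N" for p
  proof -
    have pn: "p i < n" if "i < n" for i using permutes_in_image[OF p, of i] that by simp
    have "(\<Prod>i\<in>?N. char_poly_matrix G $$ (i, p i))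
        = (\<Prod>i\<in>?N. monom (- G $$ (i, p i)) 0 + monom (if i = p i then 1 else 0) 1)"
      using G pn by (intro prod.cong) (auto simp: char_poly_matrix_def monom_0 monom_Suc one_pCons)
    also have "\<dots> = (\<Sum>S\<in>Pow ?N. (\<Prod>i\<in>S. monom (- G $$ (i, p i)) 0)
        * (\<Prod>i\<in>?N - S. monom (if i = p i then 1 else 0) 1))"
      by (rule prod_add) simp
    also have "\<dots> = (\<Sum>S\<in>Pow ?N. monom ((-1) ^ card S *
        (\<Prod>i\<in>?N. principal_minor_mat G S $$ (i, p i))) (n - card S))"
    proof (rule sum.cong[OF refl])
      fix S assume "S \<in> Pow ?N"
      then have S: "S \<subseteq> ?N" by simp
      then have fin: "finite S" by (rule finite_subset) simp
      have "(\<Prod>i\<in>?N. principal_minor_mat G S $$ (i, p i))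
          = (\<Prod>i\<in>?N - S. principal_minor_mat G S $$ (i, p i)) * (\<Prod>i\<in>S. principal_minor_mat G S $$ (i, p i))"
        using S by (rule prod.subset_diff) simp
      also have "(\<Prod>i\<in>S. principal_minor_mat G S $$ (i, p i)) = (\<Prod>i\<in>S. G $$ (i, p i))"
        using S G pn by (intro prod.cong) (auto simp: principal_minor_mat_def subset_iff)
      also have "(\<Prod>i\<in>?N - S. principal_minor_mat G S $$ (i, p i)) = (\<Prod>i\<in>?N - S. if i = p i then 1 else 0)"
        using S G pn by (intro prod.cong) (auto simp: principal_minor_mat_def)
      finally have pm: "(\<Prod>i\<in>?N. principal_minor_mat G S $$ (i, p i))
          = (\<Prod>i\<in>?N - S. if i = p i then 1 else 0) * (\<Prod>i\<in>S. G $$ (i, p i))" .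
      show "(\<Prod>i\<in>S. monom (- G $$ (i, p i)) 0) * (\<Prod>i\<in>?N - S. monom (if i = p i then 1 else 0) 1)
          = monom ((-1) ^ card S * (\<Prod>i\<in>?N. principal_minor_mat G S $$ (i, p i))) (n - card S)"
        unfolding pm using S fin
        by (simp add: monom_prod mult_monom prod_uminus card_Diff_subset mult_ac)
    qed
    finally show ?thesis .
  qed
  have "char_poly G = (\<Sum>p | p permutes ?N. of_int (sign p) * (\<Prod>i\<in>?N. char_poly_matrix G $$ (i, p i)))"
    unfolding char_poly_def by (rule det_def') (use G in simp)
  also have "\<dots> = (\<Sum>p | p permutes ?N. of_int (sign p) * (\<Sum>S\<in>Pow ?N. monom ((-1) ^ card S *
        (\<Prod>i\<in>?N. principal_minor_mat G S $$ (i, p i))) (n - card S)))"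
    by (rule sum.cong) (use row in auto)
  also have "\<dots> = (\<Sum>S\<in>Pow ?N. \<Sum>p | p permutes ?N. monom ((-1) ^ card S * (of_int (sign p) *
        (\<Prod>i\<in>?N. principal_minor_mat G S $$ (i, p i)))) (n - card S))"
    unfolding sum_distrib_left
    by (subst sum.swap, intro sum.cong refl)
      (simp add: of_int_poly[symmetric] mult_monom monom_0[symmetric] mult_ac sign_def minus_monom)
  also have "\<dots> = (\<Sum>S\<in>Pow ?N. monom ((-1) ^ card S * det (principal_minor_mat G S)) (n - card S))"
    using G by (intro sum.cong refl) 
      (subst det_def'[of _ n], auto simp: principal_minor_mat_def monom_sum sum_distrib_left)
  finally show ?thesis .
qed

lemma coeff_char_poly_principal_minors:
  fixes G :: "'a::comm_ring_1 mat"
  assumes G: "G \<in> carrier_mat n n" and k: "k \<le> n"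
  shows "poly.coeff (char_poly G) (n - k)
    = (-1) ^ k * (\<Sum>S | S \<subseteq> {0..<n} \<and> card S = k. det (principal_minor_mat G S))"
proof -
  have "poly.coeff (char_poly G) (n - k)
    = (\<Sum>S\<in>Pow {0..<n}. if card S = k then (-1) ^ k * det (principal_minor_mat G S) else 0)"
    unfolding char_poly_principal_minors[OF G] coeff_sum
  proof (rule sum.cong[OF refl])
    fix S assume "S \<in> Pow {0..<n}"
    then have "card S \<le> n" using card_mono[of "{0..<n}" S] by simp
    then show "poly.coeff (monom ((-1) ^ card S * det (principal_minor_mat G S)) (n - card S)) (n - k)
        = (if card S = k then (-1) ^ k * det (principal_minor_mat G S) else 0)"
      using k by auto
  qed
  also have "\<dots> = (\<Sum>S | S \<subseteq> {0..<n} \<and> card S = k. (-1) ^ k * det (principal_minor_mat G S))"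
    by (subst sum.inter_filter[symmetric]) (auto simp: Pow_def intro!: sum.cong)
  finally show ?thesis by (simp add: sum_distrib_left)
qed

section \<open>Characteristic polynomials of idempotent matrices\<close>

interpretation const_poly_hom: comm_ring_hom "\<lambda>a :: 'a::comm_ring_1. [:a:]"
  by unfold_locales (auto simp: one_pCons)

abbreviation const_mat :: "'a::comm_ring_1 mat \<Rightarrow> 'a poly mat" where
  "const_mat \<equiv> map_mat (\<lambda>a. [:a:])"

lemma const_mat_mult:
  "A \<in> carrier_mat m n \<Longrightarrow> B \<in> carrier_mat n l \<Longrightarrow> const_mat (A * B) = const_mat A * const_mat B"
  by (rule const_poly_hom.mat_hom_mult)

lemma scaled_char_poly:
  fixes G :: "'a::comm_ring_1 mat"
  assumes "G \<in> carrier_mat n n"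
  shows "det ([:0, t:] \<cdot>\<^sub>m 1\<^sub>m n - const_mat (t \<cdot>\<^sub>m G)) = [:t:] ^ n * char_poly G"
proof -
  have "[:0, t:] \<cdot>\<^sub>m 1\<^sub>m n - const_mat (t \<cdot>\<^sub>m G) = [:t:] \<cdot>\<^sub>m char_poly_matrix G"
    using assms by (intro eq_matI) (auto simp: char_poly_matrix_def)
  moreover have "dim_col (char_poly_matrix G) = n" using char_poly_matrix_closed[OF assms] by (rule carrier_matD(2))
  ultimately show ?thesis by (simp add: char_poly_def)
qed

text \<open>Where \<open>t\<close> is invertible, \<open>G\<close> is an idempotent whose image has the columns of \<open>U\<close> as a basis, and its
  characteristic polynomial is \<open>X\<^sup>q\<^sup>-\<^sup>k (X - 1)\<^sup>k\<close>. This is Sylvester's identity for \<open>y = t X\<close>, with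
  denominators cleared; the form chosen is meaningful for \<open>k > q\<close> too.\<close>
lemma char_poly_factored:
  fixes G :: "'a::comm_ring_1 mat"
  assumes G: "G \<in> carrier_mat q q" and U: "U \<in> carrier_mat q k" and V: "V \<in> carrier_mat k q"
    and UV: "U * V = t \<cdot>\<^sub>m G" and VU: "V * U = t \<cdot>\<^sub>m 1\<^sub>m k"
  shows "[:t:] ^ (q + k) * ([:0, 1:] ^ k * char_poly G) = [:t:] ^ (q + k) * ([:0, 1:] ^ q * [:-1, 1:] ^ k)"
proof -
  have y: "[:0, t:] = [:t:] * [:0, 1:]" by simp
  have "[:0, t:] ^ k * det ([:0, t:] \<cdot>\<^sub>m 1\<^sub>m q - const_mat U * const_mat V)
      = [:0, t:] ^ q * det ([:0, t:] \<cdot>\<^sub>m 1\<^sub>m k - const_mat V * const_mat U)"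
    by (rule sylvester_determinant) (use U V in auto)
  also have "[:0, t:] \<cdot>\<^sub>m 1\<^sub>m k - const_mat V * const_mat U = ([:t:] * [:-1, 1:]) \<cdot>\<^sub>m 1\<^sub>m k"
    unfolding const_mat_mult[OF V U, symmetric] VU by (intro eq_matI) auto
  finally have "[:0, t:] ^ k * ([:t:] ^ q * char_poly G) = [:0, t:] ^ q * ([:t:] * [:-1, 1:]) ^ k"
    unfolding const_mat_mult[OF U V, symmetric] UV scaled_char_poly[OF G] by simp
  then show ?thesis unfolding y power_mult_distrib power_add by (simp only: mult_ac)
qed

text \<open>The projection onto the coordinates in \<open>S\<close>. Working with it keeps all matrices of size \<open>n\<close>, instead
  of passing to submatrices of size \<open>card S\<close>.\<close>
definition coord_proj :: "nat \<Rightarrow> nat set \<Rightarrow> 'a::comm_ring_1 mat" where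
  "coord_proj n S = mat n n (\<lambda>(i, j). if i = j \<and> i \<in> S then 1 else 0)"

lemma coord_proj_carrier [simp]: "coord_proj n S \<in> carrier_mat n n"
  by (simp add: coord_proj_def)

lemma coord_proj_dim [simp]: "dim_row (coord_proj n S) = n" "dim_col (coord_proj n S) = n"
  by (simp_all add: coord_proj_def)

lemma coord_proj_mult_left:
  assumes "A \<in> carrier_mat n l"
  shows "coord_proj n S * A = mat n l (\<lambda>(i, j). if i \<in> S then A $$ (i, j) else 0)"
proof (rule eq_matI)
  fix i j assume "i < dim_row (mat n l (\<lambda>(i, j). if i \<in> S then A $$ (i, j) else 0))"
    "j < dim_col (mat n l (\<lambda>(i, j). if i \<in> S then A $$ (i, j) else 0))"
  then have ij: "i < n" "j < l" by auto
  have "(coord_proj n S * A) $$ (i, j) = (\<Sum>h\<in>{0..<n}. coord_proj n S $$ (i, h) * A $$ (h, j))"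
    using ij assms by (simp add: scalar_prod_def)
  also have "\<dots> = (\<Sum>h\<in>{0..<n}. if h = i then (if i \<in> S then A $$ (i, j) else 0) else 0)"
    using ij by (intro sum.cong) (auto simp: coord_proj_def)
  finally show "(coord_proj n S * A) $$ (i, j) = mat n l (\<lambda>(i, j). if i \<in> S then A $$ (i, j) else 0) $$ (i, j)"
    using ij by simp
qed (use assms in \<open>auto simp: coord_proj_def\<close>)

lemma coord_proj_mult_right:
  assumes "A \<in> carrier_mat l n"
  shows "A * coord_proj n S = mat l n (\<lambda>(i, j). if j \<in> S then A $$ (i, j) else 0)"
proof (rule eq_matI)
  fix i j assume "i < dim_row (mat l n (\<lambda>(i, j). if j \<in> S then A $$ (i, j) else 0))"
    "j < dim_col (mat l n (\<lambda>(i, j). if j \<in> S then A $$ (i, j) else 0))"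
  then have ij: "i < l" "j < n" by auto
  have "(A * coord_proj n S) $$ (i, j) = (\<Sum>h\<in>{0..<n}. A $$ (i, h) * coord_proj n S $$ (h, j))"
    using ij assms by (simp add: scalar_prod_def)
  also have "\<dots> = (\<Sum>h\<in>{0..<n}. if h = j then (if j \<in> S then A $$ (i, j) else 0) else 0)"
    using ij by (intro sum.cong) (auto simp: coord_proj_def)
  finally show "(A * coord_proj n S) $$ (i, j) = mat l n (\<lambda>(i, j). if j \<in> S then A $$ (i, j) else 0) $$ (i, j)"
    using ij by simp
qed (use assms in \<open>auto simp: coord_proj_def\<close>)

lemma det_scalar_minus_coord_proj:
  fixes y z :: "'b::comm_ring_1"
  assumes S: "S \<subseteq> {0..<n}" "card S = k"
  shows "det (y \<cdot>\<^sub>m 1\<^sub>m n - z \<cdot>\<^sub>m coord_proj n S) = y ^ (n - k) * (y - z) ^ k"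
proof -
  let ?A = "y \<cdot>\<^sub>m 1\<^sub>m n - z \<cdot>\<^sub>m coord_proj n S"
  have fin: "finite S" using S finite_subset by blast
  have A: "?A \<in> carrier_mat n n" using coord_proj_carrier by (intro minus_carrier_mat smult_carrier_mat)
  have entry: "?A $$ (i, j) = (if i = j then if i \<in> S then y - z else y else 0)" if "i < n" "j < n" for i j
    using that by (auto simp: coord_proj_def)
  have "det ?A = prod_list (diag_mat ?A)"
  proof (rule det_lower_triangular[OF _ A])
    fix i j assume "i < j" "j < n"
    then show "?A $$ (i, j) = 0" by (subst entry) auto
  qed
  also have "\<dots> = (\<Prod>i\<in>{0..<n}. if i \<in> S then y - z else y)"
    unfolding prod_list_diag_prod carrier_matD(1)[OF A] by (intro prod.cong refl, subst entry) auto
  also have "\<dots> = (\<Prod>i\<in>{0..<n} - S. y) * (\<Prod>i\<in>S. y - z)"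
    by (subst prod.subset_diff[OF S(1)]) (auto intro!: arg_cong2[of _ _ _ _ "(*)"] prod.cong)
  also have "\<dots> = y ^ (n - k) * (y - z) ^ k"
    using S fin by (simp add: card_Diff_subset)
  finally show ?thesis .
qed

lemma scalar_minus_mult:
  fixes A B :: "'b::comm_ring_1 mat"
  assumes A: "A \<in> carrier_mat n n" and B: "B \<in> carrier_mat n n" and AB: "A * B = 0\<^sub>m n n"
  shows "(y \<cdot>\<^sub>m 1\<^sub>m n - A) * (y \<cdot>\<^sub>m 1\<^sub>m n - B) = y \<cdot>\<^sub>m (y \<cdot>\<^sub>m 1\<^sub>m n - (A + B))"
proof -
  have 1: "y \<cdot>\<^sub>m 1\<^sub>m n \<in> carrier_mat n n" by simp
  have yB: "y \<cdot>\<^sub>m 1\<^sub>m n - B \<in> carrier_mat n n" using B by (rule minus_carrier_mat)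
  have "(y \<cdot>\<^sub>m 1\<^sub>m n - A) * (y \<cdot>\<^sub>m 1\<^sub>m n - B)
      = y \<cdot>\<^sub>m 1\<^sub>m n * (y \<cdot>\<^sub>m 1\<^sub>m n - B) - A * (y \<cdot>\<^sub>m 1\<^sub>m n - B)"
    by (rule minus_mult_distrib_mat[OF 1 A yB])
  also have "y \<cdot>\<^sub>m 1\<^sub>m n * (y \<cdot>\<^sub>m 1\<^sub>m n - B) = y \<cdot>\<^sub>m (y \<cdot>\<^sub>m 1\<^sub>m n - B)"
    unfolding mult_smult_assoc_mat[OF one_carrier_mat yB] left_mult_one_mat[OF yB] ..
  also have "A * (y \<cdot>\<^sub>m 1\<^sub>m n - B) = A * (y \<cdot>\<^sub>m 1\<^sub>m n) - A * B"
    by (rule mult_minus_distrib_mat[OF A 1 B])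
  also have "A * (y \<cdot>\<^sub>m 1\<^sub>m n) = y \<cdot>\<^sub>m A"
    using A by (simp add: mult_smult_distrib[of _ n n _ n])
  finally show ?thesis
    unfolding AB using A B by (intro eq_matI) (auto simp: algebra_simps)
qed

lemma power_mult_eqI:
  fixes z w h :: "'a::comm_ring_1"
  assumes "z * h = w * h"
  shows "z ^ r * h = w ^ r * h"
proof (induction r)
  case (Suc r)
  have "z ^ Suc r * h = z ^ r * (z * h)" by (simp only: power_Suc2 mult.assoc)
  also have "\<dots> = w * (z ^ r * h)" unfolding assms by (simp only: mult_ac)
  also have "\<dots> = w ^ Suc r * h" unfolding Suc by (simp only: power_Suc mult.assoc)
  finally show ?case .
qed simp

text \<open>Let \<open>T = G J V\<close> with the projection \<open>J\<close> to \<open>S\<close>, and \<open>H = s G - T\<close>. Where \<open>s\<close> is invertible,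
  \<open>s\<^sup>-\<^sup>1 T\<close> is an idempotent below \<open>G\<close> whose image is free of rank \<open>k\<close>, and \<open>s\<^sup>-\<^sup>1 H\<close> is its complement
  in \<open>G\<close>. With \<open>y = s X\<close>, the determinant of \<open>(y - T)(y - H) = s y (X - G)\<close> and the hypothesis on the
  characteristic polynomial of \<open>G\<close> make \<open>det(y - H)\<close> equal to \<open>y\<^sup>n\<close> up to a power of \<open>s\<close> and
  nilpotents. At \<open>X = 1\<close> the determinant of \<open>s - H\<close> is thus a power of \<open>s\<close> up to a nilpotent, and
  \<open>H (s - H) = 0\<close> shows that a power of \<open>s\<close> kills \<open>H\<close>.\<close>
lemma idempotent_eq_factored_part:
  fixes G :: "'a::comm_ring_1 mat"
  assumes G: "G \<in> carrier_mat n n" and GG: "G * G = G"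
    and S: "S \<subseteq> {0..<n}" "card S = k"
    and V: "V \<in> carrier_mat n n" and VG: "V * G = V" and JV: "coord_proj n S * V = V"
    and VU: "V * (G * coord_proj n S) = s \<cdot>\<^sub>m coord_proj n S"
    and nil: "nilpotent_coeffs ([:s:] * (char_poly G - [:0, 1:] ^ (n - k) * [:-1, 1:] ^ k))"
  shows "\<exists>N. s ^ N \<cdot>\<^sub>m (G * coord_proj n S * V) = s ^ Suc N \<cdot>\<^sub>m G"
proof -
  define J where "J = (coord_proj n S :: 'a mat)"
  define U where "U = G * J"
  define T where "T = U * V"
  define H where "H = s \<cdot>\<^sub>m G - T"
  have J: "J \<in> carrier_mat n n" unfolding J_def by simp
  have U: "U \<in> carrier_mat n n" unfolding U_def using G J by simp
  have T: "T \<in> carrier_mat n n" unfolding T_def using U V by simp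
  have H: "H \<in> carrier_mat n n" unfolding H_def using T by (rule minus_carrier_mat)
  have sG: "s \<cdot>\<^sub>m G \<in> carrier_mat n n" using G by simp
  have VU': "V * U = s \<cdot>\<^sub>m J" using VU unfolding U_def J_def .
  have kn: "k \<le> n" using card_mono[OF _ S(1)] S(2) by simp
  have GT: "G * T = T"
  proof -
    have "G * T = G * U * V" unfolding T_def using G U V by (simp add: assoc_mult_mat[of _ n n _ n _ n])
    also have "G * U = G * G * J" unfolding U_def using G J by (simp add: assoc_mult_mat[of _ n n _ n _ n])
    finally show ?thesis unfolding GG U_def[symmetric] T_def[symmetric] .
  qed
  have TG: "T * G = T"
    unfolding T_def using U V G VG by (simp add: assoc_mult_mat[of _ n n _ n _ n])
  have TT: "T * T = s \<cdot>\<^sub>m T"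
  proof -
    have "T * T = U * ((V * U) * V)" unfolding T_def using U V by (simp add: assoc_mult_mat[of _ n n _ n _ n])
    also have "(V * U) * V = s \<cdot>\<^sub>m V" unfolding VU' using J V JV by (simp add: mult_smult_assoc_mat[of _ n n _ n] J_def)
    also have "U * (s \<cdot>\<^sub>m V) = s \<cdot>\<^sub>m T" unfolding T_def using U V by (simp add: mult_smult_distrib[of _ n n _ n])
    finally show ?thesis .
  qed
  have TH: "T * H = 0\<^sub>m n n"
  proof -
    have "T * H = T * (s \<cdot>\<^sub>m G) - T * T" unfolding H_def by (rule mult_minus_distrib_mat[OF T sG T])
    also have "T * (s \<cdot>\<^sub>m G) = s \<cdot>\<^sub>m T" using T G TG by (simp add: mult_smult_distrib[of _ n n _ n])
    finally show ?thesis unfolding TT using T by simp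
  qed
  have GH: "G * H = H"
  proof -
    have "G * H = G * (s \<cdot>\<^sub>m G) - G * T" unfolding H_def by (rule mult_minus_distrib_mat[OF G sG T])
    also have "G * (s \<cdot>\<^sub>m G) = s \<cdot>\<^sub>m G" using G GG by (simp add: mult_smult_distrib[of _ n n _ n])
    finally show ?thesis unfolding GT H_def[symmetric] .
  qed
  have HH: "H * H = s \<cdot>\<^sub>m H"
  proof -
    have "H * H = s \<cdot>\<^sub>m G * H - T * H" by (subst (1) H_def) (rule minus_mult_distrib_mat[OF sG T H])
    also have "s \<cdot>\<^sub>m G * H = s \<cdot>\<^sub>m H" using G H GH by (simp add: mult_smult_assoc_mat[of _ n n _ n])
    finally show ?thesis unfolding TH using H by (intro eq_matI) auto
  qed
  let ?X = "[:0, 1:] :: 'a poly" and ?L = "[:-1, 1:] :: 'a poly" and ?c = "[:s:]" and ?y = "[:0, s:]"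
  have y: "?y = ?c * ?X" and yc: "?y - ?c = ?c * ?L" by simp_all
  \<comment> \<open>The variable is scaled: \<open>y = s X\<close> clears the denominators of the characteristic polynomials of \<open>s\<^sup>-\<^sup>1 T\<close> and \<open>s\<^sup>-\<^sup>1 H\<close>.\<close>
  define P where "P = det (?y \<cdot>\<^sub>m 1\<^sub>m n - const_mat H)"
  have detT: "?y ^ n * det (?y \<cdot>\<^sub>m 1\<^sub>m n - const_mat T) = ?y ^ n * (?y ^ (n - k) * (?c * ?L) ^ k)"
  proof -
    have "?y ^ n * det (?y \<cdot>\<^sub>m 1\<^sub>m n - const_mat U * const_mat V)
        = ?y ^ n * det (?y \<cdot>\<^sub>m 1\<^sub>m n - const_mat V * const_mat U)"
      by (rule sylvester_determinant) (use U V in auto)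
    also have "const_mat V * const_mat U = ?c \<cdot>\<^sub>m coord_proj n S"
      unfolding const_mat_mult[OF V U, symmetric] VU' J_def
      by (intro eq_matI) (auto simp: coord_proj_def)
    finally show ?thesis
      unfolding det_scalar_minus_coord_proj[OF S] yc const_mat_mult[OF U V, symmetric] T_def[symmetric] .
  qed
  have "det (?y \<cdot>\<^sub>m 1\<^sub>m n - const_mat T) * P = (?c * ?y) ^ n * char_poly G"
  proof -
    have cTH: "const_mat T * const_mat H = 0\<^sub>m n n"
      unfolding const_mat_mult[OF T H, symmetric] TH by (intro eq_matI) auto
    have "(?y \<cdot>\<^sub>m 1\<^sub>m n - const_mat T) * (?y \<cdot>\<^sub>m 1\<^sub>m n - const_mat H)
        = ?y \<cdot>\<^sub>m (?y \<cdot>\<^sub>m 1\<^sub>m n - (const_mat T + const_mat H))"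
      by (rule scalar_minus_mult) (use T H cTH in auto)
    also have "const_mat T + const_mat H = const_mat (s \<cdot>\<^sub>m G)"
      unfolding H_def using T G by (intro eq_matI) auto
    finally have "det (?y \<cdot>\<^sub>m 1\<^sub>m n - const_mat T) * P = det (?y \<cdot>\<^sub>m (?y \<cdot>\<^sub>m 1\<^sub>m n - const_mat (s \<cdot>\<^sub>m G)))"
      unfolding P_def using T H by (subst det_mult[of _ n, symmetric]) auto
    also have "\<dots> = ?y ^ n * (?c ^ n * char_poly G)"
      unfolding det_smult scaled_char_poly[OF G] using G by simp
    finally show ?thesis by (simp only: power_mult_distrib mult_ac)
  qed
  then have "?y ^ n * det (?y \<cdot>\<^sub>m 1\<^sub>m n - const_mat T) * P = ?y ^ n * ((?c * ?y) ^ n * char_poly G)"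
    by (simp only: mult.assoc)
  then have "?y ^ n * (?y ^ (n - k) * (?c * ?L) ^ k) * P = ?y ^ n * ((?c * ?y) ^ n * char_poly G)"
    unfolding detT .
  then have "?X ^ n * (?X ^ (n - k) * (?L ^ k * (?c ^ n * (?c ^ (n - k) * ?c ^ k) * P)))
      = ?X ^ n * (?X ^ n * (?c ^ n * ?c ^ n * ?c ^ n * char_poly G))"
    unfolding y power_mult_distrib by (simp only: mult_ac)
  moreover have "?c ^ (n - k) * ?c ^ k = ?c ^ n" using kn by (simp add: power_add[symmetric])
  ultimately have key: "?X ^ n * (?X ^ (n - k) * (?L ^ k * (?c ^ n * ?c ^ n * P)))
      = ?X ^ n * (?X ^ n * (?c ^ n * ?c ^ n * ?c ^ n * char_poly G))"
    by (simp only:)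
  \<comment> \<open>\<open>D = 0\<close> would say that \<open>det(y - H) = y\<^sup>n\<close> up to a power of \<open>s\<close>. The extra factor \<open>c\<close> is the one for which \<open>nil\<close> provides nilpotency.\<close>
  define D where "D = ?c * (?c ^ n * ?c ^ n * P - ?c ^ n * ?c ^ n * ?c ^ n * ?X ^ n)"
  let ?\<nu> = "char_poly G - ?X ^ (n - k) * ?L ^ k"
  have "?X ^ n * (?X ^ (n - k) * (?L ^ k * D))
      = ?c * (?X ^ n * (?X ^ (n - k) * (?L ^ k * (?c ^ n * ?c ^ n * P))))
        - ?c * (?X ^ n * (?X ^ (n - k) * (?L ^ k * (?c ^ n * ?c ^ n * ?c ^ n * ?X ^ n))))"
    unfolding D_def by (simp only: right_diff_distrib mult_ac)
  also have "\<dots> = (?X ^ n * ?X ^ n * ?c ^ n * ?c ^ n * ?c ^ n) * (?c * ?\<nu>)"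
    unfolding key by (simp only: right_diff_distrib mult_ac)
  finally have "nilpotent_coeffs (?X ^ n * (?X ^ (n - k) * (?L ^ k * D)))"
    using nilpotent_coeffs_mult[OF nil] by simp
  then have "nilpotent_coeffs D"
    by (intro nilpotent_coeffs_cancel_X_minus_1_power[of k D] nilpotent_coeffs_cancel_X_power[of "n - k" "?L ^ k * D"]
        nilpotent_coeffs_cancel_X_power[of n "?X ^ (n - k) * (?L ^ k * D)"])
  then have "nilpotent (poly D 1)" by (rule nilpotent_coeffs_poly)
  moreover have "poly D 1 = s ^ Suc (n + n) * poly P 1 - s ^ Suc (n + n + n)"
    unfolding D_def by (simp add: algebra_simps power_add)
  moreover have "poly P 1 = det (s \<cdot>\<^sub>m 1\<^sub>m n - H)"
  proof -
    have "poly P 1 = det (map_mat (\<lambda>p. poly p 1) (?y \<cdot>\<^sub>m 1\<^sub>m n - const_mat H))"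
      unfolding P_def by (rule comm_ring_hom.hom_det[OF poly_hom.comm_ring_hom_axioms, symmetric])
    also have "map_mat (\<lambda>p. poly p 1) (?y \<cdot>\<^sub>m 1\<^sub>m n - const_mat H) = s \<cdot>\<^sub>m 1\<^sub>m n - H"
      using H by (intro eq_matI) auto
    finally show ?thesis .
  qed
  ultimately obtain e where e: "(s ^ Suc (n + n) * det (s \<cdot>\<^sub>m 1\<^sub>m n - H) - s ^ Suc (n + n + n)) ^ e = 0"
    unfolding nilpotent_def by auto
  \<comment> \<open>The adjugate of \<open>s - H\<close> turns \<open>H (s - H) = 0\<close> into \<open>det(s - H) H = 0\<close>.\<close>
  define d where "d = det (s \<cdot>\<^sub>m 1\<^sub>m n - H)"
  have sH: "s \<cdot>\<^sub>m 1\<^sub>m n - H \<in> carrier_mat n n" using H by (rule minus_carrier_mat)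
  have dH: "d \<cdot>\<^sub>m H = 0\<^sub>m n n"
  proof -
    have 1: "s \<cdot>\<^sub>m 1\<^sub>m n \<in> carrier_mat n n" by simp
    have "H * (s \<cdot>\<^sub>m 1\<^sub>m n - H) = H * (s \<cdot>\<^sub>m 1\<^sub>m n) - H * H"
      by (rule mult_minus_distrib_mat[OF H 1 H])
    also have "\<dots> = 0\<^sub>m n n" unfolding HH using H by (simp add: mult_smult_distrib[of _ n n _ n])
    finally have "H * ((s \<cdot>\<^sub>m 1\<^sub>m n - H) * adj_mat (s \<cdot>\<^sub>m 1\<^sub>m n - H)) = 0\<^sub>m n n"
      using H sH adj_mat(1)[OF sH] by (subst assoc_mult_mat[of _ n n _ n _ n, symmetric]) auto
    then show ?thesis
      unfolding adj_mat(2)[OF sH] d_def using H by (simp add: mult_smult_distrib[of _ n n _ n])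
  qed
  have zero: "s ^ (Suc (n + n + n) * e) * H $$ (i, j) = 0" if "i < n" "j < n" for i j
  proof -
    let ?h = "H $$ (i, j)" and ?p = "s ^ Suc (n + n + n)" and ?z = "s ^ Suc (n + n) * d - s ^ Suc (n + n + n)"
    have "d * ?h = 0" using arg_cong[OF dH, of "\<lambda>A. A $$ (i, j)"] H that by simp
    moreover have "?z * ?h = s ^ Suc (n + n) * (d * ?h) - ?p * ?h"
      by (simp only: left_diff_distrib mult.assoc)
    ultimately have "?z * ?h = - ?p * ?h" by simp
    then have "?z ^ r * ?h = (- ?p) ^ r * ?h" for r
      by (rule power_mult_eqI)
    from this[of e] have "(- ?p) ^ e * ?h = 0" using e unfolding d_def by simp
    then have "(-1) ^ e * ((- ?p) ^ e * ?h) = 0" by simp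
    then have "(-1 * - ?p) ^ e * ?h = 0" by (simp only: power_mult_distrib mult.assoc)
    moreover have "-1 * - ?p = ?p" by (simp del: power_Suc)
    ultimately show ?thesis by (simp only: power_mult)
  qed
  show ?thesis
  proof (rule exI[of _ "Suc (n + n + n) * e"], rule eq_matI)
    fix i j assume "i < dim_row (s ^ Suc (Suc (n + n + n) * e) \<cdot>\<^sub>m G)" "j < dim_col (s ^ Suc (Suc (n + n + n) * e) \<cdot>\<^sub>m G)"
    then have ij: "i < n" "j < n" using G by auto
    have "G * coord_proj n S * V = T" unfolding T_def U_def J_def ..
    then show "(s ^ (Suc (n + n + n) * e) \<cdot>\<^sub>m (G * coord_proj n S * V)) $$ (i, j)
        = (s ^ Suc (Suc (n + n + n) * e) \<cdot>\<^sub>m G) $$ (i, j)"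
      using zero[OF ij] ij G T unfolding H_def by (simp add: algebra_simps)
  qed (use G J V in \<open>auto simp: J_def[symmetric]\<close>)
qed

text \<open>Let \<open>J\<close> be the projection to \<open>S\<close>. The matrix of the principal minor agrees with \<open>J G\<close> on the
  coordinates in \<open>S\<close>, so \<open>D\<close> inverts \<open>J G J\<close> there up to the factor \<open>s\<close>. Hence \<open>V = J D J G\<close> is, up to
  \<open>s\<close>, a left inverse of the columns \<open>G J\<close>.\<close>
lemma principal_minor_factorization:
  fixes G :: "'a::comm_ring_1 mat"
  assumes G: "G \<in> carrier_mat n n" and GG: "G * G = G"
    and S: "S \<subseteq> {0..<n}" "card S = k"
    and D: "D \<in> carrier_mat n n" and inv: "D * principal_minor_mat G S = s \<cdot>\<^sub>m 1\<^sub>m n"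
    and nil: "nilpotent_coeffs ([:s:] * (char_poly G - [:0, 1:] ^ (n - k) * [:-1, 1:] ^ k))"
  shows "\<exists>N V. V \<in> carrier_mat n n \<and> G * coord_proj n S * V = s ^ Suc N \<cdot>\<^sub>m G
    \<and> V * (G * coord_proj n S) = s ^ Suc N \<cdot>\<^sub>m coord_proj n S"
proof -
  define J where "J = (coord_proj n S :: 'a mat)"
  note [simp] = assoc_mult_mat[of _ n n _ n _ n]
  have J: "J \<in> carrier_mat n n" unfolding J_def by simp
  have JJ: "J * J = J" unfolding J_def coord_proj_mult_left[OF coord_proj_carrier]
    by (intro eq_matI) (auto simp: coord_proj_def)
  have M: "principal_minor_mat G S \<in> carrier_mat n n" using G by (simp add: principal_minor_mat_def)
  have GJ: "G * J \<in> carrier_mat n n" using G J by simp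
  have "principal_minor_mat G S * J = J * (G * J)"
    unfolding J_def coord_proj_mult_right[OF M] coord_proj_mult_right[OF G]
      coord_proj_mult_left[OF mat_carrier] using G
    by (intro eq_matI) (auto simp: principal_minor_mat_def)
  then have "D * (J * (G * J)) = D * principal_minor_mat G S * J" using D M J by simp
  also have "\<dots> = s \<cdot>\<^sub>m J" unfolding inv using J by (simp add: mult_smult_assoc_mat[of _ n n _ n])
  finally have DJ: "D * (J * (G * J)) = s \<cdot>\<^sub>m J" .
  define V where "V = J * (D * (J * G))"
  have V: "V \<in> carrier_mat n n" unfolding V_def using J D G by simp
  have VG: "V * G = V" unfolding V_def using J D G GG by simp
  have "J * V = J * J * (D * (J * G))" unfolding V_def using J D G by simp
  then have JV: "J * V = V" unfolding JJ V_def .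
  have "V * (G * J) = J * (D * (J * (G * G * J)))" unfolding V_def using J D G by simp
  also have "\<dots> = s \<cdot>\<^sub>m J" unfolding GG DJ using J JJ by (simp add: mult_smult_distrib[of _ n n _ n])
  finally have VU: "V * (G * J) = s \<cdot>\<^sub>m J" .
  obtain N where N: "s ^ N \<cdot>\<^sub>m (G * J * V) = s ^ Suc N \<cdot>\<^sub>m G"
    using idempotent_eq_factored_part[OF G GG S V VG _ _ nil] JV VU unfolding J_def by blast
  show ?thesis
  proof (intro exI conjI)
    show "s ^ N \<cdot>\<^sub>m V \<in> carrier_mat n n" using V by simp
    show "G * coord_proj n S * (s ^ N \<cdot>\<^sub>m V) = s ^ Suc N \<cdot>\<^sub>m G"
      using N G J V unfolding J_def[symmetric] by (simp add: mult_smult_distrib[of _ n n _ n])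
    have "s ^ N \<cdot>\<^sub>m V * (G * J) = s ^ N \<cdot>\<^sub>m (V * (G * J))"
      by (rule mult_smult_assoc_mat[OF V GJ])
    moreover have "s ^ N \<cdot>\<^sub>m (s \<cdot>\<^sub>m J) = s ^ Suc N \<cdot>\<^sub>m J"
      by (intro eq_matI) auto
    ultimately show "s ^ N \<cdot>\<^sub>m V * (G * coord_proj n S) = s ^ Suc N \<cdot>\<^sub>m coord_proj n S"
      unfolding VU J_def[symmetric] by simp
  qed
qed

section \<open>A ring type with every commutative ring as a direct factor\<close>

text \<open>The product of all commutative rings on subsets of a type, with one more factor, the integers,
  which guarantees \<open>0 \<noteq> 1\<close>. The operations are componentwise, so this type is a commutative ring
  with no reference to a carrier.\<close>
typedef ('a, 'r) cring_prod = "{(z :: int, f :: ('a, 'r) ring_scheme \<Rightarrow> 'a).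
    \<forall>R. if cring R then f R \<in> carrier R else f R = undefined}"
proof
  show "(0, \<lambda>R. if cring R then \<zero>\<^bsub>R\<^esub> else undefined) \<in> {(z :: int, f :: ('a, 'r) ring_scheme \<Rightarrow> 'a).
    \<forall>R. if cring R then f R \<in> carrier R else f R = undefined}"
    by (auto intro: cring.cring_simprules)
qed

setup_lifting type_definition_cring_prod

instantiation cring_prod :: (type, type) comm_ring_1
begin

lift_definition zero_cring_prod :: "('a, 'b) cring_prod" is
  "(0, \<lambda>R. if cring R then \<zero>\<^bsub>R\<^esub> else undefined)"
  by (auto intro: cring.cring_simprules)

lift_definition one_cring_prod :: "('a, 'b) cring_prod" is
  "(1, \<lambda>R. if cring R then \<one>\<^bsub>R\<^esub> else undefined)"
  by (auto intro: cring.cring_simprules)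

lift_definition plus_cring_prod :: "('a, 'b) cring_prod \<Rightarrow> ('a, 'b) cring_prod \<Rightarrow> ('a, 'b) cring_prod" is
  "\<lambda>(y, f) (z, g). (y + z, \<lambda>R. if cring R then f R \<oplus>\<^bsub>R\<^esub> g R else undefined)"
  by (fastforce intro: cring.cring_simprules split: if_splits)

lift_definition times_cring_prod :: "('a, 'b) cring_prod \<Rightarrow> ('a, 'b) cring_prod \<Rightarrow> ('a, 'b) cring_prod" is
  "\<lambda>(y, f) (z, g). (y * z, \<lambda>R. if cring R then f R \<otimes>\<^bsub>R\<^esub> g R else undefined)"
  by (fastforce intro: cring.cring_simprules split: if_splits)

lift_definition uminus_cring_prod :: "('a, 'b) cring_prod \<Rightarrow> ('a, 'b) cring_prod" is
  "\<lambda>(y, f). (- y, \<lambda>R. if cring R then \<ominus>\<^bsub>R\<^esub> f R else undefined)"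
  by (fastforce intro: cring.cring_simprules split: if_splits)

definition minus_cring_prod :: "('a, 'b) cring_prod \<Rightarrow> ('a, 'b) cring_prod \<Rightarrow> ('a, 'b) cring_prod" where
  "minus_cring_prod x y = x + - y"

instance
proof
  fix x y z :: "('a, 'b) cring_prod"
  show "x * y * z = x * (y * z)"
    by transfer (auto simp: cring.cring_simprules(11) fun_eq_iff)
  show "x * y = y * x"
    by transfer (auto simp: cring.cring_simprules(14) fun_eq_iff)
  show "1 * x = x"
    by transfer (auto simp: cring.cring_simprules(12) fun_eq_iff)
  show "x + y + z = x + (y + z)"
    by transfer (auto simp: cring.cring_simprules(7) fun_eq_iff)
  show "x + y = y + x"
    by transfer (auto simp: cring.cring_simprules(10) fun_eq_iff)
  show "0 + x = x"
    by transfer (auto simp: cring.cring_simprules(8) fun_eq_iff)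
  show "- x + x = 0"
    by transfer (auto simp: cring.cring_simprules(9) fun_eq_iff)
  show "x - y = x + - y" by (rule minus_cring_prod_def)
  show "(x + y) * z = x * z + y * z"
    by transfer (auto simp: cring.cring_simprules(13) fun_eq_iff distrib_right)
  show "(0 :: ('a, 'b) cring_prod) \<noteq> 1" by transfer simp
qed

end

lift_definition proj :: "('a, 'r) ring_scheme \<Rightarrow> ('a, 'r) cring_prod \<Rightarrow> 'a" is "\<lambda>R (z, f). f R" .

text \<open>The inclusion of the factor \<open>R\<close>. It preserves sums and products but sends \<open>1\<close> to the idempotent
  that cuts out this factor; so equations that do not mention \<open>1\<close> can be transferred from \<open>R\<close> without
  passing to a quotient.\<close>
lift_definition emb :: "('a, 'r) ring_scheme \<Rightarrow> 'a \<Rightarrow> ('a, 'r) cring_prod" is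
  "\<lambda>R a. (0, \<lambda>S. if cring S then if S = R \<and> a \<in> carrier S then a else \<zero>\<^bsub>S\<^esub> else undefined)"
  by (auto intro: cring.cring_simprules)

text \<open>Homomorphisms from a ring type to a ring on a carrier. Determinants, being polynomial expressions
  in the entries, commute with them.\<close>
locale hom_to_cring = cring R for R (structure) +
  fixes h :: "'u::comm_ring_1 \<Rightarrow> 'a"
  assumes h_closed [simp, intro]: "h x \<in> carrier R"
    and h_add: "h (x + y) = h x \<oplus> h y"
    and h_mult: "h (x * y) = h x \<otimes> h y"
    and h_one: "h 1 = \<one>"
begin

lemma h_zero: "h 0 = \<zero>"
  using h_add[of 0 0] h_closed[of 0] by (metis add.l_cancel_one' add_0)

lemma h_uminus: "h (- x) = \<ominus> h x"
proof -
  have "h (- x) \<oplus> h x = \<zero>" using h_add[of "- x" x] h_zero by simp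
  then show ?thesis using minus_equality by auto
qed

lemma h_minus: "h (x - y) = h x \<ominus> h y"
  using h_add[of x "- y"] h_uminus[of y] by (simp add: a_minus_def)

lemma h_sum: "finite I \<Longrightarrow> h (\<Sum>i\<in>I. f i) = (\<Oplus>i\<in>I. h (f i))"
  by (induction I rule: finite_induct) (auto simp: h_zero h_add)

lemma h_prod: "finite I \<Longrightarrow> h (\<Prod>i\<in>I. f i) = (\<Otimes>i\<in>I. h (f i))"
  by (induction I rule: finite_induct) (auto simp: h_one h_mult)

lemma h_power: "h (x ^ n) = h x [^] n"
  by (induction n) (auto simp: h_one h_mult m_comm)

lemma h_det:
  assumes A: "A \<in> carrier_mat q q"
    and G: "\<And>i j. i < q \<Longrightarrow> j < q \<Longrightarrow> G i j = h (A $$ (i, j))"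
  shows "mat_det R q G = h (det A)"
proof -
  have fin: "finite {p. p permutes {..<q}}" by (rule finite_permutations) simp
  have "h (det A) = (\<Oplus>p\<in>{p. p permutes {..<q}}. h (of_int (sign p) * (\<Prod>i\<in>{..<q}. A $$ (i, p i))))"
    unfolding det_def'[OF A] atLeast0LessThan by (rule h_sum[OF fin])
  also have "\<dots> = mat_det R q G"
    unfolding mat_det_def
  proof (rule finsum_cong'[OF refl, symmetric])
    fix p assume "p \<in> {p. p permutes {..<q}}"
    then have pq: "p i < q" if "i < q" for i using permutes_in_image[of p "{..<q}" i] that by simp
    have prd: "(\<Otimes>i\<in>{..<q}. G i (p i)) = h (\<Prod>i\<in>{..<q}. A $$ (i, p i))"
      unfolding h_prod[OF finite_lessThan] by (rule finprod_cong') (use G pq in auto)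
    show "(if evenperm p then \<Otimes>i\<in>{..<q}. G i (p i) else \<ominus> (\<Otimes>i\<in>{..<q}. G i (p i)))
        = h (of_int (sign p) * (\<Prod>i\<in>{..<q}. A $$ (i, p i)))"
      unfolding prd by (simp add: sign_def h_uminus)
  qed auto
  finally show ?thesis ..
qed

end

definition poly_proj :: "('a, 'r) ring_scheme \<Rightarrow> ('a, 'r) cring_prod poly \<Rightarrow> nat \<Rightarrow> 'a" where
  "poly_proj R p = (\<lambda>i. proj R (coeff p i))"

context cring
begin

lemma proj_hom: "hom_to_cring R (proj R)"
proof (unfold_locales)
  have cring: "cring R" ..
  fix x y
  show "proj R x \<in> carrier R" using cring by transfer (auto split: if_splits)
  show "proj R (x + y) = proj R x \<oplus> proj R y" using cring by transfer (auto split: if_splits)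
  show "proj R (x * y) = proj R x \<otimes> proj R y" using cring by transfer (auto split: if_splits)
  show "proj R 1 = \<one>" using cring by transfer (auto split: if_splits)
qed

sublocale proj: hom_to_cring R "proj R" by (rule proj_hom)

lemma proj_emb [simp]: "a \<in> carrier R \<Longrightarrow> proj R (emb R a) = a"
  using is_cring by transfer auto

lemma emb_add: "a \<in> carrier R \<Longrightarrow> b \<in> carrier R \<Longrightarrow> emb R (a \<oplus> b) = emb R a + emb R b"
  by transfer (auto simp: fun_eq_iff cring.cring_simprules(1,2,8))

lemma emb_mult: "a \<in> carrier R \<Longrightarrow> emb R a * x = emb R (a \<otimes> proj R x)"
proof -
  have l_null: "\<zero>\<^bsub>S\<^esub> \<otimes>\<^bsub>S\<^esub> y = \<zero>\<^bsub>S\<^esub>" if "cring S" "y \<in> carrier S" for S :: "('a, 'b) ring_scheme" and y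
  proof -
    interpret S: cring S by (rule that)
    show ?thesis using that by simp
  qed
  assume "a \<in> carrier R"
  then show ?thesis
    by transfer (auto simp: fun_eq_iff l_null cring.cring_simprules(5) split: if_splits)
qed

lemma poly_proj_hom: "hom_to_cring (UP R) (poly_proj R)"
proof -
  have "cring (UP R)" by (rule UP_cring.UP_cring) (unfold_locales)
  have closed: "poly_proj R p \<in> up R" for p
  proof -
    have "bound \<zero> (degree p) (poly_proj R p)"
      by (rule bound.intro) (simp add: poly_proj_def coeff_eq_0 proj.h_zero)
    then show ?thesis unfolding up_def poly_proj_def by blast
  qed
  show ?thesis
  proof (intro hom_to_cring.intro hom_to_cring_axioms.intro)
    show "cring (UP R)" by fact
    fix p q
    show "poly_proj R p \<in> carrier (UP R)" using closed by (simp add: UP_def)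
    show "poly_proj R (p + q) = poly_proj R p \<oplus>\<^bsub>UP R\<^esub> poly_proj R q"
      using closed[of p] closed[of q] by (simp add: UP_def fun_eq_iff) (simp add: poly_proj_def proj.h_add)
    show "poly_proj R (p * q) = poly_proj R p \<otimes>\<^bsub>UP R\<^esub> poly_proj R q"
      using closed[of p] closed[of q]
      by (simp add: UP_def fun_eq_iff) (simp add: poly_proj_def coeff_mult proj.h_sum proj.h_mult)
    show "poly_proj R 1 = \<one>\<^bsub>UP R\<^esub>"
      by (simp add: UP_def fun_eq_iff poly_proj_def coeff_1 proj.h_one proj.h_zero)
  qed
qed

lemma coeff_poly_proj: "up_ring.coeff (UP R) (poly_proj R p) i = proj R (coeff p i)"
  using hom_to_cring.h_closed[OF poly_proj_hom, of p] by (simp add: UP_def) (simp add: poly_proj_def)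

lemma UP_X_poly_proj: "UP_X R = poly_proj R [:0, 1:]"
  by (auto simp: UP_X_def UP_def poly_proj_def fun_eq_iff coeff_pCons proj.h_one proj.h_zero split: nat.splits)

lemma UP_const_poly_proj: "up_ring.monom (UP R) (proj R c) 0 = poly_proj R [:c:]"
  by (auto simp: UP_def poly_proj_def fun_eq_iff coeff_pCons proj.h_zero split: nat.splits)

lemma char_polynomial_poly_proj:
  assumes A: "A \<in> carrier_mat q q" and G: "\<And>i j. i < q \<Longrightarrow> j < q \<Longrightarrow> G i j = proj R (A $$ (i, j))"
  shows "char_polynomial R q G = poly_proj R (char_poly A)"
  unfolding char_polynomial_def char_poly_def
proof (rule hom_to_cring.h_det[OF poly_proj_hom])
  show "char_poly_matrix A \<in> carrier_mat q q" using A by (rule char_poly_matrix_closed)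
  fix i j assume ij: "i < q" "j < q"
  have "char_poly_matrix A $$ (i, j) = (if i = j then [:0, 1:] else 0) - [:A $$ (i, j):]"
    using ij A by (auto simp: char_poly_matrix_def)
  then show "(if i = j then UP_X R else \<zero>\<^bsub>UP R\<^esub>) \<ominus>\<^bsub>UP R\<^esub> up_ring.monom (UP R) (G i j) 0
      = poly_proj R (char_poly_matrix A $$ (i, j))"
    using G[OF ij] by (simp add: hom_to_cring.h_minus[OF poly_proj_hom] hom_to_cring.h_zero[OF poly_proj_hom] UP_X_poly_proj UP_const_poly_proj)
qed

lemma rank_polynomial_poly_proj:
  "(UP_X R \<ominus>\<^bsub>UP R\<^esub> \<one>\<^bsub>UP R\<^esub>) [^]\<^bsub>UP R\<^esub> k \<otimes>\<^bsub>UP R\<^esub> UP_X R [^]\<^bsub>UP R\<^esub> (m :: nat)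
    = poly_proj R ([:-1, 1:] ^ k * [:0, 1:] ^ m)"
proof -
  have "[:-1, 1:] = [:0, 1:] - (1 :: ('a, 'b) cring_prod poly)"
    by (rule poly_eqI) (auto simp: coeff_pCons coeff_1 split: nat.splits)
  then show ?thesis
    by (simp only: hom_to_cring.h_mult[OF poly_proj_hom] hom_to_cring.h_power[OF poly_proj_hom] hom_to_cring.h_minus[OF poly_proj_hom] hom_to_cring.h_one[OF poly_proj_hom] UP_X_poly_proj)
qed

lemma equal_up_to_nilpotents_poly_proj:
  "equal_up_to_nilpotents R (poly_proj R p) (poly_proj R q)
    \<longleftrightarrow> (\<forall>i. nilpotent_elem R (proj R (coeff (p - q) i)))"
  unfolding equal_up_to_nilpotents_def coeff_poly_proj by (simp add: proj.h_minus)

end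

section \<open>Comaximal elements\<close>

lemma ex_uniform_bound:
  fixes P :: "'j \<Rightarrow> nat \<Rightarrow> bool"
  assumes "finite J" "\<And>j. j \<in> J \<Longrightarrow> \<exists>N. P j N" "\<And>j N N'. j \<in> J \<Longrightarrow> P j N \<Longrightarrow> N \<le> N' \<Longrightarrow> P j N'"
  shows "\<exists>N. \<forall>j\<in>J. P j N"
proof -
  obtain f where f: "\<And>j. j \<in> J \<Longrightarrow> P j (f j)" using assms(2) by metis
  have "f j \<le> sum f J" if "j \<in> J" for j using assms(1) that by (simp add: member_le_sum)
  then show ?thesis using f assms(3) by blast
qed

text \<open>The exponents are raised one index \<open>j\<close> at a time: if \<open>E = c + b\<^sub>j s\<^sub>j\<close>, then a power of \<open>E\<close>, which is
  \<open>E\<close> itself, is congruent to the same power of \<open>b\<^sub>j s\<^sub>j\<close> modulo \<open>c\<close>. An idempotent \<open>E\<close> takes the place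
  of \<open>1\<close> because the unit of a direct factor is not the unit of the product.\<close>
lemma comaximal_powers:
  fixes s a :: "'i \<Rightarrow> 'a::comm_ring_1" and N :: "'i \<Rightarrow> nat"
  assumes fin: "finite I" and E: "(\<Sum>i\<in>I. a i * s i) = E" and idem: "E * E = E"
  shows "\<exists>b. (\<Sum>i\<in>I. b i * s i ^ Suc (N i)) = E"
proof -
  have "\<exists>b. (\<Sum>i\<in>I. b i * s i ^ (if i \<in> F then Suc (N i) else 1)) = E" if "finite F" "F \<subseteq> I" for F
    using that
  proof (induction F rule: finite_induct)
    case empty
    then show ?case using E by auto
  next
    case (insert j F)
    let ?f = "\<lambda>i. if i \<in> F then Suc (N i) else 1"
    obtain b where b: "(\<Sum>i\<in>I. b i * s i ^ ?f i) = E" using insert by auto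
    have j: "j \<in> I" "j \<notin> F" using insert by auto
    define c where "c = (\<Sum>i\<in>I - {j}. b i * s i ^ ?f i)"
    have Ec: "E = b j * s j + c"
      using sum.remove[OF fin j(1), of "\<lambda>i. b i * s i ^ ?f i"] b j(2) unfolding c_def by simp
    have "E ^ Suc m = E" for m by (induction m) (simp_all add: idem)
    moreover obtain q where "E ^ Suc (N j) - (b j * s j) ^ Suc (N j) = (E - b j * s j) * q"
      using diff_power_eq_sum[of E "N j" "b j * s j"] by blast
    ultimately have q: "E = b j ^ Suc (N j) * s j ^ Suc (N j) + c * q"
      using Ec by (simp only: power_mult_distrib) (simp add: algebra_simps del: power_Suc)
    define b' where "b' = (\<lambda>i. if i = j then b j ^ Suc (N j) else b i * q)"
    define h where "h = (\<lambda>i. b' i * s i ^ (if i \<in> insert j F then Suc (N i) else 1))"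
    have "sum h I = h j + sum h (I - {j})" by (rule sum.remove[OF fin j(1)])
    also have "h j = b j ^ Suc (N j) * s j ^ Suc (N j)" unfolding h_def b'_def by simp
    also have "sum h (I - {j}) = c * q"
      unfolding c_def sum_distrib_right
      by (rule sum.cong) (auto simp: h_def b'_def mult_ac)
    finally have "sum h I = E" unfolding q[symmetric] .
    then show ?case unfolding h_def by (rule exI[of _ b'])
  qed
  from this[OF fin] obtain b where "(\<Sum>i\<in>I. b i * s i ^ (if i \<in> I then Suc (N i) else 1)) = E"
    by auto
  then show ?thesis by (intro exI[of _ b]) (simp cong: sum.cong)
qed

lemma comaximal_vanish:
  fixes s a :: "'i \<Rightarrow> 'a::comm_ring_1"
  assumes fin: "finite I" and E: "(\<Sum>i\<in>I. a i * s i) = E" and idem: "E * E = E"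
    and Ez: "E * z = z" and z: "\<And>i. i \<in> I \<Longrightarrow> \<exists>N. s i ^ N * z = 0"
  shows "z = 0"
proof -
  obtain N where N: "\<And>i. i \<in> I \<Longrightarrow> s i ^ N i * z = 0" using z by metis
  obtain b where "(\<Sum>i\<in>I. b i * s i ^ Suc (N i)) = E"
    using comaximal_powers[OF fin E idem] by blast
  then have "z = (\<Sum>i\<in>I. b i * s i ^ Suc (N i)) * z" using Ez by simp
  also have "\<dots> = (\<Sum>i\<in>I. b i * s i * (s i ^ N i * z))"
    unfolding sum_distrib_right by (intro sum.cong) (auto simp: mult_ac)
  also have "\<dots> = 0" using N by simp
  finally show ?thesis .
qed

section \<open>Dual bases and local bases\<close>

text \<open>Scalars form a type, elements form a carrier: sums of scalars are then ordinary sums, and matrices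
  of scalars are available.\<close>
locale scalar_module = abelian_group M for M (structure) +
  fixes sc :: "'u::comm_ring_1 \<Rightarrow> 'b \<Rightarrow> 'b" (infixr \<open>\<star>\<close> 75)
  assumes sc_closed [simp, intro]: "x \<in> carrier M \<Longrightarrow> u \<star> x \<in> carrier M"
    and sc_add_left: "x \<in> carrier M \<Longrightarrow> (u + v) \<star> x = u \<star> x \<oplus> v \<star> x"
    and sc_add_right: "x \<in> carrier M \<Longrightarrow> y \<in> carrier M \<Longrightarrow> u \<star> (x \<oplus> y) = u \<star> x \<oplus> u \<star> y"
    and sc_mult: "x \<in> carrier M \<Longrightarrow> (u * v) \<star> x = u \<star> v \<star> x"
    and sc_one [simp]: "x \<in> carrier M \<Longrightarrow> 1 \<star> x = x"
begin

lemma sc_zero_left [simp]: "x \<in> carrier M \<Longrightarrow> 0 \<star> x = \<zero>"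
  using sc_add_left[of x 0 0] by (metis add.l_cancel_one' add_0 sc_closed)

lemma sc_zero_right [simp]: "u \<star> \<zero> = \<zero>"
  using sc_add_right[of \<zero> \<zero> u] by (metis add.l_cancel_one' l_zero sc_closed zero_closed)

lemma sc_sum_right: "finite I \<Longrightarrow> x \<in> I \<rightarrow> carrier M \<Longrightarrow> u \<star> (\<Oplus>i\<in>I. x i) = (\<Oplus>i\<in>I. u \<star> x i)"
  by (induction I rule: finite_induct) (auto simp: sc_add_right Pi_def)

lemma sc_sum_left: "finite I \<Longrightarrow> x \<in> carrier M \<Longrightarrow> sum u I \<star> x = (\<Oplus>i\<in>I. u i \<star> x)"
  by (induction I rule: finite_induct) (auto simp: sc_add_left)

definition comb :: "'i set \<Rightarrow> ('i \<Rightarrow> 'u) \<Rightarrow> ('i \<Rightarrow> 'b) \<Rightarrow> 'b" where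
  "comb I u x = (\<Oplus>i\<in>I. u i \<star> x i)"

lemma comb_closed [simp, intro]: "x \<in> I \<rightarrow> carrier M \<Longrightarrow> comb I u x \<in> carrier M"
  unfolding comb_def by (intro finsum_closed) auto

lemma comb_cong:
  "x \<in> I \<rightarrow> carrier M \<Longrightarrow> (\<And>i. i \<in> I \<Longrightarrow> u i = v i) \<Longrightarrow> (\<And>i. i \<in> I \<Longrightarrow> y i = x i) \<Longrightarrow> comb I u y = comb I v x"
  unfolding comb_def by (rule finsum_cong') auto

lemma comb_zero [simp]: "x \<in> I \<rightarrow> carrier M \<Longrightarrow> comb I (\<lambda>i. 0) x = \<zero>"
  unfolding comb_def by (rule trans[OF finsum_cong' finsum_zero]) (auto simp: Pi_def)

lemma comb_add: "x \<in> I \<rightarrow> carrier M \<Longrightarrow> comb I (\<lambda>i. u i + v i) x = comb I u x \<oplus> comb I v x"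
proof -
  assume x: "x \<in> I \<rightarrow> carrier M"
  have "comb I (\<lambda>i. u i + v i) x = (\<Oplus>i\<in>I. u i \<star> x i \<oplus> v i \<star> x i)"
    unfolding comb_def by (rule finsum_cong') (use x in \<open>auto simp: sc_add_left Pi_def\<close>)
  also have "\<dots> = comb I u x \<oplus> comb I v x"
    unfolding comb_def by (rule finsum_addf) (use x in auto)
  finally show ?thesis .
qed

lemma comb_scale: "finite I \<Longrightarrow> x \<in> I \<rightarrow> carrier M \<Longrightarrow> comb I (\<lambda>i. c * u i) x = c \<star> comb I u x"
  unfolding comb_def by (subst sc_sum_right) (auto simp: sc_mult Pi_def intro!: finsum_cong')

lemma comb_diff_eq_zero:
  assumes "x \<in> I \<rightarrow> carrier M" "comb I u x = comb I v x"
  shows "comb I (\<lambda>i. u i - v i) x = \<zero>"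
proof -
  have "comb I (\<lambda>i. (u i - v i) + v i) x = comb I (\<lambda>i. u i - v i) x \<oplus> comb I v x"
    by (rule comb_add) fact
  then have "comb I v x = comb I (\<lambda>i. u i - v i) x \<oplus> comb I v x" using assms(2) by simp
  then show ?thesis using assms(1) by (metis add.r_cancel_one' comb_closed)
qed

lemma comb_sum:
  assumes x: "x \<in> I \<rightarrow> carrier M" and J: "finite J"
  shows "comb I (\<lambda>i. \<Sum>j\<in>J. u j i) x = (\<Oplus>j\<in>J. comb I (u j) x)"
  using J by (induction J rule: finite_induct) (use x in \<open>auto simp: comb_add\<close>)

lemma comb_comb:
  assumes I: "finite I" and J: "finite J" and x: "x \<in> I \<rightarrow> carrier M"
    and y: "\<And>j. j \<in> J \<Longrightarrow> y j = comb I (v j) x"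
  shows "comb J u y = comb I (\<lambda>i. \<Sum>j\<in>J. u j * v j i) x"
proof -
  have "comb I (\<lambda>i. \<Sum>j\<in>J. u j * v j i) x = (\<Oplus>j\<in>J. comb I (\<lambda>i. u j * v j i) x)"
    by (rule comb_sum[OF x J])
  also have "\<dots> = (\<Oplus>j\<in>J. u j \<star> y j)"
    by (rule finsum_cong') (use x y in \<open>auto simp: comb_scale[OF I x] Pi_def\<close>)
  finally show ?thesis unfolding comb_def ..
qed

lemma comb_delta:
  assumes "finite I" "j \<in> I" "x \<in> I \<rightarrow> carrier M"
  shows "comb I (\<lambda>i. if i = j then c else 0) x = c \<star> x j"
proof -
  have "comb I (\<lambda>i. if i = j then c else 0) x = (\<Oplus>i\<in>I. if j = i then c \<star> x i else \<zero>)"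
    unfolding comb_def by (rule finsum_cong') (use assms in \<open>auto simp: Pi_def\<close>)
  also have "\<dots> = c \<star> x j"
    by (rule add.finprod_singleton) (use assms in auto)
  finally show ?thesis .
qed

lemma comb_reindex:
  assumes "bij_betw f J I" "x \<in> I \<rightarrow> carrier M"
  shows "comb I u x = comb J (\<lambda>j. u (f j)) (\<lambda>j. x (f j))"
  unfolding comb_def bij_betw_imp_surj_on[OF assms(1), symmetric]
  by (rule finsum_reindex[OF _ bij_betw_imp_inj_on[OF assms(1)]])
    (use assms bij_betw_imp_surj_on[OF assms(1)] in auto)

definition functional :: "('b \<Rightarrow> 'u) \<Rightarrow> bool" where
  "functional \<phi> \<longleftrightarrow> (\<forall>x\<in>carrier M. \<forall>y\<in>carrier M. \<phi> (x \<oplus> y) = \<phi> x + \<phi> y)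
    \<and> (\<forall>u. \<forall>x\<in>carrier M. \<phi> (u \<star> x) = u * \<phi> x)"

lemma functionalD:
  assumes "functional \<phi>"
  shows "x \<in> carrier M \<Longrightarrow> y \<in> carrier M \<Longrightarrow> \<phi> (x \<oplus> y) = \<phi> x + \<phi> y"
    and "x \<in> carrier M \<Longrightarrow> \<phi> (u \<star> x) = u * \<phi> x"
    and "\<phi> \<zero> = 0"
proof -
  show 1: "x \<in> carrier M \<Longrightarrow> y \<in> carrier M \<Longrightarrow> \<phi> (x \<oplus> y) = \<phi> x + \<phi> y" for x y
    using assms unfolding functional_def by blast
  show "x \<in> carrier M \<Longrightarrow> \<phi> (u \<star> x) = u * \<phi> x"
    using assms unfolding functional_def by blast
  show "\<phi> \<zero> = 0" using 1[of \<zero> \<zero>] by simp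
qed

lemma functional_sum_mult:
  "(\<And>i. i \<in> I \<Longrightarrow> functional (\<phi> i)) \<Longrightarrow> functional (\<lambda>x. \<Sum>i\<in>I. c i * \<phi> i x)"
  unfolding functional_def
  by (auto simp: algebra_simps sum.distrib sum_distrib_left intro!: sum.cong)

lemma functional_mult: "functional \<phi> \<Longrightarrow> functional (\<lambda>x. c * \<phi> x)"
  unfolding functional_def by (auto simp: algebra_simps)

lemma functional_comb:
  assumes "functional \<phi>" "finite I" "x \<in> I \<rightarrow> carrier M"
  shows "\<phi> (comb I u x) = (\<Sum>i\<in>I. u i * \<phi> (x i))"
  using assms(2,3) unfolding comb_def
  by (induction I rule: finite_induct) (auto simp: functionalD[OF assms(1)] Pi_def)

definition generates :: "nat \<Rightarrow> (nat \<Rightarrow> 'b) \<Rightarrow> bool" where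
  "generates n g \<longleftrightarrow> g \<in> {..<n} \<rightarrow> carrier M \<and> (\<forall>x\<in>carrier M. \<exists>u. x = comb {..<n} u g)"

text \<open>By the dual basis lemma, a module has such a system exactly if it is finitely generated projective.\<close>
definition dual_basis :: "nat \<Rightarrow> (nat \<Rightarrow> 'b) \<Rightarrow> (nat \<Rightarrow> 'b \<Rightarrow> 'u) \<Rightarrow> bool" where
  "dual_basis n w \<phi> \<longleftrightarrow> w \<in> {..<n} \<rightarrow> carrier M \<and> (\<forall>i<n. functional (\<phi> i))
    \<and> (\<forall>x\<in>carrier M. x = comb {..<n} (\<lambda>i. \<phi> i x) w)"

text \<open>A basis of the module over the ring with \<open>t\<close> inverted, together with its coordinate forms, all
  multiplied by \<open>t\<close> in order to be defined without denominators.\<close>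
definition local_basis :: "'u \<Rightarrow> 'i set \<Rightarrow> ('i \<Rightarrow> 'b) \<Rightarrow> ('i \<Rightarrow> 'b \<Rightarrow> 'u) \<Rightarrow> bool" where
  "local_basis t I e \<psi> \<longleftrightarrow> finite I \<and> e \<in> I \<rightarrow> carrier M \<and> (\<forall>i\<in>I. functional (\<psi> i))
    \<and> (\<forall>x\<in>carrier M. comb I (\<lambda>i. \<psi> i x) e = t \<star> x)
    \<and> (\<forall>i\<in>I. \<forall>j\<in>I. \<psi> i (e j) = (if i = j then t else 0))"

text \<open>The literal content of freeness after inverting \<open>s\<close>: the exponents may depend on the element and on
  the relation, and the coefficients need not be linear in \<open>x\<close>.\<close>
definition weak_local_basis :: "'u \<Rightarrow> nat \<Rightarrow> (nat \<Rightarrow> 'b) \<Rightarrow> bool" where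
  "weak_local_basis s k e \<longleftrightarrow> e \<in> {..<k} \<rightarrow> carrier M
    \<and> (\<forall>x\<in>carrier M. \<exists>N c. s ^ N \<star> x = comb {..<k} c e)
    \<and> (\<forall>a. comb {..<k} a e = \<zero> \<longrightarrow> (\<exists>N. \<forall>l<k. s ^ N * a l = 0))"

text \<open>Expressing each \<open>w\<^sub>j\<close> by the generators \<open>g\<^sub>i\<close> and collecting terms only changes the linear forms.\<close>
lemma dual_basis_change_generators:
  assumes db: "dual_basis q w \<phi>" and gen: "generates n g"
  obtains \<iota> where "dual_basis n g \<iota>"
proof -
  have "\<exists>u. w j = comb {..<n} u g" if "j < q" for j
    using db gen that unfolding dual_basis_def generates_def by blast
  then obtain a where a: "\<And>j. j < q \<Longrightarrow> w j = comb {..<n} (a j) g" by metis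
  have g: "g \<in> {..<n} \<rightarrow> carrier M" using gen unfolding generates_def by blast
  have "dual_basis n g (\<lambda>i x. \<Sum>j<q. a j i * \<phi> j x)"
    unfolding dual_basis_def
  proof (intro conjI ballI allI impI)
    fix x assume x: "x \<in> carrier M"
    have "comb {..<q} (\<lambda>i. \<phi> i x) w = comb {..<n} (\<lambda>i. \<Sum>j<q. \<phi> j x * a j i) g"
      by (rule comb_comb) (use g a in auto)
    then show "x = comb {..<n} (\<lambda>i. \<Sum>j<q. a j i * \<phi> j x) g"
      using db x unfolding dual_basis_def by (simp add: mult.commute)
  qed (use g db in \<open>auto simp: dual_basis_def intro: functional_sum_mult\<close>)
  then show thesis by (rule that)
qed

lemma dual_basis_idempotent:
  assumes "dual_basis n w \<phi>" "i < n" "j < n"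
  shows "(\<Sum>l<n. \<phi> i (w l) * \<phi> l (w j)) = \<phi> i (w j)"
proof -
  have w: "w \<in> {..<n} \<rightarrow> carrier M" using assms unfolding dual_basis_def by blast
  have "\<phi> i (w j) = \<phi> i (comb {..<n} (\<lambda>l. \<phi> l (w j)) w)"
    using assms w unfolding dual_basis_def by (metis PiE lessThan_iff)
  also have "\<dots> = (\<Sum>l<n. \<phi> l (w j) * \<phi> i (w l))"
    by (rule functional_comb) (use assms w in \<open>auto simp: dual_basis_def\<close>)
  finally show ?thesis by (simp add: mult.commute)
qed

lemma local_basis_reindex:
  assumes lb: "local_basis t I e \<psi>" and f: "bij_betw f J I"
  shows "local_basis t J (\<lambda>j. e (f j)) (\<lambda>j. \<psi> (f j))"
proof -
  have fJ: "f j \<in> I" if "j \<in> J" for j using f that bij_betwE by metis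
  have inj: "f i = f j \<longleftrightarrow> i = j" if "i \<in> J" "j \<in> J" for i j
    using bij_betw_imp_inj_on[OF f] that by (auto dest: inj_onD)
  have "comb J (\<lambda>j. \<psi> (f j) x) (\<lambda>j. e (f j)) = comb I (\<lambda>i. \<psi> i x) e" for x
    using lb comb_reindex[OF f, of e "\<lambda>i. \<psi> i x"] unfolding local_basis_def by simp
  then show ?thesis
    using lb fJ inj bij_betw_finite[OF f] unfolding local_basis_def by (auto simp: Pi_def)
qed

text \<open>Both identities hold for the matrix \<open>G\<close> of the dual basis. Since \<open>g\<^sub>l = \<Sum>\<^sub>i \<iota>\<^sub>i(g\<^sub>l) g\<^sub>i\<close>, the
  factorization of \<open>t G\<close> through the columns in \<open>S\<close> expresses \<open>t x\<close> by the \<open>g\<^sub>l\<close> with \<open>l \<in> S\<close>.\<close>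
lemma local_basis_of_factorization:
  assumes db: "dual_basis n g \<iota>" and S: "S \<subseteq> {..<n}"
    and GV: "\<And>i j. i < n \<Longrightarrow> j < n \<Longrightarrow> (\<Sum>l\<in>S. \<iota> i (g l) * V l j) = t * \<iota> i (g j)"
    and VG: "\<And>l m. l \<in> S \<Longrightarrow> m \<in> S \<Longrightarrow> (\<Sum>j<n. V l j * \<iota> j (g m)) = (if l = m then t else 0)"
  shows "local_basis t S g (\<lambda>l x. \<Sum>j<n. V l j * \<iota> j x)"
proof -
  have g: "g \<in> {..<n} \<rightarrow> carrier M" and fn: "\<And>i. i < n \<Longrightarrow> functional (\<iota> i)"
    and rep: "\<And>x. x \<in> carrier M \<Longrightarrow> x = comb {..<n} (\<lambda>i. \<iota> i x) g"
    using db unfolding dual_basis_def by blast+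
  have fin: "finite S" using S finite_subset by blast
  have gS: "g l \<in> carrier M" if "l \<in> S" for l using g S that by auto
  show ?thesis
    unfolding local_basis_def
  proof (intro conjI ballI fin)
    fix x assume x: "x \<in> carrier M"
    have "comb S (\<lambda>l. \<Sum>j<n. V l j * \<iota> j x) g
        = comb {..<n} (\<lambda>i. \<Sum>l\<in>S. (\<Sum>j<n. V l j * \<iota> j x) * \<iota> i (g l)) g"
      by (rule comb_comb) (use fin g gS rep in auto)
    also have "\<dots> = comb {..<n} (\<lambda>i. t * \<iota> i x) g"
    proof (rule comb_cong[OF g])
      fix i assume i: "i \<in> {..<n}"
      have "(\<Sum>l\<in>S. (\<Sum>j<n. V l j * \<iota> j x) * \<iota> i (g l))
          = (\<Sum>j<n. (\<Sum>l\<in>S. \<iota> i (g l) * V l j) * \<iota> j x)"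
        unfolding sum_distrib_right by (subst sum.swap) (simp add: mult_ac)
      also have "\<dots> = (\<Sum>j<n. t * (\<iota> j x * \<iota> i (g j)))"
        by (rule sum.cong) (use GV i in \<open>auto simp: mult_ac\<close>)
      also have "\<dots> = t * \<iota> i (comb {..<n} (\<lambda>j. \<iota> j x) g)"
        using functional_comb[OF fn finite_lessThan g] i by (simp add: sum_distrib_left)
      also have "comb {..<n} (\<lambda>j. \<iota> j x) g = x" using rep[OF x] ..
      finally show "(\<Sum>l\<in>S. (\<Sum>j<n. V l j * \<iota> j x) * \<iota> i (g l)) = t * \<iota> i x" .
    qed simp
    also have "\<dots> = t \<star> comb {..<n} (\<lambda>i. \<iota> i x) g" by (rule comb_scale) (use g in auto)
    also have "comb {..<n} (\<lambda>i. \<iota> i x) g = x" using rep[OF x] ..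
    finally show "comb S (\<lambda>l. \<Sum>j<n. V l j * \<iota> j x) g = t \<star> x" .
  qed (use gS fn VG in \<open>auto intro: functional_sum_mult\<close>)
qed

section \<open>Gluing local bases\<close>

text \<open>Writing \<open>s\<^sub>i\<^sup>N g\<^sub>j\<close> in terms of the \<open>e\<^sub>i\<^sub>l\<close> defines linear functions \<open>C\<^sub>i\<^sub>l\<close> of a coefficient vector
  \<open>u\<close>, which give coordinates of \<open>\<Sum>\<^sub>j u\<^sub>j g\<^sub>j\<close>. To be functions of this sum they have to vanish on
  relations, that is, on \<open>u\<close> with \<open>\<Sum>\<^sub>j u\<^sub>j g\<^sub>j = 0\<close>. A power of \<open>s\<^sub>i\<close>, depending on \<open>u\<close>, kills
  \<open>C\<^sub>i\<^sub>l(u)\<close>. For the finitely many relations \<open>y\<^sub>i\<^sub>j\<close> one exponent suffices. It then suffices for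
  every relation \<open>u\<close>, because for each \<open>h\<close> some \<open>s\<^sub>h\<^sup>M u\<close> is a combination of the \<open>y\<^sub>h\<^sub>j\<close> and the \<open>s\<^sub>h\<close>
  are comaximal.\<close>
lemma weak_local_bases_rectify:
  fixes s a :: "'i \<Rightarrow> 'u" and e :: "'i \<Rightarrow> nat \<Rightarrow> 'b"
  assumes fin: "finite I"
    and E: "\<And>j. j \<in> I \<Longrightarrow> (\<Sum>i\<in>I. a i * s i) * s j = s j"
    and gen: "generates n g"
    and wb: "\<And>i. i \<in> I \<Longrightarrow> weak_local_basis (s i) k (e i)"
  obtains N \<psi> where "\<And>i. i \<in> I \<Longrightarrow> local_basis (s i ^ Suc (N i)) {..<k} (e i) (\<psi> i)"
proof -
  have g: "g \<in> {..<n} \<rightarrow> carrier M" using gen unfolding generates_def by blast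
  then have gM: "g j \<in> carrier M" if "j < n" for j using that by auto
  have e: "e i \<in> {..<k} \<rightarrow> carrier M" if "i \<in> I" for i using wb[OF that] unfolding weak_local_basis_def by blast
  have eM: "e i l \<in> carrier M" if "i \<in> I" "l < k" for i l using e[OF that(1)] that(2) by auto
  define E where "E = (\<Sum>i\<in>I. a i * s i)"
  have Es: "E * s j = s j" if "j \<in> I" for j using assms(2)[OF that] unfolding E_def .
  have EE: "E * E = E"
  proof -
    have "E * E = (\<Sum>i\<in>I. a i * (E * s i))"
      by (subst (2) E_def) (simp add: sum_distrib_left mult_ac)
    also have "\<dots> = E" unfolding E_def[symmetric] using Es by (simp add: E_def)
    finally show ?thesis .
  qed
  have "\<exists>N. \<forall>j\<in>{..<n}. \<exists>c. s i ^ N \<star> g j = comb {..<k} c (e i)" if i: "i \<in> I" for i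
  proof (rule ex_uniform_bound)
    fix j assume "j \<in> {..<n}"
    then show "\<exists>N c. s i ^ N \<star> g j = comb {..<k} c (e i)"
      using wb[OF i] gM unfolding weak_local_basis_def by blast
  next
    fix j N N' assume j: "j \<in> {..<n}" and "\<exists>c. s i ^ N \<star> g j = comb {..<k} c (e i)" and le: "N \<le> N'"
    then obtain c where c: "s i ^ N \<star> g j = comb {..<k} c (e i)" by blast
    have "s i ^ N' \<star> g j = s i ^ (N' - N) \<star> s i ^ N \<star> g j"
      using le gM j by (simp add: sc_mult[symmetric] power_add[symmetric])
    also have "\<dots> = comb {..<k} (\<lambda>l. s i ^ (N' - N) * c l) (e i)"
      unfolding c using comb_scale[OF _ e[OF i]] by simp
    finally show "\<exists>c. s i ^ N' \<star> g j = comb {..<k} c (e i)" by blast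
  qed simp
  then obtain N where "\<And>i. i \<in> I \<Longrightarrow> \<forall>j\<in>{..<n}. \<exists>c. s i ^ N i \<star> g j = comb {..<k} c (e i)" by metis
  then have "\<forall>i j. \<exists>c. i \<in> I \<longrightarrow> j < n \<longrightarrow> s i ^ N i \<star> g j = comb {..<k} c (e i)" by blast
  then obtain c where c: "\<And>i j. i \<in> I \<Longrightarrow> j < n \<Longrightarrow> s i ^ N i \<star> g j = comb {..<k} (c i j) (e i)" by metis
  have "\<forall>i l. \<exists>b. i \<in> I \<longrightarrow> l < k \<longrightarrow> e i l = comb {..<n} b g"
    using gen eM unfolding generates_def by blast
  then obtain b where b: "\<And>i l. i \<in> I \<Longrightarrow> l < k \<Longrightarrow> e i l = comb {..<n} (b i l) g" by metis
  define C where "C = (\<lambda>i l u. \<Sum>j<n. u j * c i j l)"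
  have C_comb: "comb {..<k} (\<lambda>l. C i l u) (e i) = s i ^ N i \<star> comb {..<n} u g" if i: "i \<in> I" for i u
  proof -
    have "s i ^ N i \<star> comb {..<n} u g = comb {..<n} u (\<lambda>j. s i ^ N i \<star> g j)"
      unfolding comb_def by (subst sc_sum_right)
        (use gM in \<open>auto simp: sc_mult[symmetric] mult.commute intro!: finsum_cong'\<close>)
    also have "\<dots> = comb {..<k} (\<lambda>l. C i l u) (e i)"
      unfolding C_def by (rule comb_comb) (use e c i in auto)
    finally show ?thesis ..
  qed
  have rel: "\<exists>K. \<forall>l<k. s i ^ K * C i l u = 0" if "i \<in> I" "comb {..<n} u g = \<zero>" for i u
    using wb[OF that(1)] C_comb[OF that(1), of u] that(2) unfolding weak_local_basis_def by simp
  \<comment> \<open>Column \<open>j\<close> of \<open>s\<^sub>i\<^sup>N - b c\<close>: the relation obtained by writing \<open>s\<^sub>i\<^sup>N g\<^sub>j\<close> by the \<open>e\<^sub>i\<^sub>l\<close> and these again by the generators.\<close>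
  define y where "y = (\<lambda>i j p. (if p = j then s i ^ N i else 0) - (\<Sum>l<k. c i j l * b i l p))"
  have y_rel: "comb {..<n} (y i j) g = \<zero>" if "i \<in> I" "j < n" for i j
    unfolding y_def
  proof (rule comb_diff_eq_zero[OF g])
    have "comb {..<n} (\<lambda>p. if p = j then s i ^ N i else 0) g = s i ^ N i \<star> g j"
      by (rule comb_delta) (use that g in auto)
    also have "\<dots> = comb {..<k} (c i j) (e i)" by (rule c[OF that])
    also have "\<dots> = comb {..<n} (\<lambda>p. \<Sum>l<k. c i j l * b i l p) g"
      by (rule comb_comb) (use g b that in auto)
    finally show "comb {..<n} (\<lambda>p. if p = j then s i ^ N i else 0) g
        = comb {..<n} (\<lambda>p. \<Sum>l<k. c i j l * b i l p) g" .
  qed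
  have "\<exists>K. \<forall>(i, i', j)\<in>I \<times> I \<times> {..<n}. \<forall>l<k. s i ^ K * C i l (y i' j) = 0"
  proof (rule ex_uniform_bound)
    show "finite (I \<times> I \<times> {..<n})" using fin by simp
    fix x assume "x \<in> I \<times> I \<times> {..<n}"
    then show "\<exists>K. case x of (i, i', j) \<Rightarrow> \<forall>l<k. s i ^ K * C i l (y i' j) = 0"
      using rel y_rel by auto
  next
    fix x K K' assume "case x of (i, i', j) \<Rightarrow> \<forall>l<k. s i ^ K * C i l (y i' j) = 0" "K \<le> K'"
    moreover from \<open>K \<le> K'\<close> have "s i ^ K' = s i ^ (K' - K) * s i ^ K" for i
      by (simp add: power_add[symmetric])
    ultimately show "case x of (i, i', j) \<Rightarrow> \<forall>l<k. s i ^ K' * C i l (y i' j) = 0"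
      by (auto simp: mult.assoc)
  qed
  then obtain K where K: "\<And>i i' j l. i \<in> I \<Longrightarrow> i' \<in> I \<Longrightarrow> j < n \<Longrightarrow> l < k \<Longrightarrow> s i ^ K * C i l (y i' j) = 0"
    by fastforce
  have kill: "s i ^ Suc K * C i l u = 0" if i: "i \<in> I" and l: "l < k" and u: "comb {..<n} u g = \<zero>" for i l u
  proof (rule comaximal_vanish[OF fin E_def[symmetric] EE])
    show "E * (s i ^ Suc K * C i l u) = s i ^ Suc K * C i l u"
      using Es[OF i] by (simp add: mult.assoc[symmetric])
    fix h assume h: "h \<in> I"
    obtain K' where K': "\<And>l. l < k \<Longrightarrow> s h ^ K' * C h l u = 0" using rel[OF h u] by blast
    \<comment> \<open>On relations, \<open>c\<close> vanishes up to a power of \<open>s\<^sub>h\<close>, so the matrix \<open>s\<^sub>h\<^sup>N - b c\<close> acts as \<open>s\<^sub>h\<^sup>N\<close>.\<close>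
    have expand: "s h ^ (K' + N h) * u p = (\<Sum>j<n. s h ^ K' * u j * y h j p)" if p: "p < n" for p
    proof -
      have "(\<Sum>j<n. s h ^ K' * u j * y h j p)
          = (\<Sum>j<n. if j = p then s h ^ K' * u p * s h ^ N h else 0)
            - (\<Sum>j<n. \<Sum>l<k. s h ^ K' * u j * (c h j l * b h l p))"
        unfolding sum_subtractf[symmetric]
        by (rule sum.cong) (auto simp: y_def right_diff_distrib sum_distrib_left)
      also have "(\<Sum>j<n. \<Sum>l<k. s h ^ K' * u j * (c h j l * b h l p)) = (\<Sum>l<k. (s h ^ K' * C h l u) * b h l p)"
        unfolding C_def by (subst sum.swap) (simp add: sum_distrib_left sum_distrib_right mult_ac)
      also have "\<dots> = 0" using K' by simp
      finally show ?thesis using p by (simp add: power_add mult_ac)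
    qed
    have "s h ^ (K' + N h) * C i l u = (\<Sum>p<n. (s h ^ (K' + N h) * u p) * c i p l)"
      unfolding C_def by (simp add: sum_distrib_left mult_ac)
    also have "\<dots> = (\<Sum>p<n. \<Sum>j<n. s h ^ K' * u j * y h j p * c i p l)"
      by (rule sum.cong) (auto simp: expand sum_distrib_right)
    also have "\<dots> = (\<Sum>j<n. s h ^ K' * u j * C i l (y h j))"
      unfolding C_def by (subst sum.swap) (simp add: sum_distrib_left mult_ac)
    finally have *: "s h ^ (K' + N h) * C i l u = (\<Sum>j<n. s h ^ K' * u j * C i l (y h j))" .
    have "s h ^ (K' + N h) * (s i ^ Suc K * C i l u) = s i ^ Suc K * (s h ^ (K' + N h) * C i l u)"
      by (rule mult.left_commute)
    also have "\<dots> = (\<Sum>j<n. s h ^ K' * u j * s i * (s i ^ K * C i l (y h j)))"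
      unfolding * sum_distrib_left by (simp add: mult_ac)
    also have "\<dots> = 0" using K i h l by simp
    finally show "\<exists>M. s h ^ M * (s i ^ Suc K * C i l u) = 0" by blast
  qed
  have "\<forall>x. \<exists>u. x \<in> carrier M \<longrightarrow> x = comb {..<n} u g" using gen unfolding generates_def by blast
  then obtain crd where crd: "\<And>x. x \<in> carrier M \<Longrightarrow> x = comb {..<n} (crd x) g" by metis
  \<comment> \<open>Any choice of coefficient vectors \<open>crd x\<close> will do, since the result does not depend on it. The forms are dual to the \<open>e\<^sub>i\<^sub>l\<close> only up to one further power of \<open>s\<^sub>i\<close>.\<close>
  define \<psi>0 where "\<psi>0 = (\<lambda>i l x. s i ^ Suc K * C i l (crd x))"
  have \<psi>0: "\<psi>0 i l (comb {..<n} u g) = s i ^ Suc K * C i l u" if "i \<in> I" "l < k" for i l u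
  proof -
    have "comb {..<n} (\<lambda>j. crd (comb {..<n} u g) j - u j) g = \<zero>"
      by (rule comb_diff_eq_zero[OF g]) (use crd[of "comb {..<n} u g"] g in simp)
    from kill[OF that this] have "s i ^ Suc K * (C i l (crd (comb {..<n} u g)) - C i l u) = 0"
      unfolding C_def by (simp add: left_diff_distrib sum_subtractf)
    then show ?thesis unfolding \<psi>0_def by (simp add: right_diff_distrib)
  qed
  have fun0: "functional (\<psi>0 i l)" if il: "i \<in> I" "l < k" for i l
    unfolding functional_def
  proof (intro conjI ballI allI)
    fix x z assume x: "x \<in> carrier M" and z: "z \<in> carrier M"
    have "x \<oplus> z = comb {..<n} (\<lambda>j. crd x j + crd z j) g"
      using comb_add[OF g, of "crd x" "crd z"] crd[OF x] crd[OF z] by simp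
    then show "\<psi>0 i l (x \<oplus> z) = \<psi>0 i l x + \<psi>0 i l z"
      using \<psi>0[OF il, of "\<lambda>j. crd x j + crd z j"]
      by (simp add: \<psi>0_def C_def distrib_left distrib_right sum.distrib)
  next
    fix v x assume x: "x \<in> carrier M"
    have "v \<star> x = comb {..<n} (\<lambda>j. v * crd x j) g"
      using comb_scale[OF _ g, of v "crd x"] crd[OF x] by simp
    then show "\<psi>0 i l (v \<star> x) = v * \<psi>0 i l x"
      using \<psi>0[OF il, of "\<lambda>j. v * crd x j"]
      by (simp add: \<psi>0_def C_def sum_distrib_left mult_ac)
  qed
  have comb0: "comb {..<k} (\<lambda>l. \<psi>0 i l x) (e i) = s i ^ (Suc K + N i) \<star> x"
    if i: "i \<in> I" and x: "x \<in> carrier M" for i x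
  proof -
    have "comb {..<k} (\<lambda>l. \<psi>0 i l x) (e i) = s i ^ Suc K \<star> comb {..<k} (\<lambda>l. C i l (crd x)) (e i)"
      unfolding \<psi>0_def by (rule comb_scale) (use e[OF i] in auto)
    also have "comb {..<k} (\<lambda>l. C i l (crd x)) (e i) = s i ^ N i \<star> x"
      using C_comb[OF i, of "crd x"] crd[OF x] by simp
    also have "s i ^ Suc K \<star> s i ^ N i \<star> x = s i ^ (Suc K + N i) \<star> x"
      unfolding power_add by (rule sc_mult[OF x, symmetric])
    finally show ?thesis .
  qed
  have "\<exists>L. \<forall>m\<in>{..<k}. \<forall>l<k. s i ^ L * (\<psi>0 i l (e i m) - (if l = m then s i ^ (Suc K + N i) else 0)) = 0"
    if i: "i \<in> I" for i
  proof (rule ex_uniform_bound)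
    fix m assume m: "m \<in> {..<k}"
    have "comb {..<k} (\<lambda>l. \<psi>0 i l (e i m) - (if l = m then s i ^ (Suc K + N i) else 0)) (e i) = \<zero>"
    proof (rule comb_diff_eq_zero[OF e[OF i]])
      have "comb {..<k} (\<lambda>l. if l = m then s i ^ (Suc K + N i) else 0) (e i) = s i ^ (Suc K + N i) \<star> e i m"
        by (rule comb_delta) (use m e[OF i] in auto)
      then show "comb {..<k} (\<lambda>l. \<psi>0 i l (e i m)) (e i)
          = comb {..<k} (\<lambda>l. if l = m then s i ^ (Suc K + N i) else 0) (e i)"
        using comb0[OF i eM[OF i]] m by simp
    qed
    then show "\<exists>L. \<forall>l<k. s i ^ L * (\<psi>0 i l (e i m) - (if l = m then s i ^ (Suc K + N i) else 0)) = 0"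
      using wb[OF i] unfolding weak_local_basis_def by blast
  next
    fix m L L'
    assume *: "\<forall>l<k. s i ^ L * (\<psi>0 i l (e i m) - (if l = m then s i ^ (Suc K + N i) else 0)) = 0" and "L \<le> L'"
    show "\<forall>l<k. s i ^ L' * (\<psi>0 i l (e i m) - (if l = m then s i ^ (Suc K + N i) else 0)) = 0"
    proof (intro allI impI)
      fix l assume "l < k"
      then have z: "s i ^ L * (\<psi>0 i l (e i m) - (if l = m then s i ^ (Suc K + N i) else 0)) = 0"
        using * by blast
      from \<open>L \<le> L'\<close> have L': "s i ^ L' = s i ^ (L' - L) * s i ^ L"
        by (simp add: power_add[symmetric])
      show "s i ^ L' * (\<psi>0 i l (e i m) - (if l = m then s i ^ (Suc K + N i) else 0)) = 0"
        unfolding L' mult.assoc z by simp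
    qed
  qed simp
  then obtain L where L: "\<And>i. i \<in> I \<Longrightarrow> \<forall>m\<in>{..<k}. \<forall>l<k.
      s i ^ L i * (\<psi>0 i l (e i m) - (if l = m then s i ^ (Suc K + N i) else 0)) = 0"
    by metis
  have "local_basis (s i ^ Suc (L i + K + N i)) {..<k} (e i) (\<lambda>l x. s i ^ L i * \<psi>0 i l x)" if i: "i \<in> I" for i
  proof -
    have t: "s i ^ Suc (L i + K + N i) = s i ^ L i * s i ^ (Suc K + N i)"
      unfolding power_add[symmetric] by (simp add: add.assoc)
    have "s i ^ L i * \<psi>0 i l (e i m) = (if l = m then s i ^ L i * s i ^ (Suc K + N i) else 0)"
      if "l < k" "m < k" for l m
    proof -
      have "s i ^ L i * (\<psi>0 i l (e i m) - (if l = m then s i ^ (Suc K + N i) else 0)) = 0"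
        using L[OF i] that by blast
      then show ?thesis by (simp add: right_diff_distrib split: if_splits del: power_Suc)
    qed
    moreover have "comb {..<k} (\<lambda>l. s i ^ L i * \<psi>0 i l x) (e i) = (s i ^ L i * s i ^ (Suc K + N i)) \<star> x"
      if "x \<in> carrier M" for x
      using comb_scale[OF _ e[OF i], of "s i ^ L i" "\<lambda>l. \<psi>0 i l x"] comb0[OF i that] that
      by (simp add: sc_mult del: power_Suc)
    ultimately show ?thesis
      unfolding local_basis_def t using e[OF i] fun0[OF i] by (auto intro: functional_mult)
  qed
  then show thesis by (rule that)
qed

text \<open>As \<open>\<Sum>\<^sub>i a\<^sub>i t\<^sub>i\<close> acts as \<open>1\<close>, summing \<open>a\<^sub>i t\<^sub>i x = \<Sum>\<^sub>l a\<^sub>i \<psi>\<^sub>i\<^sub>l(x) e\<^sub>i\<^sub>l\<close> over \<open>i\<close> shows that all the \<open>e\<^sub>i\<^sub>l\<close>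
  together form a dual basis with the forms \<open>a\<^sub>i \<psi>\<^sub>i\<^sub>l\<close>; then the \<open>e\<^sub>i\<^sub>l\<close> are expressed by the generators.\<close>
lemma dual_basis_of_local_bases:
  fixes t a :: "'i \<Rightarrow> 'u" and e :: "'i \<Rightarrow> nat \<Rightarrow> 'b"
  assumes fin: "finite I" and gen: "generates n g"
    and lb: "\<And>i. i \<in> I \<Longrightarrow> local_basis (t i) {..<k} (e i) (\<psi> i)"
    and cover: "\<And>x. x \<in> carrier M \<Longrightarrow> (\<Sum>i\<in>I. a i * t i) \<star> x = x"
  obtains \<iota> where "dual_basis n g \<iota>"
proof -
  have g: "g \<in> {..<n} \<rightarrow> carrier M" using gen unfolding generates_def by blast
  have "\<forall>i l. \<exists>b. i \<in> I \<longrightarrow> l < k \<longrightarrow> e i l = comb {..<n} b g"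
  proof (intro allI)
    fix i l show "\<exists>b. i \<in> I \<longrightarrow> l < k \<longrightarrow> e i l = comb {..<n} b g"
    proof (cases "i \<in> I \<and> l < k")
      case True
      then have "e i l \<in> carrier M" using lb[of i] unfolding local_basis_def by auto
      then show ?thesis using gen unfolding generates_def by blast
    qed blast
  qed
  then obtain b where b: "\<And>i l. i \<in> I \<Longrightarrow> l < k \<Longrightarrow> e i l = comb {..<n} (b i l) g" by metis
  have "dual_basis n g (\<lambda>p x. \<Sum>i\<in>I. a i * (\<Sum>l<k. b i l p * \<psi> i l x))"
    unfolding dual_basis_def
  proof (intro conjI ballI allI impI)
    fix x assume x: "x \<in> carrier M"
    have "comb {..<n} (\<lambda>p. \<Sum>i\<in>I. a i * (\<Sum>l<k. b i l p * \<psi> i l x)) g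
        = (\<Oplus>i\<in>I. comb {..<n} (\<lambda>p. a i * (\<Sum>l<k. \<psi> i l x * b i l p)) g)"
      by (subst comb_sum[OF g fin]) (simp add: mult.commute)
    also have "\<dots> = (\<Oplus>i\<in>I. (a i * t i) \<star> x)"
    proof (rule finsum_cong')
      fix i assume i: "i \<in> I"
      have "comb {..<n} (\<lambda>p. a i * (\<Sum>l<k. \<psi> i l x * b i l p)) g
          = a i \<star> comb {..<n} (\<lambda>p. \<Sum>l<k. \<psi> i l x * b i l p) g"
        by (rule comb_scale) (use g in auto)
      also have "comb {..<n} (\<lambda>p. \<Sum>l<k. \<psi> i l x * b i l p) g = comb {..<k} (\<lambda>l. \<psi> i l x) (e i)"
        by (rule comb_comb[symmetric]) (use g b i in auto)
      also have "\<dots> = t i \<star> x" using lb[OF i] x unfolding local_basis_def by blast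
      finally show "comb {..<n} (\<lambda>p. a i * (\<Sum>l<k. \<psi> i l x * b i l p)) g = (a i * t i) \<star> x"
        using x by (simp add: sc_mult)
    qed (use x in auto)
    also have "\<dots> = x" using sc_sum_left[OF fin x, symmetric] cover[OF x] by simp
    finally show "x = comb {..<n} (\<lambda>p. \<Sum>i\<in>I. a i * (\<Sum>l<k. b i l p * \<psi> i l x)) g" ..
  qed (use g lb in \<open>auto simp: local_basis_def intro!: functional_sum_mult\<close>)
  then show thesis by (rule that)
qed

section \<open>The matrix of a dual basis\<close>

definition coord_mat :: "nat \<Rightarrow> (nat \<Rightarrow> 'b) \<Rightarrow> (nat \<Rightarrow> 'b \<Rightarrow> 'u) \<Rightarrow> 'u mat" where
  "coord_mat q w \<phi> = mat q q (\<lambda>(i, j). \<phi> i (w j))"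

lemma coord_mat_carrier [simp]: "coord_mat q w \<phi> \<in> carrier_mat q q"
  by (simp add: coord_mat_def)

text \<open>The matrices \<open>U = (\<phi>\<^sub>p(e\<^sub>l))\<close> and \<open>V = (\<psi>\<^sub>l(w\<^sub>j))\<close> express the passage between the dual basis and the
  local basis; evaluating the two expansions of \<open>t x\<close> and \<open>x\<close> gives \<open>U V = t G\<close> and \<open>V U = t\<close>.\<close>
lemma char_poly_local_basis:
  assumes db: "dual_basis q w \<phi>" and lb: "local_basis t {..<k} e \<psi>"
  shows "[:t:] ^ (q + k) * ([:0, 1:] ^ k * char_poly (coord_mat q w \<phi>))
    = [:t:] ^ (q + k) * ([:0, 1:] ^ q * [:-1, 1:] ^ k)"
proof (rule char_poly_factored)
  have w: "w \<in> {..<q} \<rightarrow> carrier M" and \<phi>: "\<And>i. i < q \<Longrightarrow> functional (\<phi> i)"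
    and rep: "\<And>x. x \<in> carrier M \<Longrightarrow> x = comb {..<q} (\<lambda>i. \<phi> i x) w"
    using db unfolding dual_basis_def by blast+
  have e: "e \<in> {..<k} \<rightarrow> carrier M" and \<psi>: "\<And>l. l < k \<Longrightarrow> functional (\<psi> l)"
    and rep': "\<And>x. x \<in> carrier M \<Longrightarrow> comb {..<k} (\<lambda>l. \<psi> l x) e = t \<star> x"
    and delta: "\<And>l m. l < k \<Longrightarrow> m < k \<Longrightarrow> \<psi> l (e m) = (if l = m then t else 0)"
    using lb unfolding local_basis_def by blast+
  let ?U = "mat q k (\<lambda>(p, l). \<phi> p (e l))" and ?V = "mat k q (\<lambda>(l, j). \<psi> l (w j))"
  show "?U \<in> carrier_mat q k" "?V \<in> carrier_mat k q" "coord_mat q w \<phi> \<in> carrier_mat q q" by simp_all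
  show "?U * ?V = t \<cdot>\<^sub>m coord_mat q w \<phi>"
  proof (rule eq_matI)
    fix p j assume "p < dim_row (t \<cdot>\<^sub>m coord_mat q w \<phi>)" "j < dim_col (t \<cdot>\<^sub>m coord_mat q w \<phi>)"
    then have pj: "p < q" "j < q" by (auto simp: coord_mat_def)
    then have wj: "w j \<in> carrier M" using w by auto
    have "(?U * ?V) $$ (p, j) = (\<Sum>l<k. \<psi> l (w j) * \<phi> p (e l))"
      using pj by (simp add: scalar_prod_def atLeast0LessThan mult.commute)
    also have "\<dots> = \<phi> p (comb {..<k} (\<lambda>l. \<psi> l (w j)) e)"
      by (rule functional_comb[symmetric]) (use pj \<phi> e in auto)
    also have "\<dots> = t * \<phi> p (w j)"
      unfolding rep'[OF wj] by (rule functionalD(2)[OF \<phi>[OF pj(1)] wj])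
    finally show "(?U * ?V) $$ (p, j) = (t \<cdot>\<^sub>m coord_mat q w \<phi>) $$ (p, j)"
      using pj by (simp add: coord_mat_def)
  qed (auto simp: coord_mat_def)
  show "?V * ?U = t \<cdot>\<^sub>m 1\<^sub>m k"
  proof (rule eq_matI)
    fix l m assume "l < dim_row (t \<cdot>\<^sub>m 1\<^sub>m k)" "m < dim_col (t \<cdot>\<^sub>m 1\<^sub>m k)"
    then have lm: "l < k" "m < k" by auto
    then have em: "e m \<in> carrier M" using e by auto
    have "(?V * ?U) $$ (l, m) = (\<Sum>p<q. \<phi> p (e m) * \<psi> l (w p))"
      using lm by (simp add: scalar_prod_def atLeast0LessThan mult.commute)
    also have "\<dots> = \<psi> l (comb {..<q} (\<lambda>p. \<phi> p (e m)) w)"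
      by (rule functional_comb[symmetric]) (use lm \<psi> w in auto)
    also have "\<dots> = \<psi> l (e m)" using rep[OF em] by simp
    finally show "(?V * ?U) $$ (l, m) = (t \<cdot>\<^sub>m 1\<^sub>m k) $$ (l, m)"
      using lm delta by simp
  qed auto
qed

lemma local_basis_of_principal_minor:
  assumes db: "dual_basis n g \<iota>" and S: "S \<subseteq> {0..<n}" "card S = k"
    and D: "D \<in> carrier_mat n n"
    and inv: "D * principal_minor_mat (coord_mat n g \<iota>) S = s \<cdot>\<^sub>m 1\<^sub>m n"
    and nil: "nilpotent_coeffs ([:s:] * (char_poly (coord_mat n g \<iota>) - [:0, 1:] ^ (n - k) * [:-1, 1:] ^ k))"
  obtains N e \<psi> where "local_basis (s ^ Suc N) {..<k} e \<psi>"
proof -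
  let ?G = "coord_mat n g \<iota>"
  have G: "?G \<in> carrier_mat n n" by simp
  have GG: "?G * ?G = ?G"
    by (rule eq_matI) (auto simp: coord_mat_def scalar_prod_def atLeast0LessThan dual_basis_idempotent[OF db])
  obtain N V where V: "V \<in> carrier_mat n n" and GV: "?G * coord_proj n S * V = s ^ Suc N \<cdot>\<^sub>m ?G"
    and VG: "V * (?G * coord_proj n S) = s ^ Suc N \<cdot>\<^sub>m coord_proj n S"
    using principal_minor_factorization[OF G GG S D inv nil] by blast
  note VG = VG[unfolded coord_proj_mult_right[OF G]] and GV = GV[unfolded coord_proj_mult_right[OF G]]
  have fin: "finite S" using S finite_subset by blast
  have "local_basis (s ^ Suc N) S g (\<lambda>l x. \<Sum>j<n. V $$ (l, j) * \<iota> j x)"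
  proof (rule local_basis_of_factorization[OF db])
    show "S \<subseteq> {..<n}" using S by auto
    fix i j assume ij: "i < n" "j < n"
    have "(\<Sum>l\<in>S. \<iota> i (g l) * V $$ (l, j)) = (\<Sum>l<n. (if l \<in> S then \<iota> i (g l) else 0) * V $$ (l, j))"
      using S by (intro sum.mono_neutral_cong_left) auto
    also have "\<dots> = (mat n n (\<lambda>(i, j). if j \<in> S then ?G $$ (i, j) else 0) * V) $$ (i, j)"
      using ij V by (auto simp: scalar_prod_def atLeast0LessThan coord_mat_def intro!: sum.cong)
    also have "\<dots> = s ^ Suc N * \<iota> i (g j)" unfolding GV using ij by (simp add: coord_mat_def)
    finally show "(\<Sum>l\<in>S. \<iota> i (g l) * V $$ (l, j)) = s ^ Suc N * \<iota> i (g j)" .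
  next
    fix l m assume lm: "l \<in> S" "m \<in> S"
    then have lmn: "l < n" "m < n" using S by auto
    have "(\<Sum>j<n. V $$ (l, j) * \<iota> j (g m))
        = (V * mat n n (\<lambda>(i, j). if j \<in> S then ?G $$ (i, j) else 0)) $$ (l, m)"
      using lmn lm V by (auto simp: scalar_prod_def atLeast0LessThan coord_mat_def intro!: sum.cong)
    also have "\<dots> = (if l = m then s ^ Suc N else 0)"
      unfolding VG using lmn lm by (simp add: coord_proj_def)
    finally show "(\<Sum>j<n. V $$ (l, j) * \<iota> j (g m)) = (if l = m then s ^ Suc N else 0)" .
  qed
  moreover obtain f where "bij_betw f {..<k} S"
    using ex_bij_betw_nat_finite[OF fin] S(2) by (auto simp: atLeast0LessThan)
  ultimately show thesis using local_basis_reindex that by blast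
qed

end

context cring
begin

lemma emb_zero [simp]: "emb R \<zero> = 0"
  using emb_add[of \<zero> \<zero>] by simp

lemma emb_sum: "finite I \<Longrightarrow> a \<in> I \<rightarrow> carrier R \<Longrightarrow> emb R (\<Oplus>i\<in>I. a i) = (\<Sum>i\<in>I. emb R (a i))"
  by (induction I rule: finite_induct) (auto simp: emb_add Pi_def)

lemma emb_inj: "a \<in> carrier R \<Longrightarrow> b \<in> carrier R \<Longrightarrow> emb R a = emb R b \<longleftrightarrow> a = b"
  using proj_emb by metis

lemma emb_mult_emb: "a \<in> carrier R \<Longrightarrow> b \<in> carrier R \<Longrightarrow> emb R (a \<otimes> b) = emb R a * emb R b"
  by (simp add: emb_mult)

end

section \<open>Dual bases, projective modules and idempotent matrices\<close>

lemma free_module_carrier: "carrier (free_module R q) = {..<q} \<rightarrow>\<^sub>E carrier R"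
  and free_module_zero: "\<zero>\<^bsub>free_module R q\<^esub> = (\<lambda>i\<in>{..<q}. \<zero>\<^bsub>R\<^esub>)"
  and free_module_add: "u \<oplus>\<^bsub>free_module R q\<^esub> v = (\<lambda>i\<in>{..<q}. u i \<oplus>\<^bsub>R\<^esub> v i)"
  and free_module_smult: "a \<odot>\<^bsub>free_module R q\<^esub> u = (\<lambda>i\<in>{..<q}. a \<otimes>\<^bsub>R\<^esub> u i)"
  by (simp_all add: free_module_def)

lemmas free_module_simps = free_module_carrier free_module_zero free_module_add free_module_smult

lemma (in cring) free_module_is_module: "module R (free_module R q)"
proof (rule moduleI)
  show "cring R" ..
  show "abelian_group (free_module R q)"
  proof (rule abelian_groupI)
    fix x assume x: "x \<in> carrier (free_module R q)"
    show "\<exists>y\<in>carrier (free_module R q). y \<oplus>\<^bsub>free_module R q\<^esub> x = \<zero>\<^bsub>free_module R q\<^esub>"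
      by (rule bexI[of _ "\<lambda>i\<in>{..<q}. \<ominus> x i"])
        (use x in \<open>auto simp: free_module_simps PiE_iff l_neg intro!: restrict_ext\<close>)
  qed (auto simp: free_module_simps PiE_iff a_ac extensional_def intro!: restrict_ext)
qed (auto simp: free_module_simps PiE_iff l_distr r_distr m_assoc extensional_def intro!: restrict_ext)

context module
begin

sublocale scalar: scalar_module M "\<lambda>u x. proj R u \<odot>\<^bsub>M\<^esub> x"
  by unfold_locales
    (auto simp: R.proj.h_add R.proj.h_mult R.proj.h_one smult_l_distr smult_r_distr smult_assoc1)

lemma generated_by_n_generates:
  assumes "generated_by_n R M n"
  obtains g where "scalar.generates n g"
proof -
  obtain g where g: "g \<in> {..<n} \<rightarrow> carrier M"
    and gen: "\<And>x. x \<in> carrier M \<Longrightarrow> \<exists>a \<in> {..<n} \<rightarrow> carrier R. x = (\<Oplus>\<^bsub>M\<^esub>i\<in>{..<n}. a i \<odot>\<^bsub>M\<^esub> g i)"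
    using assms unfolding generated_by_n_def by blast
  have "\<exists>u. x = scalar.comb {..<n} u g" if x: "x \<in> carrier M" for x
  proof -
    obtain a where a: "a \<in> {..<n} \<rightarrow> carrier R" and xa: "x = (\<Oplus>\<^bsub>M\<^esub>i\<in>{..<n}. a i \<odot>\<^bsub>M\<^esub> g i)"
      using gen[OF x] by blast
    have "scalar.comb {..<n} (\<lambda>i. emb R (a i)) g = x"
      unfolding xa scalar.comb_def by (rule M.finsum_cong') (use a g in \<open>auto simp: Pi_def\<close>)
    then show ?thesis by metis
  qed
  then show thesis using that g unfolding scalar.generates_def by blast
qed

text \<open>The idempotent \<open>emb R \<one>\<close> acts as the identity on \<open>M\<close>, so linear forms take values in the factor \<open>R\<close>.\<close>
lemma functional_eq_emb:
  assumes "scalar.functional \<phi>" "x \<in> carrier M"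
  shows "\<phi> x = emb R (proj R (\<phi> x))"
proof -
  have "\<phi> x = \<phi> (proj R (emb R \<one>) \<odot>\<^bsub>M\<^esub> x)" using assms by simp
  also have "\<dots> = emb R \<one> * \<phi> x" by (rule scalar.functionalD(2)[OF assms])
  finally show ?thesis by (simp add: R.emb_mult)
qed

lemma functional_emb:
  assumes "\<And>x. x \<in> carrier M \<Longrightarrow> f x \<in> carrier R"
    and "\<And>x y. x \<in> carrier M \<Longrightarrow> y \<in> carrier M \<Longrightarrow> f (x \<oplus>\<^bsub>M\<^esub> y) = f x \<oplus> f y"
    and "\<And>a x. a \<in> carrier R \<Longrightarrow> x \<in> carrier M \<Longrightarrow> f (a \<odot>\<^bsub>M\<^esub> x) = a \<otimes> f x"
  shows "scalar.functional (\<lambda>x. emb R (f x))"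
proof -
  have "emb R (f (proj R u \<odot>\<^bsub>M\<^esub> x)) = u * emb R (f x)" if x: "x \<in> carrier M" for u x
  proof -
    have "u * emb R (f x) = emb R (f x \<otimes> proj R u)"
      using R.emb_mult[OF assms(1)[OF x], of u] by (simp add: mult.commute)
    then show ?thesis using assms(1,3) x by (simp add: R.m_comm)
  qed
  then show ?thesis unfolding scalar.functional_def using assms(1,2) by (simp add: R.emb_add)
qed

text \<open>The embedding into a free module that belongs to a dual basis.\<close>
definition coords :: "nat \<Rightarrow> (nat \<Rightarrow> 'c \<Rightarrow> ('a, 'b) cring_prod) \<Rightarrow> 'c \<Rightarrow> nat \<Rightarrow> 'a" where
  "coords q \<phi> x = (\<lambda>i\<in>{..<q}. proj R (\<phi> i x))"

lemma coords_linear: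
  assumes "\<And>i. i < q \<Longrightarrow> scalar.functional (\<phi> i)"
  shows "x \<in> carrier M \<Longrightarrow> y \<in> carrier M
      \<Longrightarrow> coords q \<phi> (x \<oplus>\<^bsub>M\<^esub> y) = coords q \<phi> x \<oplus>\<^bsub>free_module R q\<^esub> coords q \<phi> y"
    and "a \<in> carrier R \<Longrightarrow> x \<in> carrier M
      \<Longrightarrow> coords q \<phi> (a \<odot>\<^bsub>M\<^esub> x) = a \<odot>\<^bsub>free_module R q\<^esub> coords q \<phi> x"
    and "coords q \<phi> x \<in> carrier (free_module R q)"
proof -
  show "coords q \<phi> x \<in> carrier (free_module R q)"
    by (auto simp: coords_def free_module_simps)
  show "coords q \<phi> (x \<oplus>\<^bsub>M\<^esub> y) = coords q \<phi> x \<oplus>\<^bsub>free_module R q\<^esub> coords q \<phi> y"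
    if "x \<in> carrier M" "y \<in> carrier M"
    using that assms
    by (auto simp: coords_def free_module_simps scalar.functionalD(1) R.proj.h_add intro!: restrict_ext)
  show "coords q \<phi> (a \<odot>\<^bsub>M\<^esub> x) = a \<odot>\<^bsub>free_module R q\<^esub> coords q \<phi> x"
    if a: "a \<in> carrier R" and x: "x \<in> carrier M"
  proof -
    have "\<phi> i (a \<odot>\<^bsub>M\<^esub> x) = emb R a * \<phi> i x" if "i < q" for i
      using scalar.functionalD(2)[OF assms[OF that] x, of "emb R a"] a by simp
    then show ?thesis
      using a by (auto simp: coords_def free_module_simps R.proj.h_mult intro!: restrict_ext)
  qed
qed

lemma coords_inj:
  assumes db: "scalar.dual_basis q w \<phi>"
  shows "inj_on (coords q \<phi>) (carrier M)"
proof (rule inj_onI)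
  fix x y assume x: "x \<in> carrier M" and y: "y \<in> carrier M" and eq: "coords q \<phi> x = coords q \<phi> y"
  have fn: "scalar.functional (\<phi> i)" if "i < q" for i using db that unfolding scalar.dual_basis_def by blast
  have "\<phi> i x = \<phi> i y" if "i < q" for i
    using fun_cong[OF eq, of i] functional_eq_emb[OF fn[OF that] x] functional_eq_emb[OF fn[OF that] y] that
    by (simp add: coords_def)
  moreover have "w \<in> {..<q} \<rightarrow> carrier M" using db unfolding scalar.dual_basis_def by blast
  ultimately have "scalar.comb {..<q} (\<lambda>i. \<phi> i x) w = scalar.comb {..<q} (\<lambda>i. \<phi> i y) w"
    by (intro scalar.comb_cong) auto
  then show "x = y" using db x y unfolding scalar.dual_basis_def by metis
qed

lemma module_iso_coords:
  assumes db: "scalar.dual_basis q w \<phi>"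
  shows "module_iso R M ((free_module R q)\<lparr>carrier := coords q \<phi> ` carrier M\<rparr>)"
proof -
  have fn: "\<And>i. i < q \<Longrightarrow> scalar.functional (\<phi> i)" using db unfolding scalar.dual_basis_def by blast
  have "bij_betw (coords q \<phi>) (carrier M) (coords q \<phi> ` carrier M)"
    using coords_inj[OF db] by (rule inj_on_imp_bij_betw)
  then show ?thesis
    unfolding module_iso_def using coords_linear[OF fn] by (intro exI[of _ "coords q \<phi>"]) auto
qed

lemma dual_basis_mat_image:
  assumes db: "scalar.dual_basis q w \<phi>"
  defines "G \<equiv> \<lambda>i j. proj R (\<phi> i (w j))"
  shows "sq_matrix R q G" and "idempotent_matrix R q G" and "module_iso R M (mat_image R q G)"
proof -
  have w: "w \<in> {..<q} \<rightarrow> carrier M" and fn: "\<And>i. i < q \<Longrightarrow> scalar.functional (\<phi> i)"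
    using db unfolding scalar.dual_basis_def by blast+
  show "sq_matrix R q G" unfolding sq_matrix_def G_def by simp
  show "idempotent_matrix R q G"
    unfolding idempotent_matrix_def G_def R.proj.h_mult[symmetric]
    by (simp add: R.proj.h_sum[symmetric] scalar.dual_basis_idempotent[OF db])
  have app: "mat_apply R q G u = coords q \<phi> (scalar.comb {..<q} (\<lambda>j. emb R (u j)) w)"
    if u: "u \<in> carrier (free_module R q)" for u
    unfolding mat_apply_def coords_def
  proof (rule restrict_ext)
    fix i assume i: "i \<in> {..<q}"
    have uj: "u j \<in> carrier R" if "j < q" for j using u that by (auto simp: free_module_simps)
    have "proj R (\<phi> i (scalar.comb {..<q} (\<lambda>j. emb R (u j)) w)) = proj R (\<Sum>j<q. emb R (u j) * \<phi> i (w j))"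
      using scalar.functional_comb[OF fn finite_lessThan w] i by simp
    also have "\<dots> = (\<Oplus>j\<in>{..<q}. G i j \<otimes> u j)"
      unfolding R.proj.h_sum[OF finite_lessThan] G_def
      by (rule R.finsum_cong') (use uj in \<open>auto simp: R.proj.h_mult R.m_comm\<close>)
    finally show "(\<Oplus>j\<in>{..<q}. G i j \<otimes> u j) = proj R (\<phi> i (scalar.comb {..<q} (\<lambda>j. emb R (u j)) w))" ..
  qed
  have "mat_apply R q G ` carrier (free_module R q) = coords q \<phi> ` carrier M"
  proof (intro equalityI subsetI)
    fix v assume "v \<in> mat_apply R q G ` carrier (free_module R q)"
    then show "v \<in> coords q \<phi> ` carrier M" using app w by auto
  next
    fix v assume "v \<in> coords q \<phi> ` carrier M"
    then obtain x where x: "x \<in> carrier M" and v: "v = coords q \<phi> x" by blast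
    have "scalar.comb {..<q} (\<lambda>j. emb R (coords q \<phi> x j)) w = scalar.comb {..<q} (\<lambda>j. \<phi> j x) w"
      by (rule scalar.comb_cong) (use w functional_eq_emb[OF fn x] in \<open>auto simp: coords_def\<close>)
    also have "\<dots> = x" using db x unfolding scalar.dual_basis_def by metis
    finally have "scalar.comb {..<q} (\<lambda>j. emb R (v j)) w = x" unfolding v .
    moreover have cx: "v \<in> carrier (free_module R q)" unfolding v using fn by (rule coords_linear(3))
    ultimately have "mat_apply R q G v = v" using app[of v] v by simp
    then show "v \<in> mat_apply R q G ` carrier (free_module R q)"
      using cx image_eqI[of v "mat_apply R q G" v] by simp
  qed
  then show "module_iso R M (mat_image R q G)"
    unfolding mat_image_def using module_iso_coords[OF db] by simp
qed

lemma iso_functional: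
  assumes f: "\<And>x. x \<in> carrier M \<Longrightarrow> f x \<in> carrier (free_module R q)"
    and add: "\<And>x y. x \<in> carrier M \<Longrightarrow> y \<in> carrier M \<Longrightarrow> f (x \<oplus>\<^bsub>M\<^esub> y) = f x \<oplus>\<^bsub>free_module R q\<^esub> f y"
    and smult: "\<And>a x. a \<in> carrier R \<Longrightarrow> x \<in> carrier M \<Longrightarrow> f (a \<odot>\<^bsub>M\<^esub> x) = a \<odot>\<^bsub>free_module R q\<^esub> f x"
    and i: "i < q"
  shows "scalar.functional (\<lambda>x. emb R (f x i))"
  by (rule functional_emb) (use f i in \<open>auto simp: add smult free_module_simps PiE_iff\<close>)

text \<open>The components of an isomorphism onto the image of \<open>G\<close> are the forms, and the elements \<open>w\<^sub>j\<close>
  correspond to the columns of \<open>G\<close>; the expansion of \<open>x\<close> says that \<open>G\<close> fixes its image.\<close>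
lemma mat_image_dual_basis:
  assumes sq: "sq_matrix R q G" and idem: "idempotent_matrix R q G"
    and iso: "module_iso R M (mat_image R q G)"
  obtains w \<phi> where "scalar.dual_basis q w \<phi>"
    and "\<And>i j. i < q \<Longrightarrow> j < q \<Longrightarrow> proj R (\<phi> i (w j)) = G i j"
proof -
  let ?F = "free_module R q"
  have G: "G i j \<in> carrier R" if "i < q" "j < q" for i j using sq that unfolding sq_matrix_def by blast
  obtain f where bij: "bij_betw f (carrier M) (mat_apply R q G ` carrier ?F)"
    and add: "\<And>x y. x \<in> carrier M \<Longrightarrow> y \<in> carrier M \<Longrightarrow> f (x \<oplus>\<^bsub>M\<^esub> y) = f x \<oplus>\<^bsub>?F\<^esub> f y"
    and smult: "\<And>a x. a \<in> carrier R \<Longrightarrow> x \<in> carrier M \<Longrightarrow> f (a \<odot>\<^bsub>M\<^esub> x) = a \<odot>\<^bsub>?F\<^esub> f x"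
    using iso unfolding module_iso_def mat_image_def by auto
  have sub: "mat_apply R q G u \<in> carrier ?F" if "u \<in> carrier ?F" for u
    using that G by (auto simp: mat_apply_def free_module_simps PiE_iff intro!: R.finsum_closed)
  have f: "f x \<in> carrier ?F" if "x \<in> carrier M" for x
    using bij_betw_apply[OF bij that] sub by (auto elim!: imageE)
  define \<phi> where "\<phi> = (\<lambda>i x. emb R (f x i))"
  have fn: "scalar.functional (\<phi> i)" if "i < q" for i
    unfolding \<phi>_def using iso_functional[OF f add smult that] .
  have "(\<lambda>i\<in>{..<q}. G i j) \<in> f ` carrier M" if j: "j < q" for j
  proof -
    let ?e = "\<lambda>i\<in>{..<q}. if i = j then \<one> else \<zero>"
    have "mat_apply R q G ?e = (\<lambda>i\<in>{..<q}. G i j)"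
      unfolding mat_apply_def
    proof (rule restrict_ext)
      fix i assume i: "i \<in> {..<q}"
      have "(\<Oplus>h\<in>{..<q}. G i h \<otimes> ?e h) = (\<Oplus>h\<in>{..<q}. if j = h then G i h else \<zero>)"
        by (rule R.finsum_cong') (use G i in auto)
      also have "\<dots> = G i j" by (rule R.add.finprod_singleton) (use G i j in auto)
      finally show "(\<Oplus>h\<in>{..<q}. G i h \<otimes> ?e h) = G i j" .
    qed
    moreover have "?e \<in> carrier ?F" by (auto simp: free_module_simps)
    ultimately show ?thesis using bij_betw_imp_surj_on[OF bij] by (metis imageI)
  qed
  then have "\<forall>j. \<exists>x. j < q \<longrightarrow> x \<in> carrier M \<and> f x = (\<lambda>i\<in>{..<q}. G i j)" by force
  then obtain w where wM: "\<And>j. j < q \<Longrightarrow> w j \<in> carrier M" and fw: "\<And>j. j < q \<Longrightarrow> f (w j) = (\<lambda>i\<in>{..<q}. G i j)"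
    by metis
  have w: "w \<in> {..<q} \<rightarrow> carrier M" using wM by auto
  have \<phi>w: "\<phi> i (w j) = emb R (G i j)" if "i < q" "j < q" for i j
    unfolding \<phi>_def fw[OF that(2)] using that by simp
  have GG: "(\<Sum>l<q. emb R (G i l) * emb R (G l j)) = emb R (G i j)" if "i < q" "j < q" for i j
  proof -
    have "(\<Oplus>l\<in>{..<q}. G i l \<otimes> G l j) = G i j" using idem that unfolding idempotent_matrix_def by blast
    then have "emb R (G i j) = emb R (\<Oplus>l\<in>{..<q}. G i l \<otimes> G l j)" by simp
    also have "\<dots> = (\<Sum>l<q. emb R (G i l \<otimes> G l j))"
      by (rule R.emb_sum) (use G that in auto)
    finally show ?thesis using G that by (simp add: R.emb_mult_emb)
  qed
  have "scalar.dual_basis q w \<phi>"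
    unfolding scalar.dual_basis_def
  proof (intro conjI ballI allI impI w fn)
    fix x assume x: "x \<in> carrier M"
    obtain u where u: "u \<in> carrier ?F" and fx: "f x = mat_apply R q G u"
      using bij_betw_apply[OF bij x] by (rule imageE)
    have uj: "u j \<in> carrier R" if "j < q" for j using u that by (auto simp: free_module_simps)
    have \<phi>x: "\<phi> i x = (\<Sum>l<q. emb R (G i l) * emb R (u l))" if i: "i < q" for i
    proof -
      have "\<phi> i x = emb R (\<Oplus>l\<in>{..<q}. G i l \<otimes> u l)" unfolding \<phi>_def fx using i by (simp add: mat_apply_def)
      also have "\<dots> = (\<Sum>l<q. emb R (G i l \<otimes> u l))" by (rule R.emb_sum) (use G uj i in auto)
      finally show ?thesis using G uj i by (simp add: R.emb_mult_emb)
    qed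
    let ?c = "scalar.comb {..<q} (\<lambda>i. \<phi> i x) w"
    have c: "?c \<in> carrier M" using w by auto
    have "\<phi> i ?c = \<phi> i x" if i: "i < q" for i
    proof -
      have "\<phi> i ?c = (\<Sum>j<q. \<phi> j x * \<phi> i (w j))"
        by (rule scalar.functional_comb[OF fn[OF i] finite_lessThan w])
      also have "\<dots> = (\<Sum>j<q. \<Sum>l<q. emb R (G i j) * emb R (G j l) * emb R (u l))"
        by (rule sum.cong) (auto simp: \<phi>w \<phi>x i sum_distrib_left sum_distrib_right mult_ac)
      also have "\<dots> = (\<Sum>l<q. (\<Sum>j<q. emb R (G i j) * emb R (G j l)) * emb R (u l))"
        unfolding sum_distrib_right by (rule sum.swap)
      finally show ?thesis using GG i \<phi>x by simp
    qed
    then have "f ?c i = f x i" if "i < q" for i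
      using that f[OF c] f[OF x] R.emb_inj unfolding \<phi>_def by (auto simp: free_module_simps PiE_iff)
    then have "f ?c = f x"
      using f[OF c] f[OF x] unfolding free_module_simps by (intro PiE_ext) auto
    then show "x = ?c" using bij c x unfolding bij_betw_def by (auto dest: inj_onD)
  qed
  moreover have "proj R (\<phi> i (w j)) = G i j" if "i < q" "j < q" for i j
    using \<phi>w[OF that] G[OF that] by simp
  ultimately show thesis by (rule that)
qed

text \<open>Let \<open>f\<close> identify \<open>M\<close> with a direct summand \<open>P\<close> of a free module, with complement \<open>N\<close>. The forms are
  the components of \<open>f\<close>, and \<open>w\<^sub>j\<close> corresponds to the \<open>P\<close>-part of the standard basis vector with
  index \<open>j\<close>. The difference of \<open>f x\<close> and the image of the expansion of \<open>x\<close> lies in \<open>P\<close>, and it is a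
  combination of the \<open>N\<close>-parts \<open>y\<^sub>j\<close>; so it is zero.\<close>
lemma fg_projective_imp_dual_basis:
  assumes "fg_projective R M"
  obtains q w \<phi> where "scalar.dual_basis q w \<phi>"
proof -
  obtain q P N where P: "submodule P R (free_module R q)" and N: "submodule N R (free_module R q)"
    and PN: "P \<inter> N = {\<zero>\<^bsub>free_module R q\<^esub>}"
    and sum: "P <+>\<^bsub>free_module R q\<^esub> N = carrier (free_module R q)"
    and iso: "module_iso R M ((free_module R q)\<lparr>carrier := P\<rparr>)"
    using assms unfolding fg_projective_def by blast
  let ?F = "free_module R q"
  interpret F: module R ?F by (rule R.free_module_is_module)
  note PE = F.submoduleE[OF P] and NE = F.submoduleE[OF N]
  have N0: "\<zero>\<^bsub>?F\<^esub> \<in> N" using PN by blast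
  obtain f where bij: "bij_betw f (carrier M) P"
    and add: "\<And>x y. x \<in> carrier M \<Longrightarrow> y \<in> carrier M \<Longrightarrow> f (x \<oplus>\<^bsub>M\<^esub> y) = f x \<oplus>\<^bsub>?F\<^esub> f y"
    and smult: "\<And>a x. a \<in> carrier R \<Longrightarrow> x \<in> carrier M \<Longrightarrow> f (a \<odot>\<^bsub>M\<^esub> x) = a \<odot>\<^bsub>?F\<^esub> f x"
    using iso unfolding module_iso_def by auto
  have fP: "f x \<in> P" if "x \<in> carrier M" for x using bij that by (rule bij_betw_apply)
  then have f: "f x \<in> carrier ?F" if "x \<in> carrier M" for x using that PE(1) by blast
  define \<phi> where "\<phi> = (\<lambda>i x. emb R (f x i))"
  have fn: "scalar.functional (\<phi> i)" if "i < q" for i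
    unfolding \<phi>_def using iso_functional[OF f add smult that] .
  have "\<exists>x y. x \<in> carrier M \<and> y \<in> N \<and> (\<lambda>i\<in>{..<q}. if i = j then \<one> else \<zero>) = f x \<oplus>\<^bsub>?F\<^esub> y" for j
  proof -
    have "(\<lambda>i\<in>{..<q}. if i = j then \<one> else \<zero>) \<in> P <+>\<^bsub>?F\<^esub> N"
      unfolding sum by (auto simp: free_module_simps)
    then obtain p y where "p \<in> P" "y \<in> N" "(\<lambda>i\<in>{..<q}. if i = j then \<one> else \<zero>) = p \<oplus>\<^bsub>?F\<^esub> y"
      unfolding set_add_def' by blast
    then show ?thesis using bij_betw_imp_surj_on[OF bij] by blast
  qed
  then obtain w y where wM: "\<And>j. w j \<in> carrier M" and y: "\<And>j. y j \<in> N"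
    and split: "\<And>j. (\<lambda>i\<in>{..<q}. if i = j then \<one> else \<zero>) = f (w j) \<oplus>\<^bsub>?F\<^esub> y j"
    by metis
  have w: "w \<in> {..<q} \<rightarrow> carrier M" using wM by auto
  have yF: "y j i \<in> carrier R" if "i < q" for i j
    using y NE(1) that by (force simp: free_module_simps)
  have fwR: "f (w j) i \<in> carrier R" if "i < q" for i j
    using f[OF wM] that by (force simp: free_module_simps)
  have delta: "\<phi> i (w j) + emb R (y j i) = (if i = j then emb R \<one> else 0)" if "i < q" for i j
  proof -
    have e: "f (w j) i \<oplus> y j i = (if i = j then \<one> else \<zero>)"
      using fun_cong[OF split[of j], of i, symmetric] that by (simp add: free_module_simps)
    have "\<phi> i (w j) + emb R (y j i) = emb R (f (w j) i \<oplus> y j i)"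
      unfolding \<phi>_def using fwR yF that by (simp add: R.emb_add)
    then show ?thesis unfolding e by simp
  qed
  have "scalar.dual_basis q w \<phi>"
    unfolding scalar.dual_basis_def
  proof (intro conjI ballI allI impI w fn)
    fix x assume x: "x \<in> carrier M"
    let ?c = "scalar.comb {..<q} (\<lambda>i. \<phi> i x) w"
    have c: "?c \<in> carrier M" using w by auto
    have fxi: "f x i \<in> carrier R" if "i < q" for i using f[OF x] that by (force simp: free_module_simps)
    have fci: "f ?c i \<in> carrier R" if "i < q" for i using f[OF c] that by (force simp: free_module_simps)
    have inN: "(\<lambda>i\<in>{..<q}. \<Oplus>j\<in>{..<m}. f x j \<otimes> y j i) \<in> N" if "m \<le> q" for m
      using that
    proof (induction m)
      case 0
      then show ?case using N0 by (simp add: free_module_simps restrict_def)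
    next
      case (Suc m)
      have "(\<lambda>i\<in>{..<q}. \<Oplus>j\<in>{..<Suc m}. f x j \<otimes> y j i)
          = (\<lambda>i\<in>{..<q}. \<Oplus>j\<in>{..<m}. f x j \<otimes> y j i) \<oplus>\<^bsub>?F\<^esub> (f x m \<odot>\<^bsub>?F\<^esub> y m)"
        unfolding free_module_simps
      proof (rule restrict_ext)
        fix i assume i: "i \<in> {..<q}"
        have "(\<Oplus>j\<in>{..<Suc m}. f x j \<otimes> y j i) = f x m \<otimes> y m i \<oplus> (\<Oplus>j\<in>{..<m}. f x j \<otimes> y j i)"
          unfolding lessThan_Suc by (rule R.finsum_insert) (use i Suc.prems fxi yF in auto)
        also have "\<dots> = (\<Oplus>j\<in>{..<m}. f x j \<otimes> y j i) \<oplus> f x m \<otimes> y m i"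
          by (rule R.a_comm) (use i Suc.prems fxi yF in \<open>auto intro!: R.finsum_closed\<close>)
        finally show "(\<Oplus>j\<in>{..<Suc m}. f x j \<otimes> y j i)
            = (\<lambda>i\<in>{..<q}. \<Oplus>j\<in>{..<m}. f x j \<otimes> y j i) i \<oplus> (\<lambda>i\<in>{..<q}. f x m \<otimes> y m i) i"
          using i by simp
      qed
      moreover have "(\<lambda>i\<in>{..<q}. \<Oplus>j\<in>{..<m}. f x j \<otimes> y j i) \<in> N"
        using Suc.prems by (intro Suc.IH) simp
      moreover have "f x m \<odot>\<^bsub>?F\<^esub> y m \<in> N"
        using Suc.prems by (intro NE(4) fxi y) simp
      ultimately show ?case by (simp only: NE(5))
    qed
    have key: "\<phi> i x = \<phi> i ?c + (\<Sum>j<q. \<phi> j x * emb R (y j i))" if i: "i < q" for i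
    proof -
      have "\<phi> i ?c + (\<Sum>j<q. \<phi> j x * emb R (y j i)) = (\<Sum>j<q. \<phi> j x * (\<phi> i (w j) + emb R (y j i)))"
        using scalar.functional_comb[OF fn[OF i] finite_lessThan w, of "\<lambda>j. \<phi> j x"]
        by (simp add: distrib_left sum.distrib)
      also have "\<dots> = (\<Sum>j<q. if j = i then \<phi> i x * emb R \<one> else 0)"
        by (rule sum.cong) (use delta[OF i] in auto)
      also have "\<dots> = \<phi> i x" using i fxi by (simp add: \<phi>_def R.emb_mult_emb[symmetric])
      finally show ?thesis ..
    qed
    let ?d = "f x \<oplus>\<^bsub>?F\<^esub> ((\<ominus> \<one>) \<odot>\<^bsub>?F\<^esub> f ?c)"
    have d: "?d i = (\<Oplus>j\<in>{..<q}. f x j \<otimes> y j i)" if i: "i < q" for i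
    proof -
      have cl: "(\<Oplus>j\<in>{..<q}. f x j \<otimes> y j i) \<in> carrier R" using fxi yF i by (auto intro!: R.finsum_closed)
      have "emb R (\<Oplus>j\<in>{..<q}. f x j \<otimes> y j i) = (\<Sum>j<q. emb R (f x j \<otimes> y j i))"
        by (rule R.emb_sum) (use fxi yF i in auto)
      also have "\<dots> = (\<Sum>j<q. \<phi> j x * emb R (y j i))"
        using fxi yF i by (simp add: \<phi>_def R.emb_mult_emb)
      finally have "emb R (f x i) = emb R (f ?c i) + emb R (\<Oplus>j\<in>{..<q}. f x j \<otimes> y j i)"
        using key[OF i] unfolding \<phi>_def by simp
      then have "f x i = f ?c i \<oplus> (\<Oplus>j\<in>{..<q}. f x j \<otimes> y j i)"
        using fxi[OF i] fci[OF i] cl by (metis R.emb_add R.emb_inj R.a_closed)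
      then have "f x i \<ominus> f ?c i = (\<Oplus>j\<in>{..<q}. f x j \<otimes> y j i)"
        using fci[OF i] cl by (metis R.add.inv_solve_right R.a_comm R.minus_eq R.a_closed)
      then show ?thesis using i fci[OF i] by (simp add: free_module_simps R.l_minus R.minus_eq)
    qed
    have "?d = (\<lambda>i\<in>{..<q}. \<Oplus>j\<in>{..<q}. f x j \<otimes> y j i)"
    proof
      fix i show "?d i = (\<lambda>i\<in>{..<q}. \<Oplus>j\<in>{..<q}. f x j \<otimes> y j i) i"
        using d[of i] by (cases "i < q") (auto simp: free_module_simps)
    qed
    then have "?d \<in> N" by (simp only: inN[OF order_refl])
    moreover have "?d \<in> P" using PE(4,5) fP[OF x] fP[OF c] by simp
    ultimately have d0: "?d = \<zero>\<^bsub>?F\<^esub>" using PN by blast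
    have "f x i = f ?c i" if i: "i < q" for i
    proof -
      have "f x i \<ominus> f ?c i = \<zero>"
        using fun_cong[OF d0, of i] i fci[OF i] by (simp add: free_module_simps R.l_minus R.minus_eq)
      then show ?thesis using fxi[OF i] fci[OF i] by (metis R.add.inv_closed R.add.inv_inv R.minus_eq R.minus_equality)
    qed
    then have "f x = f ?c"
      using f[OF c] f[OF x] unfolding free_module_simps by (intro PiE_ext) auto
    then show "x = ?c" using bij c x unfolding bij_betw_def by (auto dest: inj_onD)
  qed
  then show thesis by (rule that)
qed

text \<open>The embedding \<open>coords\<close> is split by the map \<open>\<pi>\<close> that sends a vector to the combination of the \<open>w\<^sub>j\<close>
  with these coefficients; the complement is the kernel of \<open>\<pi>\<close>.\<close>
lemma dual_basis_imp_fg_projective: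
  assumes db: "scalar.dual_basis q w \<phi>"
  shows "fg_projective R M"
proof -
  let ?F = "free_module R q"
  interpret F: module R ?F by (rule R.free_module_is_module)
  have w: "w \<in> {..<q} \<rightarrow> carrier M" and fn: "\<And>i. i < q \<Longrightarrow> scalar.functional (\<phi> i)"
    and rep: "\<And>x. x \<in> carrier M \<Longrightarrow> x = scalar.comb {..<q} (\<lambda>i. \<phi> i x) w"
    using db unfolding scalar.dual_basis_def by blast+
  have lin1: "coords q \<phi> (x \<oplus>\<^bsub>M\<^esub> y) = coords q \<phi> x \<oplus>\<^bsub>?F\<^esub> coords q \<phi> y"
    if "x \<in> carrier M" "y \<in> carrier M" for x y
    by (rule coords_linear(1)) (use fn that in auto)
  have lin2: "coords q \<phi> (a \<odot>\<^bsub>M\<^esub> x) = a \<odot>\<^bsub>?F\<^esub> coords q \<phi> x"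
    if "a \<in> carrier R" "x \<in> carrier M" for a x
    by (rule coords_linear(2)) (use fn that in auto)
  have lin3: "coords q \<phi> x \<in> carrier ?F" for x
    by (rule coords_linear(3)) (use fn in auto)
  define \<pi> where "\<pi> u = scalar.comb {..<q} (\<lambda>i. emb R (u i)) w" for u
  have \<pi>_closed: "\<pi> u \<in> carrier M" for u unfolding \<pi>_def using w by auto
  have FR: "u i \<in> carrier R" if "u \<in> carrier ?F" "i < q" for u i
    using that by (auto simp: free_module_simps)
  have \<pi>_add: "\<pi> (u \<oplus>\<^bsub>?F\<^esub> v) = \<pi> u \<oplus>\<^bsub>M\<^esub> \<pi> v" if "u \<in> carrier ?F" "v \<in> carrier ?F" for u v
  proof -
    have "\<pi> (u \<oplus>\<^bsub>?F\<^esub> v) = scalar.comb {..<q} (\<lambda>i. emb R (u i) + emb R (v i)) w"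
      unfolding \<pi>_def by (rule scalar.comb_cong) (use w that FR in \<open>auto simp: free_module_add R.emb_add\<close>)
    then show ?thesis unfolding \<pi>_def using scalar.comb_add[OF w] by simp
  qed
  have \<pi>_smult: "\<pi> (a \<odot>\<^bsub>?F\<^esub> u) = a \<odot>\<^bsub>M\<^esub> \<pi> u" if "a \<in> carrier R" "u \<in> carrier ?F" for a u
  proof -
    have "\<pi> (a \<odot>\<^bsub>?F\<^esub> u) = scalar.comb {..<q} (\<lambda>i. emb R a * emb R (u i)) w"
      unfolding \<pi>_def by (rule scalar.comb_cong) (use w that FR in \<open>auto simp: free_module_smult R.emb_mult_emb\<close>)
    then show ?thesis unfolding \<pi>_def using scalar.comb_scale[OF _ w] that by simp
  qed
  have \<pi>_coords: "\<pi> (coords q \<phi> x) = x" if x: "x \<in> carrier M" for x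
  proof -
    have "\<pi> (coords q \<phi> x) = scalar.comb {..<q} (\<lambda>i. \<phi> i x) w"
      unfolding \<pi>_def
      by (rule scalar.comb_cong) (use w functional_eq_emb[OF fn x] in \<open>auto simp: coords_def\<close>)
    then show ?thesis using rep[OF x, symmetric] by simp
  qed
  have neg: "\<ominus>\<^bsub>?F\<^esub> u = (\<ominus> \<one>) \<odot>\<^bsub>?F\<^esub> u" if "u \<in> carrier ?F" for u
    using F.smult_l_minus[of \<one> u] that by simp
  have zero: "coords q \<phi> \<zero>\<^bsub>M\<^esub> = \<zero>\<^bsub>?F\<^esub>"
    using lin2[of \<zero> "\<zero>\<^bsub>M\<^esub>"] lin3[of "\<zero>\<^bsub>M\<^esub>"] by simp
  have \<pi>0: "\<pi> \<zero>\<^bsub>?F\<^esub> = \<zero>\<^bsub>M\<^esub>" using \<pi>_coords[of "\<zero>\<^bsub>M\<^esub>"] zero by simp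
  define P where "P = coords q \<phi> ` carrier M"
  define N where "N = {u \<in> carrier ?F. \<pi> u = \<zero>\<^bsub>M\<^esub>}"
  have "submodule P R ?F"
  proof (rule F.submoduleI)
    show "P \<subseteq> carrier ?F" unfolding P_def using lin3 by blast
    show "\<zero>\<^bsub>?F\<^esub> \<in> P" unfolding P_def zero[symmetric] by blast
    show sm: "a \<odot>\<^bsub>?F\<^esub> u \<in> P" if "a \<in> carrier R" "u \<in> P" for a u
      using that lin2[symmetric] unfolding P_def by auto
    show "u \<oplus>\<^bsub>?F\<^esub> v \<in> P" if "u \<in> P" "v \<in> P" for u v
      using that lin1[symmetric] unfolding P_def by auto
    show "\<ominus>\<^bsub>?F\<^esub> u \<in> P" if "u \<in> P" for u
      using sm[OF _ that, of "\<ominus> \<one>"] neg \<open>P \<subseteq> carrier ?F\<close> that by auto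
  qed
  moreover have "submodule N R ?F"
  proof (rule F.submoduleI)
    show "N \<subseteq> carrier ?F" unfolding N_def by blast
    show "\<zero>\<^bsub>?F\<^esub> \<in> N" unfolding N_def using \<pi>0 by simp
    show sm: "a \<odot>\<^bsub>?F\<^esub> u \<in> N" if "a \<in> carrier R" "u \<in> N" for a u
      using that \<pi>_smult unfolding N_def by auto
    show "u \<oplus>\<^bsub>?F\<^esub> v \<in> N" if "u \<in> N" "v \<in> N" for u v
      using that \<pi>_add unfolding N_def by auto
    show "\<ominus>\<^bsub>?F\<^esub> u \<in> N" if "u \<in> N" for u
      using sm[OF _ that, of "\<ominus> \<one>"] neg \<open>N \<subseteq> carrier ?F\<close> that by auto
  qed
  moreover have "P \<inter> N = {\<zero>\<^bsub>?F\<^esub>}"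
    unfolding P_def N_def using \<pi>_coords zero \<pi>0 by (auto intro: rev_image_eqI[of "\<zero>\<^bsub>M\<^esub>"])
  moreover have "P <+>\<^bsub>?F\<^esub> N = carrier ?F"
  proof (intro equalityI subsetI)
    fix u assume "u \<in> P <+>\<^bsub>?F\<^esub> N"
    then show "u \<in> carrier ?F" unfolding set_add_def' P_def N_def using lin3 by auto
  next
    fix u assume u: "u \<in> carrier ?F"
    let ?p = "coords q \<phi> (\<pi> u)" and ?n = "u \<oplus>\<^bsub>?F\<^esub> (\<ominus> \<one>) \<odot>\<^bsub>?F\<^esub> coords q \<phi> (\<pi> u)"
    have p: "?p \<in> carrier ?F" by (rule lin3)
    have "\<pi> ?n = \<pi> u \<oplus>\<^bsub>M\<^esub> (\<ominus> \<one>) \<odot>\<^bsub>M\<^esub> \<pi> u"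
      using u p by (simp add: \<pi>_add \<pi>_smult \<pi>_coords \<pi>_closed)
    also have "\<dots> = \<zero>\<^bsub>M\<^esub>" using \<pi>_closed[of u] by (simp add: smult_l_minus M.r_neg)
    finally have "?n \<in> N" unfolding N_def using u p by simp
    moreover have "?p \<in> P" unfolding P_def using \<pi>_closed by blast
    moreover have "u = ?p \<oplus>\<^bsub>?F\<^esub> ?n"
      unfolding neg[OF p, symmetric] using u p
      by (metis F.M.a_comm F.M.a_inv_closed F.M.a_closed F.M.r_neg1)
    ultimately show "u \<in> P <+>\<^bsub>?F\<^esub> N" unfolding set_add_def' by blast
  qed
  moreover have "module_iso R M (?F\<lparr>carrier := P\<rparr>)"
    unfolding P_def by (rule module_iso_coords[OF db])
  ultimately show ?thesis unfolding fg_projective_def by blast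
qed

end

section \<open>Freeness after localization\<close>

lemma self_module_simps [simp]:
  "carrier (self_module R) = carrier R" "\<zero>\<^bsub>self_module R\<^esub> = \<zero>\<^bsub>R\<^esub>"
  "x \<oplus>\<^bsub>self_module R\<^esub> y = x \<oplus>\<^bsub>R\<^esub> y" "a \<odot>\<^bsub>self_module R\<^esub> x = a \<otimes>\<^bsub>R\<^esub> x"
  by (simp_all add: self_module_def)

lemma (in cring) self_module_is_module: "module R (self_module R)"
proof (rule moduleI)
  show "cring R" ..
  show "abelian_group (self_module R)"
  proof (rule abelian_groupI)
    fix x assume "x \<in> carrier (self_module R)"
    then show "\<exists>y\<in>carrier (self_module R). y \<oplus>\<^bsub>self_module R\<^esub> x = \<zero>\<^bsub>self_module R\<^esub>"
      by (intro bexI[of _ "\<ominus> x"]) (simp_all add: l_neg)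
  qed (auto simp: a_ac)
qed (auto simp: l_distr r_distr m_assoc)

text \<open>The localized ring has as underlying module the localization of \<open>R\<close>
  over itself, so its fractions obey the same rules.\<close>
locale localized_module = module R M for R (structure) and M (structure) +
  fixes S :: "'a set"
  assumes S_subset: "S \<subseteq> carrier R"
    and S_one [simp, intro]: "\<one>\<^bsub>R\<^esub> \<in> S"
    and S_mult [simp, intro]: "t \<in> S \<Longrightarrow> u \<in> S \<Longrightarrow> t \<otimes>\<^bsub>R\<^esub> u \<in> S"
begin

lemma S_carrier [simp, intro]: "t \<in> S \<Longrightarrow> t \<in> carrier R"
  using S_subset by blast

abbreviation frac :: "'c \<Rightarrow> 'a \<Rightarrow> ('c \<times> 'a) set" where
  "frac \<equiv> loc_frac R S M"

abbreviation rfrac :: "'a \<Rightarrow> 'a \<Rightarrow> ('a \<times> 'a) set" where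
  "rfrac \<equiv> loc_frac R S (self_module R)"

lemma smult_smult: "a \<in> carrier R \<Longrightarrow> b \<in> carrier R \<Longrightarrow> x \<in> carrier M
    \<Longrightarrow> a \<odot>\<^bsub>M\<^esub> (b \<odot>\<^bsub>M\<^esub> x) = (a \<otimes> b) \<odot>\<^bsub>M\<^esub> x"
  by (simp add: smult_assoc1)

lemma loc_rel_equiv: "equiv (carrier M \<times> S) (loc_rel R S M)"
proof (rule equivI)
  show "loc_rel R S M \<subseteq> (carrier M \<times> S) \<times> (carrier M \<times> S)" unfolding loc_rel_def by auto
  show "refl_on (carrier M \<times> S) (loc_rel R S M)" unfolding refl_on_def loc_rel_def by auto
  show "sym (loc_rel R S M)" unfolding sym_def loc_rel_def by force
  show "trans (loc_rel R S M)"
  proof (rule transI)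
    fix p q r assume "(p, q) \<in> loc_rel R S M" "(q, r) \<in> loc_rel R S M"
    then obtain x t y u z w v v' where p: "p = (x, t)" and q: "q = (y, u)" and r: "r = (z, w)"
      and M: "x \<in> carrier M" "y \<in> carrier M" "z \<in> carrier M"
      and S: "t \<in> S" "u \<in> S" "w \<in> S" "v \<in> S" "v' \<in> S"
      and 1: "(v \<otimes> u) \<odot>\<^bsub>M\<^esub> x = (v \<otimes> t) \<odot>\<^bsub>M\<^esub> y"
      and 2: "(v' \<otimes> w) \<odot>\<^bsub>M\<^esub> y = (v' \<otimes> u) \<odot>\<^bsub>M\<^esub> z"
      unfolding loc_rel_def by auto
    have "(v \<otimes> v' \<otimes> u \<otimes> w) \<odot>\<^bsub>M\<^esub> x = (v' \<otimes> w) \<odot>\<^bsub>M\<^esub> ((v \<otimes> u) \<odot>\<^bsub>M\<^esub> x)"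
      using M S by (simp add: smult_smult R.m_ac)
    also have "\<dots> = (v \<otimes> t) \<odot>\<^bsub>M\<^esub> ((v' \<otimes> w) \<odot>\<^bsub>M\<^esub> y)"
      unfolding 1 using M S by (simp add: smult_smult R.m_ac)
    also have "\<dots> = (v \<otimes> v' \<otimes> u \<otimes> t) \<odot>\<^bsub>M\<^esub> z"
      unfolding 2 using M S by (simp add: smult_smult R.m_ac)
    finally show "(p, r) \<in> loc_rel R S M"
      unfolding p r loc_rel_def using M S by blast
  qed
qed

lemma frac_eq_iff:
  assumes "x \<in> carrier M" "t \<in> S" "y \<in> carrier M" "u \<in> S"
  shows "frac x t = frac y u \<longleftrightarrow> (\<exists>v\<in>S. (v \<otimes> u) \<odot>\<^bsub>M\<^esub> x = (v \<otimes> t) \<odot>\<^bsub>M\<^esub> y)"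
proof -
  have "frac x t = frac y u \<longleftrightarrow> ((x, t), (y, u)) \<in> loc_rel R S M"
    unfolding loc_frac_def by (rule eq_equiv_class_iff[OF loc_rel_equiv]) (use assms in auto)
  then show ?thesis using assms unfolding loc_rel_def by auto
qed

lemma frac_eqI:
  assumes "x \<in> carrier M" "t \<in> S" "y \<in> carrier M" "u \<in> S" "v \<in> S"
    and "(v \<otimes> u) \<odot>\<^bsub>M\<^esub> x = (v \<otimes> t) \<odot>\<^bsub>M\<^esub> y"
  shows "frac x t = frac y u"
  using frac_eq_iff[OF assms(1-4)] assms(5,6) by blast

text \<open>The operations on classes are unions over representatives; such a union is computed by any
  representative once all members of the family are known to be equal.\<close>
lemma UN_frac:
  assumes "x \<in> carrier M" "t \<in> S"
    and "\<And>y u. y \<in> carrier M \<Longrightarrow> u \<in> S \<Longrightarrow> frac y u = frac x t \<Longrightarrow> f y u = c"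
  shows "(\<Union>(y, u)\<in>frac x t. f y u) = c"
proof (rule UN_constant_eq)
  show "(x, t) \<in> frac x t"
    unfolding loc_frac_def using equiv_class_self[OF loc_rel_equiv] assms(1,2) by blast
  show "\<forall>p\<in>frac x t. (case p of (y, u) \<Rightarrow> f y u) = c"
  proof
    fix p assume p: "p \<in> frac x t"
    then have rel: "((x, t), p) \<in> loc_rel R S M" unfolding loc_frac_def by simp
    obtain y u where yu: "p = (y, u)" by (cases p)
    have "frac y u = frac x t"
      using equiv_class_eq[OF loc_rel_equiv rel] unfolding loc_frac_def yu ..
    moreover have "y \<in> carrier M" "u \<in> S" using rel unfolding loc_rel_def yu by auto
    ultimately show "(case p of (y, u) \<Rightarrow> f y u) = c" using assms(3) yu by simp
  qed
qed

lemma loc_module_carrier: "X \<in> carrier (loc_module R S M) \<longleftrightarrow> (\<exists>x\<in>carrier M. \<exists>t\<in>S. X = frac x t)"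
  unfolding loc_module_def loc_frac_def quotient_def by auto

lemma loc_module_carrierE:
  assumes "X \<in> carrier (loc_module R S M)"
  obtains x t where "x \<in> carrier M" "t \<in> S" "X = frac x t"
  using assms unfolding loc_module_carrier by auto

lemma frac_closed [simp, intro]: "x \<in> carrier M \<Longrightarrow> t \<in> S \<Longrightarrow> frac x t \<in> carrier (loc_module R S M)"
  unfolding loc_module_carrier by blast

lemma frac_add:
  assumes x: "x \<in> carrier M" "t \<in> S" and y: "y \<in> carrier M" "u \<in> S"
  shows "frac x t \<oplus>\<^bsub>loc_module R S M\<^esub> frac y u = frac (u \<odot>\<^bsub>M\<^esub> x \<oplus>\<^bsub>M\<^esub> t \<odot>\<^bsub>M\<^esub> y) (t \<otimes> u)"
proof -
  have "(\<Union>(x', t')\<in>frac x t. \<Union>(y', u')\<in>frac y u.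
      frac (u' \<odot>\<^bsub>M\<^esub> x' \<oplus>\<^bsub>M\<^esub> t' \<odot>\<^bsub>M\<^esub> y') (t' \<otimes> u')) = frac (u \<odot>\<^bsub>M\<^esub> x \<oplus>\<^bsub>M\<^esub> t \<odot>\<^bsub>M\<^esub> y) (t \<otimes> u)"
  proof (rule UN_frac[OF x], rule UN_frac[OF y])
    fix x' t' y' u'
    assume x': "x' \<in> carrier M" "t' \<in> S" and y': "y' \<in> carrier M" "u' \<in> S"
      and eq: "frac x' t' = frac x t" "frac y' u' = frac y u"
    obtain v where v: "v \<in> S" "(v \<otimes> t) \<odot>\<^bsub>M\<^esub> x' = (v \<otimes> t') \<odot>\<^bsub>M\<^esub> x"
      using eq(1)[unfolded frac_eq_iff[OF x' x]] by blast
    obtain w where w: "w \<in> S" "(w \<otimes> u) \<odot>\<^bsub>M\<^esub> y' = (w \<otimes> u') \<odot>\<^bsub>M\<^esub> y"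
      using eq(2)[unfolded frac_eq_iff[OF y' y]] by blast
    note c = x x' y y' v(1) w(1)
    have "(v \<otimes> w \<otimes> (t \<otimes> u)) \<odot>\<^bsub>M\<^esub> (u' \<odot>\<^bsub>M\<^esub> x') = (w \<otimes> u \<otimes> u') \<odot>\<^bsub>M\<^esub> ((v \<otimes> t) \<odot>\<^bsub>M\<^esub> x')"
      using c by (simp add: smult_smult R.m_ac)
    also have "\<dots> = (v \<otimes> w \<otimes> (t' \<otimes> u')) \<odot>\<^bsub>M\<^esub> (u \<odot>\<^bsub>M\<^esub> x)"
      unfolding v(2) using c by (simp add: smult_smult R.m_ac)
    finally have 1: "(v \<otimes> w \<otimes> (t \<otimes> u)) \<odot>\<^bsub>M\<^esub> (u' \<odot>\<^bsub>M\<^esub> x')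
        = (v \<otimes> w \<otimes> (t' \<otimes> u')) \<odot>\<^bsub>M\<^esub> (u \<odot>\<^bsub>M\<^esub> x)" .
    have "(v \<otimes> w \<otimes> (t \<otimes> u)) \<odot>\<^bsub>M\<^esub> (t' \<odot>\<^bsub>M\<^esub> y') = (v \<otimes> t \<otimes> t') \<odot>\<^bsub>M\<^esub> ((w \<otimes> u) \<odot>\<^bsub>M\<^esub> y')"
      using c by (simp add: smult_smult R.m_ac)
    also have "\<dots> = (v \<otimes> w \<otimes> (t' \<otimes> u')) \<odot>\<^bsub>M\<^esub> (t \<odot>\<^bsub>M\<^esub> y)"
      unfolding w(2) using c by (simp add: smult_smult R.m_ac)
    finally have 2: "(v \<otimes> w \<otimes> (t \<otimes> u)) \<odot>\<^bsub>M\<^esub> (t' \<odot>\<^bsub>M\<^esub> y')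
        = (v \<otimes> w \<otimes> (t' \<otimes> u')) \<odot>\<^bsub>M\<^esub> (t \<odot>\<^bsub>M\<^esub> y)" .
    show "frac (u' \<odot>\<^bsub>M\<^esub> x' \<oplus>\<^bsub>M\<^esub> t' \<odot>\<^bsub>M\<^esub> y') (t' \<otimes> u') = frac (u \<odot>\<^bsub>M\<^esub> x \<oplus>\<^bsub>M\<^esub> t \<odot>\<^bsub>M\<^esub> y) (t \<otimes> u)"
      by (rule frac_eqI[of _ _ _ _ "v \<otimes> w"]) (use c 1 2 in \<open>simp_all add: smult_r_distr\<close>)
  qed
  then show ?thesis unfolding loc_module_def by simp
qed

lemma self_localized: "localized_module R (self_module R) S"
  by (intro localized_module.intro localized_module_axioms.intro R.self_module_is_module)
    (auto simp: S_subset)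

lemmas rfrac_eq_iff = localized_module.frac_eq_iff[OF self_localized, simplified]
lemmas rfrac_eqI = localized_module.frac_eqI[OF self_localized, simplified]
lemmas UN_rfrac = localized_module.UN_frac[OF self_localized, simplified]

lemma frac_smult:
  assumes a: "a \<in> carrier R" "t \<in> S" and x: "x \<in> carrier M" "u \<in> S"
  shows "rfrac a t \<odot>\<^bsub>loc_module R S M\<^esub> frac x u = frac (a \<odot>\<^bsub>M\<^esub> x) (t \<otimes> u)"
proof -
  have "(\<Union>(a', t')\<in>rfrac a t. \<Union>(x', u')\<in>frac x u.
      frac (a' \<odot>\<^bsub>M\<^esub> x') (t' \<otimes> u')) = frac (a \<odot>\<^bsub>M\<^esub> x) (t \<otimes> u)"
  proof (rule UN_rfrac[OF a], rule UN_frac[OF x])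
    fix a' t' x' u'
    assume a': "a' \<in> carrier R" "t' \<in> S" and x': "x' \<in> carrier M" "u' \<in> S"
      and eq: "rfrac a' t' = rfrac a t" "frac x' u' = frac x u"
    obtain v where v: "v \<in> S" "(v \<otimes> t) \<otimes> a' = (v \<otimes> t') \<otimes> a"
      using eq(1)[unfolded rfrac_eq_iff[OF a' a]] by blast
    obtain w where w: "w \<in> S" "(w \<otimes> u) \<odot>\<^bsub>M\<^esub> x' = (w \<otimes> u') \<odot>\<^bsub>M\<^esub> x"
      using eq(2)[unfolded frac_eq_iff[OF x' x]] by blast
    note c = a a' x x' v(1) w(1)
    have "(v \<otimes> w \<otimes> (t \<otimes> u)) \<odot>\<^bsub>M\<^esub> (a' \<odot>\<^bsub>M\<^esub> x')
        = (v \<otimes> t \<otimes> a') \<odot>\<^bsub>M\<^esub> ((w \<otimes> u) \<odot>\<^bsub>M\<^esub> x')"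
      using c by (simp add: smult_smult R.m_ac)
    also have "\<dots> = (v \<otimes> w \<otimes> (t' \<otimes> u')) \<odot>\<^bsub>M\<^esub> (a \<odot>\<^bsub>M\<^esub> x)"
      unfolding v(2) w(2) using c by (simp add: smult_smult R.m_ac)
    finally show "frac (a' \<odot>\<^bsub>M\<^esub> x') (t' \<otimes> u') = frac (a \<odot>\<^bsub>M\<^esub> x) (t \<otimes> u)"
      by (intro frac_eqI[of _ _ _ _ "v \<otimes> w"]) (use c in simp_all)
  qed
  then show ?thesis unfolding loc_module_def by simp
qed

lemma loc_ring_carrier: "X \<in> carrier (loc_ring R S) \<longleftrightarrow> (\<exists>x\<in>carrier R. \<exists>t\<in>S. X = rfrac x t)"
  using localized_module.loc_module_carrier[OF self_localized] by (simp add: loc_ring_def)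

lemma loc_ring_carrierE:
  assumes "X \<in> carrier (loc_ring R S)"
  obtains x t where "x \<in> carrier R" "t \<in> S" "X = rfrac x t"
  using assms unfolding loc_ring_carrier by auto

lemma rfrac_closed [simp, intro]: "x \<in> carrier R \<Longrightarrow> t \<in> S \<Longrightarrow> rfrac x t \<in> carrier (loc_ring R S)"
  unfolding loc_ring_carrier by blast

lemma loc_ring_zero: "\<zero>\<^bsub>loc_ring R S\<^esub> = rfrac \<zero> \<one>"
  and loc_ring_one: "\<one>\<^bsub>loc_ring R S\<^esub> = rfrac \<one> \<one>"
  by (simp_all add: loc_ring_def loc_module_def)

lemma rfrac_add:
  assumes "x \<in> carrier R" "t \<in> S" "y \<in> carrier R" "u \<in> S"
  shows "rfrac x t \<oplus>\<^bsub>loc_ring R S\<^esub> rfrac y u = rfrac (u \<otimes> x \<oplus> t \<otimes> y) (t \<otimes> u)"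
  using localized_module.frac_add[OF self_localized] assms by (simp add: loc_ring_def)

lemma rfrac_mult:
  assumes "x \<in> carrier R" "t \<in> S" "y \<in> carrier R" "u \<in> S"
  shows "rfrac x t \<otimes>\<^bsub>loc_ring R S\<^esub> rfrac y u = rfrac (x \<otimes> y) (t \<otimes> u)"
  using localized_module.frac_smult[OF self_localized] assms by (simp add: loc_ring_def loc_module_def)

lemma frac_expand:
  assumes "x \<in> carrier M" "t \<in> S" "u \<in> S"
  shows "frac x t = frac (u \<odot>\<^bsub>M\<^esub> x) (t \<otimes> u)"
  by (rule frac_eqI[of _ _ _ _ "\<one>"]) (use assms in \<open>simp_all add: smult_smult\<close>)

lemma common_denominator:
  fixes k :: nat
  assumes "\<And>l. l < k \<Longrightarrow> X l \<in> carrier (loc_module R S M)"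
  shows "\<exists>t\<in>S. \<exists>x. \<forall>l<k. x l \<in> carrier M \<and> X l = frac (x l) t"
  using assms
proof (induction k)
  case 0
  then show ?case using S_one by blast
next
  case (Suc k)
  obtain t x where t: "t \<in> S" and x: "\<And>l. l < k \<Longrightarrow> x l \<in> carrier M \<and> X l = frac (x l) t"
    using Suc by auto
  obtain y u where y: "y \<in> carrier M" "u \<in> S" "X k = frac y u"
    using Suc.prems[of k] loc_module_carrier by auto
  let ?x = "\<lambda>l. if l < k then u \<odot>\<^bsub>M\<^esub> x l else t \<odot>\<^bsub>M\<^esub> y"
  have "?x l \<in> carrier M \<and> X l = frac (?x l) (t \<otimes> u)" if l: "l < Suc k" for l
  proof (cases "l < k")
    case True
    then show ?thesis using x[OF True] t y frac_expand[of "x l" t u] by simp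
  next
    case False
    then have "l = k" using l by simp
    then show ?thesis using t y frac_expand[of y u t] by (simp add: R.m_comm)
  qed
  then have "\<forall>l<Suc k. ?x l \<in> carrier M \<and> X l = frac (?x l) (t \<otimes> u)" by blast
  then show ?case
    using t y(2) by (intro bexI[of _ "t \<otimes> u"] exI[of _ ?x]) auto
qed

lemma rcommon_denominator:
  fixes k :: nat
  assumes "\<And>l. l < k \<Longrightarrow> X l \<in> carrier (loc_ring R S)"
  shows "\<exists>t\<in>S. \<exists>x. \<forall>l<k. x l \<in> carrier R \<and> X l = rfrac (x l) t"
  using localized_module.common_denominator[OF self_localized, of k X] assms by (simp add: loc_ring_def)

lemma common_multiple:
  fixes k :: nat
  assumes "\<And>l. l < k \<Longrightarrow> \<exists>v\<in>S. P l v"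
    and "\<And>l v w. l < k \<Longrightarrow> v \<in> S \<Longrightarrow> w \<in> S \<Longrightarrow> P l v \<Longrightarrow> P l (w \<otimes> v)"
  shows "\<exists>v\<in>S. \<forall>l<k. P l v"
  using assms
proof (induction k)
  case 0
  then show ?case using S_one by blast
next
  case (Suc k)
  obtain v where v: "v \<in> S" "\<And>l. l < k \<Longrightarrow> P l v" using Suc.IH Suc.prems less_Suc_eq by metis
  obtain w where w: "w \<in> S" "P k w" using Suc.prems(1)[of k] by auto
  have "P l (w \<otimes> v)" if "l < Suc k" for l
  proof (cases "l = k")
    case True
    then show ?thesis using Suc.prems(2)[of k w v] v w by (simp add: R.m_comm)
  next
    case False
    then show ?thesis using Suc.prems(2)[of l v w] v w that by simp
  qed
  then show ?case using v(1) w(1) by blast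
qed

text \<open>Take preimages \<open>e\<^sub>l / t\<close> of the standard basis vectors, with a common denominator. Then \<open>e\<^sub>l / 1\<close> is
  sent to \<open>t\<close> times a standard basis vector, and generation and independence of the \<open>e\<^sub>l\<close> up to \<open>S\<close> are
  read off from the coordinates of \<open>x / 1\<close> and \<open>0 / 1\<close>.\<close>
lemma free_of_rank_localization:
  assumes "free_of_rank (loc_ring R S) (loc_module R S M) k"
  obtains e where "e \<in> {..<k} \<rightarrow> carrier M"
    and "\<And>x. x \<in> carrier M \<Longrightarrow> \<exists>v\<in>S. \<exists>c. v \<odot>\<^bsub>M\<^esub> x = scalar.comb {..<k} c e"
    and "\<And>a. scalar.comb {..<k} a e = \<zero>\<^bsub>M\<^esub> \<Longrightarrow> \<exists>v\<in>S. \<forall>l<k. v \<otimes> proj R (a l) = \<zero>"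
proof -
  let ?L = "loc_ring R S" and ?N = "loc_module R S M" and ?F = "free_module (loc_ring R S) k"
  obtain f where bij: "bij_betw f (carrier ?N) (carrier ?F)"
    and add: "\<And>x y. x \<in> carrier ?N \<Longrightarrow> y \<in> carrier ?N \<Longrightarrow> f (x \<oplus>\<^bsub>?N\<^esub> y) = f x \<oplus>\<^bsub>?F\<^esub> f y"
    and smult: "\<And>a x. a \<in> carrier ?L \<Longrightarrow> x \<in> carrier ?N \<Longrightarrow> f (a \<odot>\<^bsub>?N\<^esub> x) = a \<odot>\<^bsub>?F\<^esub> f x"
    using assms unfolding free_of_rank_def module_iso_def by blast
  define \<delta> where "\<delta> = (\<lambda>l. \<lambda>i\<in>{..<k}. if i = l then \<one>\<^bsub>?L\<^esub> else \<zero>\<^bsub>?L\<^esub>)"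
  have "\<delta> l \<in> carrier ?F" for l
    by (auto simp: \<delta>_def free_module_simps loc_ring_zero loc_ring_one)
  then have "\<forall>l. \<exists>X. X \<in> carrier ?N \<and> f X = \<delta> l"
    using bij_betw_imp_surj_on[OF bij] by (metis imageE)
  then obtain X where X: "\<And>l. X l \<in> carrier ?N" "\<And>l. f (X l) = \<delta> l" by metis
  obtain t e where t: "t \<in> S" and et: "\<And>l. l < k \<Longrightarrow> e l \<in> carrier M \<and> X l = frac (e l) t"
    using common_denominator[of k X] X(1) by blast
  have eM: "\<And>l. l < k \<Longrightarrow> e l \<in> carrier M" using et by blast
  have e: "e \<in> {..<k} \<rightarrow> carrier M" using eM by auto
  have fe: "f (frac (e l) \<one>) = (\<lambda>i\<in>{..<k}. if i = l then rfrac t \<one> else rfrac \<zero> \<one>)" if l: "l < k" for l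
  proof -
    have "frac (e l) \<one> = rfrac t \<one> \<odot>\<^bsub>?N\<^esub> X l"
      using et[OF l] t frac_smult[of t "\<one>" "e l" t] frac_expand[of "e l" "\<one>" t] by simp
    then have "f (frac (e l) \<one>) = rfrac t \<one> \<odot>\<^bsub>?F\<^esub> \<delta> l"
      using smult[of "rfrac t \<one>" "X l"] X t by simp
    also have "\<dots> = (\<lambda>i\<in>{..<k}. if i = l then rfrac t \<one> else rfrac \<zero> \<one>)"
      unfolding free_module_simps \<delta>_def
      by (rule restrict_ext) (use t in \<open>simp add: loc_ring_zero loc_ring_one rfrac_mult\<close>)
    finally show ?thesis .
  qed
  have f_comb: "f (frac (scalar.comb {..<m} c e) \<one>)
      = (\<lambda>i\<in>{..<k}. if i < m then rfrac (proj R (c i) \<otimes> t) \<one> else rfrac \<zero> \<one>)"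
    if "m \<le> k" for m c
    using that
  proof (induction m)
    case 0
    have "frac \<zero>\<^bsub>M\<^esub> \<one> = rfrac \<zero> \<one> \<odot>\<^bsub>?N\<^esub> frac \<zero>\<^bsub>M\<^esub> \<one>"
      by (subst frac_smult) auto
    then have "f (frac \<zero>\<^bsub>M\<^esub> \<one>) = rfrac \<zero> \<one> \<odot>\<^bsub>?F\<^esub> f (frac \<zero>\<^bsub>M\<^esub> \<one>)"
      using smult[of "rfrac \<zero> \<one>" "frac \<zero>\<^bsub>M\<^esub> \<one>"] by (metis M.zero_closed R.zero_closed S_one frac_closed rfrac_closed)
    also have "\<dots> = (\<lambda>i\<in>{..<k}. rfrac \<zero> \<one>)"
      unfolding free_module_simps
    proof (rule restrict_ext)
      fix i assume "i \<in> {..<k}"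
      then have "f (frac \<zero>\<^bsub>M\<^esub> \<one>) i \<in> carrier ?L"
        using bij_betw_apply[OF bij, of "frac \<zero>\<^bsub>M\<^esub> \<one>"] by (auto simp: free_module_simps)
      then obtain b u where b: "b \<in> carrier R" "u \<in> S" "f (frac \<zero>\<^bsub>M\<^esub> \<one>) i = rfrac b u"
        unfolding loc_ring_carrier by blast
      show "rfrac \<zero> \<one> \<otimes>\<^bsub>?L\<^esub> f (frac \<zero>\<^bsub>M\<^esub> \<one>) i = rfrac \<zero> \<one>"
        unfolding b(3) using b(1,2) by (simp add: rfrac_mult) (rule rfrac_eqI[of _ _ _ _ "\<one>"], auto)
    qed
    finally show ?case by (simp add: scalar.comb_def)
  next
    case (Suc m)
    have em: "e m \<in> carrier M" and eI: "e \<in> {..<m} \<rightarrow> carrier M" using eM Suc.prems by auto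
    let ?c = "proj R (c m)" and ?y = "scalar.comb {..<m} c e"
    have y: "?y \<in> carrier M" using eI by (rule scalar.comb_closed)
    have comb_Suc: "scalar.comb {..<Suc m} c e = ?c \<odot>\<^bsub>M\<^esub> e m \<oplus>\<^bsub>M\<^esub> ?y"
      unfolding scalar.comb_def lessThan_Suc by (rule M.finsum_insert) (use em eI in auto)
    have "frac (?c \<odot>\<^bsub>M\<^esub> e m \<oplus>\<^bsub>M\<^esub> ?y) \<one>
        = (rfrac ?c \<one> \<odot>\<^bsub>?N\<^esub> frac (e m) \<one>) \<oplus>\<^bsub>?N\<^esub> frac ?y \<one>"
      using em y by (simp add: frac_smult frac_add)
    moreover have "rfrac ?c \<one> \<odot>\<^bsub>?N\<^esub> frac (e m) \<one> \<in> carrier ?N"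
      using em by (simp add: frac_smult)
    ultimately have "f (frac (scalar.comb {..<Suc m} c e) \<one>)
        = (rfrac ?c \<one> \<odot>\<^bsub>?F\<^esub> f (frac (e m) \<one>)) \<oplus>\<^bsub>?F\<^esub> f (frac ?y \<one>)"
      unfolding comb_Suc using em y add smult by simp
    also have "\<dots> = (\<lambda>i\<in>{..<k}. if i < Suc m then rfrac (proj R (c i) \<otimes> t) \<one> else rfrac \<zero> \<one>)"
      unfolding free_module_simps Suc.IH[OF Suc_leD[OF Suc.prems]] fe[OF Suc_le_lessD[OF Suc.prems]]
    proof (rule restrict_ext)
      fix i assume i: "i \<in> {..<k}"
      consider "i < m" | "i = m" | "i > m" by linarith
      then show "(\<lambda>i\<in>{..<k}. rfrac ?c \<one> \<otimes>\<^bsub>?L\<^esub> (\<lambda>i\<in>{..<k}. if i = m then rfrac t \<one> else rfrac \<zero> \<one>) i) i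
          \<oplus>\<^bsub>?L\<^esub> (\<lambda>i\<in>{..<k}. if i < m then rfrac (proj R (c i) \<otimes> t) \<one> else rfrac \<zero> \<one>) i
          = (if i < Suc m then rfrac (proj R (c i) \<otimes> t) \<one> else rfrac \<zero> \<one>)"
        by cases (use i t in \<open>simp_all add: rfrac_mult rfrac_add\<close>)
    qed
    finally show ?case .
  qed
  show thesis
  proof (rule that[OF e])
    fix x assume x: "x \<in> carrier M"
    have "f (frac x \<one>) \<in> carrier ?F" using bij_betw_apply[OF bij] x by blast
    then have fx: "f (frac x \<one>) \<in> {..<k} \<rightarrow>\<^sub>E carrier ?L" by (simp add: free_module_simps)
    then have "\<And>l. l < k \<Longrightarrow> f (frac x \<one>) l \<in> carrier ?L" by auto
    then obtain u b where u: "u \<in> S" and b: "\<And>l. l < k \<Longrightarrow> b l \<in> carrier R \<and> f (frac x \<one>) l = rfrac (b l) u"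
      using rcommon_denominator[of k "f (frac x \<one>)"] by blast
    let ?y = "scalar.comb {..<k} (\<lambda>l. emb R (b l)) e"
    have y: "?y \<in> carrier M" using e by auto
    have "f (frac ?y \<one>) = rfrac (u \<otimes> t) \<one> \<odot>\<^bsub>?F\<^esub> f (frac x \<one>)"
      unfolding f_comb[OF order_refl] free_module_simps
    proof (rule restrict_ext)
      fix i assume "i \<in> {..<k}"
      then have i: "i < k" by simp
      have "rfrac (b i \<otimes> t) \<one> = rfrac (u \<otimes> t \<otimes> b i) (\<one> \<otimes> u)"
        by (rule rfrac_eqI[of _ _ _ _ "\<one>"]) (use b[OF i] u t in \<open>auto simp: R.m_ac\<close>)
      then show "(if i < k then rfrac (proj R (emb R (b i)) \<otimes> t) \<one> else rfrac \<zero> \<one>)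
          = rfrac (u \<otimes> t) \<one> \<otimes>\<^bsub>?L\<^esub> f (frac x \<one>) i"
        using b[OF i] u t i by (simp add: rfrac_mult)
    qed
    also have "\<dots> = f (rfrac (u \<otimes> t) \<one> \<odot>\<^bsub>?N\<^esub> frac x \<one>)"
      by (rule smult[symmetric]) (use u t x in auto)
    also have "rfrac (u \<otimes> t) \<one> \<odot>\<^bsub>?N\<^esub> frac x \<one> = frac ((u \<otimes> t) \<odot>\<^bsub>M\<^esub> x) \<one>"
      using u t x by (simp add: frac_smult)
    finally have "frac ?y \<one> = frac ((u \<otimes> t) \<odot>\<^bsub>M\<^esub> x) \<one>"
      by (rule inj_onD[OF bij_betw_imp_inj_on[OF bij]]) (use y u t x in auto)
    then obtain v where v: "v \<in> S" "(v \<otimes> \<one>) \<odot>\<^bsub>M\<^esub> ?y = (v \<otimes> \<one>) \<odot>\<^bsub>M\<^esub> ((u \<otimes> t) \<odot>\<^bsub>M\<^esub> x)"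
      using frac_eq_iff[OF y S_one _ S_one] u t x by auto
    have "(v \<otimes> (u \<otimes> t)) \<odot>\<^bsub>M\<^esub> x = v \<odot>\<^bsub>M\<^esub> ?y"
      using v u t x y by (simp add: smult_smult)
    also have "\<dots> = scalar.comb {..<k} (\<lambda>l. emb R v * emb R (b l)) e"
      using scalar.comb_scale[OF _ e, of "emb R v"] v(1) by simp
    finally show "\<exists>v\<in>S. \<exists>c. v \<odot>\<^bsub>M\<^esub> x = scalar.comb {..<k} c e"
      using v(1) u t by blast
  next
    fix a assume a: "scalar.comb {..<k} a e = \<zero>\<^bsub>M\<^esub>"
    show "\<exists>v\<in>S. \<forall>l<k. v \<otimes> proj R (a l) = \<zero>"
    proof (rule common_multiple)
      fix l assume l: "l < k"
      have "f (frac (scalar.comb {..<0} a e) \<one>) = f (frac (scalar.comb {..<k} a e) \<one>)"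
        unfolding a by (simp add: scalar.comb_def)
      then have "rfrac (proj R (a l) \<otimes> t) \<one> = rfrac \<zero> \<one>"
        unfolding f_comb[OF le0] f_comb[OF order_refl] using l by (auto dest: fun_cong[of _ _ l])
      then obtain v where v: "v \<in> S" "v \<otimes> (proj R (a l) \<otimes> t) = \<zero>"
        using rfrac_eq_iff[of "proj R (a l) \<otimes> t" "\<one>" "\<zero>" "\<one>"] t by auto
      then have "v \<otimes> t \<otimes> proj R (a l) = \<zero>" using t by (simp add: R.m_ac)
      then show "\<exists>v\<in>S. v \<otimes> proj R (a l) = \<zero>" using v(1) t by blast
    qed (simp add: R.m_assoc)
  qed
qed

text \<open>The isomorphism sends \<open>x / u\<close> to the vector with entries \<open>\<psi>\<^sub>l(x) / (t u)\<close>.\<close>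
lemma local_basis_free_of_rank:
  assumes t: "t \<in> S" and lb: "scalar.local_basis (emb R t) {..<k} e \<psi>"
  shows "free_of_rank (loc_ring R S) (loc_module R S M) k"
proof -
  let ?L = "loc_ring R S" and ?N = "loc_module R S M" and ?F = "free_module (loc_ring R S) k"
  have e: "e \<in> {..<k} \<rightarrow> carrier M" and fn: "\<And>l. l < k \<Longrightarrow> scalar.functional (\<psi> l)"
    and rep: "\<And>x. x \<in> carrier M \<Longrightarrow> scalar.comb {..<k} (\<lambda>l. \<psi> l x) e = t \<odot>\<^bsub>M\<^esub> x"
    and delta: "\<And>l m. l < k \<Longrightarrow> m < k \<Longrightarrow> \<psi> l (e m) = (if l = m then emb R t else 0)"
    using lb t unfolding scalar.local_basis_def by auto
  define p where "p = (\<lambda>l x. proj R (\<psi> l x))"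
  have pR [simp]: "p l x \<in> carrier R" for l x unfolding p_def by simp
  have p_add: "p l (x \<oplus>\<^bsub>M\<^esub> y) = p l x \<oplus> p l y" if "l < k" "x \<in> carrier M" "y \<in> carrier M" for l x y
    unfolding p_def scalar.functionalD(1)[OF fn[OF that(1)] that(2,3)] by (rule R.proj.h_add)
  have p_smult: "p l (a \<odot>\<^bsub>M\<^esub> x) = a \<otimes> p l x" if "l < k" "a \<in> carrier R" "x \<in> carrier M" for l a x
    using scalar.functionalD(2)[OF fn[OF that(1)] that(3), of "emb R a"] that(2)
    unfolding p_def by (simp add: R.proj.h_mult)
  define f where "f = (\<lambda>X. \<lambda>l\<in>{..<k}. \<Union>(x, u)\<in>X. rfrac (p l x) (t \<otimes> u))"
  have f_frac: "f (frac x u) = (\<lambda>l\<in>{..<k}. rfrac (p l x) (t \<otimes> u))" if x: "x \<in> carrier M" "u \<in> S" for x u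
    unfolding f_def
  proof (rule restrict_ext, rule UN_frac[OF x])
    fix l y w assume l: "l \<in> {..<k}" and y: "y \<in> carrier M" "w \<in> S" and eq: "frac y w = frac x u"
    obtain v where v: "v \<in> S" "(v \<otimes> u) \<odot>\<^bsub>M\<^esub> y = (v \<otimes> w) \<odot>\<^bsub>M\<^esub> x"
      using eq[unfolded frac_eq_iff[OF y x]] by blast
    have "(v \<otimes> u) \<otimes> p l y = (v \<otimes> w) \<otimes> p l x"
      using p_smult[of l "v \<otimes> u" y] p_smult[of l "v \<otimes> w" x] v x y l by simp
    then have "t \<otimes> ((v \<otimes> u) \<otimes> p l y) = t \<otimes> ((v \<otimes> w) \<otimes> p l x)" by simp
    then show "rfrac (p l y) (t \<otimes> w) = rfrac (p l x) (t \<otimes> u)"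
      by (intro rfrac_eqI[of _ _ _ _ v]) (use v(1) x y t in \<open>simp_all add: R.m_ac\<close>)
  qed
  have f_closed: "f X \<in> carrier ?F" if X_closed: "X \<in> carrier ?N" for X
  proof -
    obtain x u where x: "x \<in> carrier M" "u \<in> S" and X: "X = frac x u"
      by (rule loc_module_carrierE[OF X_closed])
    show ?thesis
      unfolding X f_frac[OF x] free_module_carrier restrict_PiE_iff
      by (intro ballI rfrac_closed pR S_mult t x)
  qed
  have inj: "inj_on f (carrier ?N)"
  proof (rule inj_onI)
    fix X Y assume XY: "X \<in> carrier ?N" "Y \<in> carrier ?N" and eq: "f X = f Y"
    obtain x u where x: "x \<in> carrier M" "u \<in> S" and X: "X = frac x u"
      using XY(1) by (rule loc_module_carrierE)
    obtain y w where y: "y \<in> carrier M" "w \<in> S" and Y: "Y = frac y w"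
      using XY(2) by (rule loc_module_carrierE)
    have "\<exists>v\<in>S. \<forall>l<k. (v \<otimes> (t \<otimes> w)) \<otimes> p l x = (v \<otimes> (t \<otimes> u)) \<otimes> p l y"
    proof (rule common_multiple)
      fix l assume l: "l < k"
      have *: "rfrac (p l x) (t \<otimes> u) = rfrac (p l y) (t \<otimes> w)"
        using fun_cong[OF eq, of l] l unfolding X Y f_frac[OF x] f_frac[OF y] by simp
      then show "\<exists>v\<in>S. (v \<otimes> (t \<otimes> w)) \<otimes> p l x = (v \<otimes> (t \<otimes> u)) \<otimes> p l y"
        by (subst (asm) rfrac_eq_iff) (use x y t in auto)
    next
      fix l v v' assume v: "v \<in> S" "v' \<in> S"
        and *: "(v \<otimes> (t \<otimes> w)) \<otimes> p l x = (v \<otimes> (t \<otimes> u)) \<otimes> p l y"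
      have "v' \<otimes> ((v \<otimes> (t \<otimes> w)) \<otimes> p l x) = v' \<otimes> ((v \<otimes> (t \<otimes> u)) \<otimes> p l y)"
        unfolding * ..
      then show "(v' \<otimes> v \<otimes> (t \<otimes> w)) \<otimes> p l x = (v' \<otimes> v \<otimes> (t \<otimes> u)) \<otimes> p l y"
        using v x y t by (simp add: R.m_assoc)
    qed
    then obtain v where v: "v \<in> S"
      and vp: "\<And>l. l < k \<Longrightarrow> (v \<otimes> (t \<otimes> w)) \<otimes> p l x = (v \<otimes> (t \<otimes> u)) \<otimes> p l y"
      by blast
    let ?a = "v \<otimes> (t \<otimes> w)" and ?b = "v \<otimes> (t \<otimes> u)"
    have ab: "?a \<in> carrier R" "?b \<in> carrier R" using v t x y by auto
    have "emb R ?a * \<psi> l x = emb R ?b * \<psi> l y" if "l < k" for l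
      using vp[OF that] ab unfolding p_def by (simp add: R.emb_mult)
    then have "scalar.comb {..<k} (\<lambda>l. emb R ?a * \<psi> l x) e = scalar.comb {..<k} (\<lambda>l. emb R ?b * \<psi> l y) e"
      by (intro scalar.comb_cong) (use e in auto)
    then have "?a \<odot>\<^bsub>M\<^esub> (t \<odot>\<^bsub>M\<^esub> x) = ?b \<odot>\<^bsub>M\<^esub> (t \<odot>\<^bsub>M\<^esub> y)"
      unfolding scalar.comb_scale[OF finite_lessThan e] rep[OF x(1)] rep[OF y(1)] using ab by simp
    then have "(v \<otimes> t \<otimes> t \<otimes> w) \<odot>\<^bsub>M\<^esub> x = (v \<otimes> t \<otimes> t \<otimes> u) \<odot>\<^bsub>M\<^esub> y"
      using v t x y by (simp add: smult_smult R.m_ac)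
    then show "X = Y"
      unfolding X Y by (intro frac_eqI[of _ _ _ _ "v \<otimes> t \<otimes> t"]) (use v t x y in auto)
  qed
  have surj: "carrier ?F \<subseteq> f ` carrier ?N"
  proof
    fix U assume U: "U \<in> carrier ?F"
    then have "U \<in> {..<k} \<rightarrow>\<^sub>E carrier ?L" by (simp add: free_module_simps)
    then obtain u b where u: "u \<in> S" and b: "\<And>l. l < k \<Longrightarrow> b l \<in> carrier R \<and> U l = rfrac (b l) u"
      using rcommon_denominator[of k U] by auto
    let ?x = "scalar.comb {..<k} (\<lambda>l. emb R (b l)) e"
    have x: "?x \<in> carrier M" using e by auto
    have px: "p l ?x = b l \<otimes> t" if l: "l < k" for l
    proof -
      have "\<psi> l ?x = (\<Sum>j<k. emb R (b j) * \<psi> l (e j))"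
        by (rule scalar.functional_comb[OF fn[OF l] finite_lessThan e])
      also have "\<dots> = (\<Sum>j<k. if j = l then emb R (b l) * emb R t else 0)"
        by (rule sum.cong) (use delta l in auto)
      finally show ?thesis using l b[OF l] t unfolding p_def by (simp add: R.proj.h_mult)
    qed
    have "f (frac ?x u) = U"
    proof
      fix l show "f (frac ?x u) l = U l"
      proof (cases "l < k")
        case True
        have "rfrac (b l \<otimes> t) (t \<otimes> u) = rfrac (b l) u"
          by (rule rfrac_eqI[of _ _ _ _ "\<one>"]) (use b[OF True] t u in \<open>auto simp: R.m_ac\<close>)
        then show ?thesis unfolding f_frac[OF x u] using True px b by simp
      next
        case False
        then show ?thesis unfolding f_frac[OF x u] using U by (auto simp: free_module_simps)
      qed
    qed
    then show "U \<in> f ` carrier ?N" using x u by blast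
  qed
  have "bij_betw f (carrier ?N) (carrier ?F)"
    unfolding bij_betw_def using inj surj f_closed by blast
  moreover have "f (X \<oplus>\<^bsub>?N\<^esub> Y) = f X \<oplus>\<^bsub>?F\<^esub> f Y" if XY: "X \<in> carrier ?N" "Y \<in> carrier ?N" for X Y
  proof -
    obtain x u where x: "x \<in> carrier M" "u \<in> S" and X: "X = frac x u"
      using XY(1) by (rule loc_module_carrierE)
    obtain y w where y: "y \<in> carrier M" "w \<in> S" and Y: "Y = frac y w"
      using XY(2) by (rule loc_module_carrierE)
    show ?thesis
      unfolding X Y frac_add[OF x y]
    proof (subst f_frac)
      show "(\<lambda>l\<in>{..<k}. rfrac (p l (w \<odot>\<^bsub>M\<^esub> x \<oplus>\<^bsub>M\<^esub> u \<odot>\<^bsub>M\<^esub> y)) (t \<otimes> (u \<otimes> w)))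
          = f (frac x u) \<oplus>\<^bsub>?F\<^esub> f (frac y w)"
        unfolding f_frac[OF x] f_frac[OF y] free_module_simps
      proof (rule restrict_ext)
        fix l assume "l \<in> {..<k}"
        then have l: "l < k" by simp
        have "rfrac (w \<otimes> p l x \<oplus> u \<otimes> p l y) (t \<otimes> (u \<otimes> w))
            = rfrac ((t \<otimes> w) \<otimes> p l x \<oplus> (t \<otimes> u) \<otimes> p l y) ((t \<otimes> u) \<otimes> (t \<otimes> w))"
          by (rule rfrac_eqI[of _ _ _ _ "\<one>"])
            (use x y t in \<open>simp_all add: R.r_distr R.l_distr R.m_ac\<close>)
        then show "rfrac (p l (w \<odot>\<^bsub>M\<^esub> x \<oplus>\<^bsub>M\<^esub> u \<odot>\<^bsub>M\<^esub> y)) (t \<otimes> (u \<otimes> w))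
            = (\<lambda>l\<in>{..<k}. rfrac (p l x) (t \<otimes> u)) l \<oplus>\<^bsub>?L\<^esub> (\<lambda>l\<in>{..<k}. rfrac (p l y) (t \<otimes> w)) l"
          using l x y t by (simp add: p_add p_smult rfrac_add)
      qed
    qed (use x y in auto)
  qed
  moreover have "f (A \<odot>\<^bsub>?N\<^esub> X) = A \<odot>\<^bsub>?F\<^esub> f X" if AX: "A \<in> carrier ?L" "X \<in> carrier ?N" for A X
  proof -
    obtain a r where a: "a \<in> carrier R" "r \<in> S" and A: "A = rfrac a r"
      using AX(1) by (rule loc_ring_carrierE)
    obtain x u where x: "x \<in> carrier M" "u \<in> S" and X: "X = frac x u"
      using AX(2) by (rule loc_module_carrierE)
    show ?thesis
      unfolding A X frac_smult[OF a x]
    proof (subst f_frac)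
      show "(\<lambda>l\<in>{..<k}. rfrac (p l (a \<odot>\<^bsub>M\<^esub> x)) (t \<otimes> (r \<otimes> u))) = rfrac a r \<odot>\<^bsub>?F\<^esub> f (frac x u)"
        unfolding f_frac[OF x] free_module_simps
        by (rule restrict_ext) (use a x t in \<open>simp add: p_smult rfrac_mult R.m_lcomm\<close>)
    qed (use a x in auto)
  qed
  ultimately show ?thesis unfolding free_of_rank_def module_iso_def by blast
qed

end

section \<open>Constant rank and local freeness\<close>

lemma coeff_X_power_mult_add: "coeff ([:0, 1:] ^ a * p) (a + i) = coeff p i"
  for p :: "'a::comm_ring_1 poly"
  unfolding X_power_monom by (simp add: coeff_monom_mult)

lemma coeff_const_power_mult: "coeff ([:t:] ^ n * p) j = t ^ n * coeff p j"
  for p :: "'a::comm_ring_1 poly"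
  by (simp add: poly_const_pow)

lemma coeff_X_minus_1_power_0: "coeff ([:-1, 1:] ^ k) 0 = (-1 :: 'a::comm_ring_1) ^ k"
  by (simp add: coeff_0_power)

context cring
begin

lemma emb_power_Suc: "a \<in> carrier R \<Longrightarrow> emb R a ^ Suc n = emb R (a [^] Suc n)"
proof (induction n)
  case (Suc n)
  then have "emb R a ^ Suc (Suc n) = emb R (a [^] Suc n) * emb R a"
    by (metis power_Suc2)
  then show ?case using Suc.prems by (simp add: emb_mult_emb[symmetric])
qed simp

lemma nilpotent_emb:
  assumes "nilpotent_elem R a" "s \<in> carrier R"
  shows "nilpotent (emb R (s \<otimes> a))"
proof -
  obtain e where a: "a \<in> carrier R" and e: "a [^] (e :: nat) = \<zero>"
    using assms(1) unfolding nilpotent_elem_def by blast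
  have "(s \<otimes> a) [^] Suc e = \<zero>"
    using a e assms(2) by (simp add: nat_pow_distrib)
  then have "emb R (s \<otimes> a) ^ Suc e = 0" using emb_power_Suc[of "s \<otimes> a" e] a assms(2) by simp
  then show ?thesis unfolding nilpotent_def by blast
qed

end

context module
begin

lemma powers_localized:
  assumes s: "s \<in> carrier R"
  shows "localized_module R M (powers_of R s)"
proof (intro localized_module.intro localized_module_axioms.intro)
  show "module R M" ..
  show "powers_of R s \<subseteq> carrier R" unfolding powers_of_def using s by auto
  have "s [^] (0 :: nat) = \<one>" by simp
  then show "\<one> \<in> powers_of R s" unfolding powers_of_def by (metis rangeI)
  fix t u assume "t \<in> powers_of R s" "u \<in> powers_of R s"
  then obtain i j :: nat where "t = s [^] i" "u = s [^] j" unfolding powers_of_def by blast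
  then have "t \<otimes> u = s [^] (i + j)" using s by (simp add: R.nat_pow_mult)
  then show "t \<otimes> u \<in> powers_of R s" unfolding powers_of_def by blast
qed

lemma free_at_weak_local_basis:
  assumes s: "s \<in> carrier R" and free: "free_of_rank (ring_at R s) (module_at R M s) k"
  obtains e where "scalar.weak_local_basis (emb R s) k e"
proof -
  interpret L: localized_module R M "powers_of R s" using s by (rule powers_localized)
  obtain e where e: "e \<in> {..<k} \<rightarrow> carrier M"
    and gen: "\<And>x. x \<in> carrier M \<Longrightarrow> \<exists>v\<in>powers_of R s. \<exists>c. v \<odot>\<^bsub>M\<^esub> x = scalar.comb {..<k} c e"
    and ind: "\<And>a. scalar.comb {..<k} a e = \<zero>\<^bsub>M\<^esub> \<Longrightarrow> \<exists>v\<in>powers_of R s. \<forall>l<k. v \<otimes> proj R (a l) = \<zero>"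
    using L.free_of_rank_localization[OF free] by metis
  have pw: "proj R (emb R s ^ i) = s [^] i" for i using s by (simp add: R.proj.h_power)
  have "scalar.weak_local_basis (emb R s) k e"
    unfolding scalar.weak_local_basis_def
  proof (intro conjI ballI allI impI e)
    fix x assume "x \<in> carrier M"
    then obtain v c where "v \<in> powers_of R s" and vx: "v \<odot>\<^bsub>M\<^esub> x = scalar.comb {..<k} c e"
      using gen by blast
    then obtain i :: nat where "v = s [^] i" unfolding powers_of_def by blast
    then show "\<exists>N c. proj R (emb R s ^ N) \<odot>\<^bsub>M\<^esub> x = scalar.comb {..<k} c e"
      using vx pw by metis
  next
    fix a assume "scalar.comb {..<k} a e = \<zero>\<^bsub>M\<^esub>"
    then obtain v where "v \<in> powers_of R s" and v: "\<And>l. l < k \<Longrightarrow> v \<otimes> proj R (a l) = \<zero>"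
      using ind by blast
    then obtain i :: nat where i: "v = s [^] i" unfolding powers_of_def by blast
    have "emb R s ^ Suc i * a l = 0" if "l < k" for l
    proof -
      have "emb R s ^ Suc i * a l = emb R s * (emb R s ^ i * a l)" by (simp add: mult.assoc)
      also have "\<dots> = emb R (s \<otimes> proj R (emb R s ^ i * a l))" by (rule R.emb_mult[OF s])
      also have "proj R (emb R s ^ i * a l) = \<zero>" using v[OF that] i pw by (simp add: R.proj.h_mult)
      finally show ?thesis using s by simp
    qed
    then show "\<exists>N. \<forall>l<k. emb R s ^ N * a l = 0" by blast
  qed
  then show thesis by (rule that)
qed

lemma local_basis_free_at:
  assumes s: "s \<in> carrier R" and lb: "scalar.local_basis (emb R s ^ Suc N) {..<k} e \<psi>"
  shows "free_of_rank (ring_at R s) (module_at R M s) k"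
proof -
  interpret L: localized_module R M "powers_of R s" using s by (rule powers_localized)
  have "s [^] Suc N \<in> powers_of R s" unfolding powers_of_def by blast
  then show ?thesis using lb unfolding R.emb_power_Suc[OF s] by (rule L.local_basis_free_of_rank)
qed

text \<open>The second claim is stated for an arbitrary dual basis, since the rank condition concerns every
  idempotent matrix with image isomorphic to \<open>M\<close>. It says that \<open>X\<^sup>k det(X - G) = X\<^sup>q (X - 1)\<^sup>k\<close>: the
  difference is killed by a power of each \<open>s\<^sub>i\<close>.\<close>
lemma locally_free_fg_projective:
  fixes m :: nat
  assumes gen: "generated_by_n R M n"
    and s: "s \<in> {..<m} \<rightarrow> carrier R" and a: "a \<in> {..<m} \<rightarrow> carrier R"
    and one: "(\<Oplus>i\<in>{..<m}. s i \<otimes> a i) = \<one>"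
    and free: "\<And>i. i < m \<Longrightarrow> free_of_rank (ring_at R (s i)) (module_at R M (s i)) k"
  shows "fg_projective R M"
    and "scalar.dual_basis q w \<phi> \<Longrightarrow>
      proj R (coeff ([:0, 1:] ^ k * char_poly (scalar.coord_mat q w \<phi>) - [:0, 1:] ^ q * [:-1, 1:] ^ k) j) = \<zero>"
proof -
  obtain g where g: "scalar.generates n g" using generated_by_n_generates[OF gen] .
  have sR: "s i \<in> carrier R" and aR: "a i \<in> carrier R" if "i < m" for i using s a that by auto
  define E where "E = (\<Sum>i<m. emb R (a i) * emb R (s i))"
  have E: "E = emb R \<one>"
  proof -
    have "emb R (\<Oplus>i\<in>{..<m}. s i \<otimes> a i) = (\<Sum>i<m. emb R (s i \<otimes> a i))"
      by (rule R.emb_sum) (use sR aR in auto)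
    also have "\<dots> = E" unfolding E_def
      by (rule sum.cong) (use sR aR in \<open>simp_all add: R.emb_mult_emb mult.commute\<close>)
    finally show ?thesis unfolding one ..
  qed
  have Es: "E * emb R (s i) = emb R (s i)" if "i < m" for i
    unfolding E using sR[OF that] by (simp add: R.emb_mult)
  have EE: "E * E = E" unfolding E by (simp add: R.emb_mult)
  have "\<forall>i. \<exists>e. i < m \<longrightarrow> scalar.weak_local_basis (emb R (s i)) k e"
    using free_at_weak_local_basis[OF sR free] by metis
  then obtain e where e: "\<And>i. i < m \<Longrightarrow> scalar.weak_local_basis (emb R (s i)) k (e i)" by metis
  obtain N \<psi> where lb: "\<And>i. i \<in> {..<m} \<Longrightarrow> scalar.local_basis (emb R (s i) ^ Suc (N i)) {..<k} (e i) (\<psi> i)"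
    by (rule scalar.weak_local_bases_rectify[of "{..<m}" "\<lambda>i. emb R (a i)" "\<lambda>i. emb R (s i)" n g k e])
      (use Es g e in \<open>auto simp: E_def\<close>)
  obtain b where b: "(\<Sum>i<m. b i * emb R (s i) ^ Suc (N i)) = E"
    using comaximal_powers[OF finite_lessThan E_def[symmetric] EE] by blast
  obtain \<iota> where "scalar.dual_basis n g \<iota>"
  proof (rule scalar.dual_basis_of_local_bases[OF finite_lessThan g lb])
    show "proj R (\<Sum>i<m. b i * emb R (s i) ^ Suc (N i)) \<odot>\<^bsub>M\<^esub> x = x" if "x \<in> carrier M" for x
      unfolding b E using that by simp
  qed
  then show "fg_projective R M" by (rule dual_basis_imp_fg_projective)
  assume db: "scalar.dual_basis q w \<phi>"
  let ?d = "[:0, 1:] ^ k * char_poly (scalar.coord_mat q w \<phi>) - [:0, 1:] ^ q * [:-1, 1:] ^ k"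
  have "E * coeff ?d j = 0"
  proof (rule comaximal_vanish[OF finite_lessThan E_def[symmetric] EE])
    show "E * (E * coeff ?d j) = E * coeff ?d j" using EE by (simp add: mult.assoc[symmetric])
    fix i assume i: "i \<in> {..<m}"
    let ?t = "emb R (s i) ^ Suc (N i)"
    have "[:?t:] ^ (q + k) * ?d = 0"
      unfolding right_diff_distrib using scalar.char_poly_local_basis[OF db lb[OF i]] by simp
    then have "?t ^ (q + k) * coeff ?d j = 0"
      unfolding coeff_const_power_mult[symmetric] by (simp only: coeff_0)
    then have "emb R (s i) ^ (Suc (N i) * (q + k)) * coeff ?d j = 0" by (simp only: power_mult)
    then have "emb R (s i) ^ (Suc (N i) * (q + k)) * (E * coeff ?d j) = 0"
      by (simp only: mult.left_commute[of _ E] mult_zero_right)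
    then show "\<exists>M. emb R (s i) ^ M * (E * coeff ?d j) = 0" by blast
  qed
  then have "proj R (emb R \<one> * coeff ?d j) = \<zero>" unfolding E by (simp add: R.proj.h_zero)
  then show "proj R (coeff ?d j) = \<zero>" by (simp add: R.proj.h_mult)
qed

text \<open>The characteristic polynomial is even equal to \<open>(X - 1)\<^sup>k X\<^sup>q\<^sup>-\<^sup>k\<close>. If \<open>k > q\<close>, then the
  coefficient of \<open>X\<^sup>q\<close> in \<open>X\<^sup>k det(X - G) = X\<^sup>q (X - 1)\<^sup>k\<close> is both \<open>0\<close> and \<open>\<plusminus> 1\<close>.\<close>
lemma locally_free_constant_rank:
  fixes m :: nat
  assumes gen: "generated_by_n R M n"
    and s: "s \<in> {..<m} \<rightarrow> carrier R" and a: "a \<in> {..<m} \<rightarrow> carrier R"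
    and one: "(\<Oplus>i\<in>{..<m}. s i \<otimes> a i) = \<one>"
    and free: "\<And>i. i < m \<Longrightarrow> free_of_rank (ring_at R (s i)) (module_at R M (s i)) k"
  shows "projective_of_constant_rank R M k"
  unfolding projective_of_constant_rank_def
proof (intro conjI impI allI; (elim conjE)?)
  show "fg_projective R M" using locally_free_fg_projective(1)[OF assms] .
  fix q G
  assume nontriv: "carrier R \<noteq> {\<zero>}" and sq: "sq_matrix R q G" and idem: "idempotent_matrix R q G"
    and iso: "module_iso R M (mat_image R q G)"
  obtain w \<phi> where db: "scalar.dual_basis q w \<phi>" and G: "\<And>i j. i < q \<Longrightarrow> j < q \<Longrightarrow> proj R (\<phi> i (w j)) = G i j"
    by (rule mat_image_dual_basis[OF sq idem iso]) blast
  let ?\<chi> = "char_poly (scalar.coord_mat q w \<phi>)" and ?X = "[:0, 1:] :: ('a, 'b) cring_prod poly"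
    and ?L = "[:-1, 1:] :: ('a, 'b) cring_prod poly"
  have d: "proj R (coeff (?X ^ k * ?\<chi> - ?X ^ q * ?L ^ k) j) = \<zero>" for j
    by (rule locally_free_fg_projective(2)[OF assms db])
  show kq: "k \<le> q"
  proof (rule ccontr)
    assume "\<not> k \<le> q"
    then have "coeff (?X ^ k * ?\<chi>) q = 0" unfolding X_power_monom by (simp add: coeff_monom_mult)
    moreover have "coeff (?X ^ q * ?L ^ k) q = (-1) ^ k"
      using coeff_X_power_mult_add[of q "?L ^ k" 0] coeff_X_minus_1_power_0[of k] by simp
    ultimately have "proj R (- ((-1) ^ k)) = \<zero>" using d[of q] by simp
    then have "proj R ((- ((-1) ^ k)) * (- ((-1) ^ k))) = \<zero>" by (simp only: R.proj.h_mult R.l_null R.zero_closed)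
    then have "\<one> = \<zero>" by (simp add: R.proj.h_one power_mult_distrib[symmetric])
    then show False using nontriv R.one_zeroD by blast
  qed
  have \<chi>: "char_polynomial R q G = poly_proj R ?\<chi>"
    by (rule R.char_polynomial_poly_proj) (use G in \<open>auto simp: scalar.coord_mat_def\<close>)
  have "nilpotent_elem R (proj R (coeff (?\<chi> - ?L ^ k * ?X ^ (q - k)) i))" for i
  proof -
    have "?X ^ q = ?X ^ k * ?X ^ (q - k)" using kq by (simp add: power_add[symmetric])
    then have "?X ^ k * ?\<chi> - ?X ^ q * ?L ^ k = ?X ^ k * (?\<chi> - ?L ^ k * ?X ^ (q - k))"
      by (simp only: right_diff_distrib mult_ac)
    then have "proj R (coeff (?\<chi> - ?L ^ k * ?X ^ (q - k)) i) = \<zero>"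
      using d[of "k + i"] coeff_X_power_mult_add[of k "?\<chi> - ?L ^ k * ?X ^ (q - k)" i] by simp
    then show ?thesis unfolding nilpotent_elem_def by (auto intro: exI[of _ 1])
  qed
  then show "equal_up_to_nilpotents R (char_polynomial R q G)
      ((UP_X R \<ominus>\<^bsub>UP R\<^esub> \<one>\<^bsub>UP R\<^esub>) [^]\<^bsub>UP R\<^esub> k \<otimes>\<^bsub>UP R\<^esub> UP_X R [^]\<^bsub>UP R\<^esub> (q - k))"
    unfolding \<chi> R.rank_polynomial_poly_proj R.equal_up_to_nilpotents_poly_proj by blast
qed

text \<open>The elements \<open>s\<^sub>i\<close> are the principal minors of order \<open>k\<close> of the matrix of a dual basis on the \<open>n\<close>
  generators. Up to sign, their sum is a coefficient of the characteristic polynomial, which the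
  rank condition determines up to a nilpotent; so it is a unit, and its inverse is the common value
  of the \<open>a\<^sub>i\<close>.\<close>
lemma constant_rank_locally_free:
  assumes gen: "generated_by_n R M n" and rank: "projective_of_constant_rank R M k"
    and nontriv: "carrier R \<noteq> {\<zero>}"
  obtains s a where "s \<in> {..<n choose k} \<rightarrow> carrier R" and "a \<in> {..<n choose k} \<rightarrow> carrier R"
    and "(\<Oplus>i\<in>{..<n choose k}. s i \<otimes> a i) = \<one>"
    and "\<And>i. i < n choose k \<Longrightarrow> free_of_rank (ring_at R (s i)) (module_at R M (s i)) k"
proof -
  obtain g where g: "scalar.generates n g" using generated_by_n_generates[OF gen] .
  obtain q w \<phi> where "scalar.dual_basis q w \<phi>"
    using rank fg_projective_imp_dual_basis unfolding projective_of_constant_rank_def by metis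
  then obtain \<iota> where db: "scalar.dual_basis n g \<iota>"
    using scalar.dual_basis_change_generators g by metis
  define G where "G = scalar.coord_mat n g \<iota>"
  have G: "G \<in> carrier_mat n n" unfolding G_def by simp
  let ?X = "[:0, 1:] :: ('a, 'b) cring_prod poly" and ?L = "[:-1, 1:] :: ('a, 'b) cring_prod poly"
  let ?\<nu> = "char_poly G - ?L ^ k * ?X ^ (n - k)"
  have \<chi>: "char_polynomial R n (\<lambda>i j. proj R (\<iota> i (g j))) = poly_proj R (char_poly G)"
    by (rule R.char_polynomial_poly_proj[OF G]) (auto simp: G_def scalar.coord_mat_def)
  have "sq_matrix R q G \<and> idempotent_matrix R q G \<and> module_iso R M (mat_image R q G) \<longrightarrow>
      k \<le> q \<and> equal_up_to_nilpotents R (char_polynomial R q G)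
        ((UP_X R \<ominus>\<^bsub>UP R\<^esub> \<one>\<^bsub>UP R\<^esub>) [^]\<^bsub>UP R\<^esub> k \<otimes>\<^bsub>UP R\<^esub> UP_X R [^]\<^bsub>UP R\<^esub> (q - k))" for q G
    using rank[unfolded projective_of_constant_rank_def, THEN conjunct2, THEN mp, OF nontriv, THEN spec, THEN spec] .
  from this[of n "\<lambda>i j. proj R (\<iota> i (g j))"] dual_basis_mat_image[OF db]
  have "k \<le> n \<and> equal_up_to_nilpotents R (poly_proj R (char_poly G)) (poly_proj R (?L ^ k * ?X ^ (n - k)))"
    unfolding \<chi> R.rank_polynomial_poly_proj by (simp only: simp_thms)
  then have kn: "k \<le> n" and nil: "\<And>i. nilpotent_elem R (proj R (coeff ?\<nu> i))"
    unfolding R.equal_up_to_nilpotents_poly_proj by blast+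
  define \<sigma> where "\<sigma> S = det (principal_minor_mat G S)" for S
  let ?SS = "{S. S \<subseteq> {0..<n} \<and> card S = k}"
  have fin: "finite ?SS" by (rule finite_subset[of _ "Pow {0..<n}"]) auto
  have "card ?SS = n choose k" using n_subsets[of "{0..<n}" k] by simp
  then obtain h where h: "bij_betw h {..<n choose k} ?SS"
    using ex_bij_betw_nat_finite[OF fin] by (auto simp: atLeast0LessThan)
  have hS: "h i \<subseteq> {0..<n}" "card (h i) = k" if "i < n choose k" for i
    using bij_betw_apply[OF h, of i] that by auto
  define u where "u = proj R ((-1) ^ k * coeff ?\<nu> (n - k))"
  have sum_\<sigma>: "(\<Sum>i<n choose k. \<sigma> (h i)) = 1 + (-1) ^ k * coeff ?\<nu> (n - k)"
  proof -
    have "(\<Sum>i<n choose k. \<sigma> (h i)) = sum \<sigma> ?SS" by (rule sum.reindex_bij_betw[OF h])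
    moreover have "coeff (char_poly G) (n - k) = (-1) ^ k * sum \<sigma> ?SS"
      unfolding \<sigma>_def by (rule coeff_char_poly_principal_minors[OF G kn])
    moreover have "coeff (?L ^ k * ?X ^ (n - k)) (n - k) = (-1) ^ k"
      using coeff_X_power_mult_add[of "n - k" "?L ^ k" 0] coeff_X_minus_1_power_0[of k]
      by (simp add: mult.commute)
    ultimately show ?thesis
      by (simp add: right_diff_distrib mult.assoc[symmetric] power_mult_distrib[symmetric])
  qed
  have "nilpotent (emb R u)"
    unfolding u_def R.proj.h_mult by (rule R.nilpotent_emb[OF nil]) simp
  then obtain b where b: "(1 + emb R u) * b = 1" by (rule one_plus_nilpotent_unit)
  have "proj R ((\<Sum>i<n choose k. \<sigma> (h i)) * b) = proj R ((1 + emb R u) * b)"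
    unfolding sum_\<sigma> R.proj.h_mult R.proj.h_add by (simp add: u_def R.proj.h_mult)
  then have one: "(\<Oplus>i\<in>{..<n choose k}. proj R (\<sigma> (h i)) \<otimes> proj R b) = \<one>"
    unfolding b sum_distrib_right R.proj.h_sum[OF finite_lessThan] R.proj.h_mult R.proj.h_one .
  show thesis
  proof (rule that[of "\<lambda>i. proj R (\<sigma> (h i))" "\<lambda>i. proj R b"])
    show "(\<Oplus>i\<in>{..<n choose k}. proj R (\<sigma> (h i)) \<otimes> proj R b) = \<one>" by (rule one)
    fix i assume i: "i < n choose k"
    let ?s = "proj R (\<sigma> (h i))" and ?P = "principal_minor_mat G (h i)"
    have P: "?P \<in> carrier_mat n n" using G by (simp add: principal_minor_mat_def)
    have s: "emb R ?s = emb R \<one> * \<sigma> (h i)" by (simp add: R.emb_mult)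
    \<comment> \<open>The factor \<open>emb R \<one>\<close> discards the components of the adjugate in the other factors of the product.\<close>
    have D: "emb R \<one> \<cdot>\<^sub>m adj_mat ?P \<in> carrier_mat n n" using adj_mat(1)[OF P] by simp
    have "emb R \<one> \<cdot>\<^sub>m adj_mat ?P * ?P = emb R \<one> \<cdot>\<^sub>m (adj_mat ?P * ?P)"
      by (rule mult_smult_assoc_mat[OF adj_mat(1)[OF P] P])
    also have "\<dots> = emb R ?s \<cdot>\<^sub>m 1\<^sub>m n"
      unfolding adj_mat(3)[OF P] \<sigma>_def[symmetric] s by (intro eq_matI) auto
    finally have inv: "emb R \<one> \<cdot>\<^sub>m adj_mat ?P * ?P = emb R ?s \<cdot>\<^sub>m 1\<^sub>m n" .
    have "nilpotent_coeffs ([:emb R ?s:] * (char_poly G - ?X ^ (n - k) * ?L ^ k))"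
      unfolding nilpotent_coeffs_def
    proof
      fix j
      have "coeff ([:emb R ?s:] * (char_poly G - ?X ^ (n - k) * ?L ^ k)) j = emb R ?s * coeff ?\<nu> j"
        by (simp add: mult.commute)
      also have "\<dots> = emb R (?s \<otimes> proj R (coeff ?\<nu> j))" by (rule R.emb_mult) simp
      finally show "nilpotent (coeff ([:emb R ?s:] * (char_poly G - ?X ^ (n - k) * ?L ^ k)) j)"
        using R.nilpotent_emb[OF nil[of j], of ?s] by simp
    qed
    then obtain N e \<psi> where "scalar.local_basis (emb R ?s ^ Suc N) {..<k} e \<psi>"
      using scalar.local_basis_of_principal_minor[OF db hS[OF i] D] inv unfolding G_def by metis
    then show "free_of_rank (ring_at R ?s) (module_at R M ?s) k"
      by (rule local_basis_free_at[rotated]) simp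
  qed auto
qed

end

theorem mainTheorem4:
  fixes A :: "('a, 'r) ring_scheme" and M :: "('a, 'b, 'm) module_scheme" and n k :: nat
  assumes "cring A" and "module A M" and "generated_by_n A M n"
  shows "projective_of_constant_rank A M k \<longleftrightarrow>
    (\<exists>m \<le> n choose k. \<exists>s \<in> {..<m} \<rightarrow> carrier A.
      {\<Oplus>\<^bsub>A\<^esub>i\<in>{..<m}. s i \<otimes>\<^bsub>A\<^esub> a i | a. a \<in> {..<m} \<rightarrow> carrier A} = carrier A \<and>
      (\<forall>i<m. free_of_rank (ring_at A (s i)) (module_at A M (s i)) k))"
    (is "_ \<longleftrightarrow> ?local")
proof -
  interpret module A M by fact
  show ?thesis
  proof
    assume rank: "projective_of_constant_rank A M k"
    show ?local
    proof (cases "carrier A = {\<zero>\<^bsub>A\<^esub>}")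
      case True
      then show ?thesis by (intro exI[of _ 0] conjI bexI[of _ "\<lambda>i. \<zero>\<^bsub>A\<^esub>"]) auto
    next
      case False
      obtain s a where s: "s \<in> {..<n choose k} \<rightarrow> carrier A" and a: "a \<in> {..<n choose k} \<rightarrow> carrier A"
        and one: "(\<Oplus>\<^bsub>A\<^esub>i\<in>{..<n choose k}. s i \<otimes>\<^bsub>A\<^esub> a i) = \<one>\<^bsub>A\<^esub>"
        and free: "\<And>i. i < n choose k \<Longrightarrow> free_of_rank (ring_at A (s i)) (module_at A M (s i)) k"
        by (rule constant_rank_locally_free[OF assms(3) rank False]) blast
      have "{\<Oplus>\<^bsub>A\<^esub>i\<in>{..<n choose k}. s i \<otimes>\<^bsub>A\<^esub> c i | c. c \<in> {..<n choose k} \<rightarrow> carrier A} = carrier A"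
      proof (intro equalityI subsetI)
        fix y assume "y \<in> {\<Oplus>\<^bsub>A\<^esub>i\<in>{..<n choose k}. s i \<otimes>\<^bsub>A\<^esub> c i | c. c \<in> {..<n choose k} \<rightarrow> carrier A}"
        then obtain c where c: "c \<in> {..<n choose k} \<rightarrow> carrier A"
          and y: "y = (\<Oplus>\<^bsub>A\<^esub>i\<in>{..<n choose k}. s i \<otimes>\<^bsub>A\<^esub> c i)" by blast
        show "y \<in> carrier A"
          unfolding y by (rule R.finsum_closed) (use s c in \<open>auto simp: Pi_def\<close>)
      next
        fix y assume y: "y \<in> carrier A"
        have "y = (\<Oplus>\<^bsub>A\<^esub>i\<in>{..<n choose k}. s i \<otimes>\<^bsub>A\<^esub> a i) \<otimes>\<^bsub>A\<^esub> y" unfolding one using y by simp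
        also have "\<dots> = (\<Oplus>\<^bsub>A\<^esub>i\<in>{..<n choose k}. s i \<otimes>\<^bsub>A\<^esub> a i \<otimes>\<^bsub>A\<^esub> y)"
          by (rule R.finsum_ldistr) (use s a y in \<open>auto simp: Pi_def\<close>)
        also have "\<dots> = (\<Oplus>\<^bsub>A\<^esub>i\<in>{..<n choose k}. s i \<otimes>\<^bsub>A\<^esub> (a i \<otimes>\<^bsub>A\<^esub> y))"
          by (rule R.finsum_cong') (use s a y in \<open>auto simp: Pi_def R.m_assoc\<close>)
        finally have "y = (\<Oplus>\<^bsub>A\<^esub>i\<in>{..<n choose k}. s i \<otimes>\<^bsub>A\<^esub> (a i \<otimes>\<^bsub>A\<^esub> y))" .
        moreover have "(\<lambda>i. a i \<otimes>\<^bsub>A\<^esub> y) \<in> {..<n choose k} \<rightarrow> carrier A" using a y by (auto simp: Pi_def)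
        ultimately show "y \<in> {\<Oplus>\<^bsub>A\<^esub>i\<in>{..<n choose k}. s i \<otimes>\<^bsub>A\<^esub> c i | c. c \<in> {..<n choose k} \<rightarrow> carrier A}"
          unfolding mem_Collect_eq by (intro exI[of _ "\<lambda>i. a i \<otimes>\<^bsub>A\<^esub> y"] conjI)
      qed
      then show ?thesis using s free by (intro exI[of _ "n choose k"] conjI bexI[of _ s]) simp_all
    qed
  next
    assume ?local
    then obtain m :: nat and s where s: "s \<in> {..<m} \<rightarrow> carrier A"
      and span: "{\<Oplus>\<^bsub>A\<^esub>i\<in>{..<m}. s i \<otimes>\<^bsub>A\<^esub> a i | a. a \<in> {..<m} \<rightarrow> carrier A} = carrier A"
      and free: "\<And>i. i < m \<Longrightarrow> free_of_rank (ring_at A (s i)) (module_at A M (s i)) k"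
      by blast
    have "\<one>\<^bsub>A\<^esub> \<in> {\<Oplus>\<^bsub>A\<^esub>i\<in>{..<m}. s i \<otimes>\<^bsub>A\<^esub> a i | a. a \<in> {..<m} \<rightarrow> carrier A}"
      unfolding span by simp
    then obtain a where a: "a \<in> {..<m} \<rightarrow> carrier A" and one: "(\<Oplus>\<^bsub>A\<^esub>i\<in>{..<m}. s i \<otimes>\<^bsub>A\<^esub> a i) = \<one>\<^bsub>A\<^esub>"
      by force
    show "projective_of_constant_rank A M k"
      by (rule locally_free_constant_rank[OF assms(3) s a one free])
  qed
qed

end
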